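(* Let $T>0$, $\theta\in[0,1]$. Assume that $\int_{\mathbb R}|z|^p\lambda(dz)<\infty$ for all $p\in[1,3)$, that the step sizes satisfy the step-size condition (S) stated in the context, and that $\sigma$ is bounded. Then for every $r<-\frac12$ the family of numerical solutions $\{u^{n,\tau}\}_{n,\tau}$, indexed by all admissible pairs $(n,\tau)$ (integers $n\ge3$ and $\tau\in(0,\frac12)$ satisfying (S)), is weakly relatively compact in the Skorohod space $D([0,T];H^r)$; that is, the family of laws of $u^{n,\tau}$ on $D([0,T];H^r)$ is relatively compact for the topology of weak convergence of probability measures.
   Context: Equation. The scheme discretizes the stochastic heat equation $\partial_tu=\partial_x^2u+\sigma(u)\dot\Lambda$ on $[0,1]$ with periodic boundary condition and $u(0,\cdot)=u_0$, where $\sigma:\mathbb R\to\mathbb R$ is globally Lipschitz and $u_0:[0,1]\to\mathbb R$ is bounded, non-negative, non-random and measurable. Noise. On a complete filtered probability space, $$\Lambda(dt,dx)=b\,dt\,dx+\int_{\{|z|\le1\}}z\,\tilde\mu(dt,dx,dz)+\int_{\{|z|>1\}}z\,\mu(dt,dx,dz),$$ where $b\in\mathbb R$, $\mu$ is a Poisson random measure on $(0,\infty)\times[0,1]\times\mathbb R$ with intensity measure $dt\,dx\,\lambda(dz)$, $\tilde\mu$ is its compensated version, and $\lambda$ is a Lévy measure on $\mathbb R$ that is not identically zero: $\lambda(\{0\})=0$, $\int_{\mathbb R}(1\wedge|z|^2)\lambda(dz)<\infty$. Scheme. Let $n\ge3$ be an integer, $\tau\in(0,\frac12)$, $t_i=i\tau$,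 $x_j=\frac jn$, $\kappa_n(y)=\frac{[ny]}n$ ($[\cdot]$ is the greatest integer function). The fully discrete scheme is $$u^{n,\tau}(t_{i+1},x_j)=u^{n,\tau}(t_i,x_j)+(1-\theta)\tau\Delta_nu^{n,\tau}(t_i,\cdot)(x_j)+\theta\tau\Delta_nu^{n,\tau}(t_{i+1},\cdot)(x_j)+n\,\sigma(u^{n,\tau}(t_i,x_j))\,\Lambda([t_i,t_{i+1})\times[x_j,x_{j+1})),$$ $j=0,\dots,n-1$, with $u^{n,\tau}(t_i,0)=u^{n,\tau}(t_i,1)$, $u^{n,\tau}(t_i,-\frac1n)=u^{n,\tau}(t_i,\frac{n-1}n)$, $u^{n,\tau}(0,x_j)=u_0(x_j)$, and $\Delta_nv(x_j)=n^2(v(x_{j+1})-2v(x_j)+v(x_{j-1}))$. It is extended to all $t\ge0$, $x\in[0,1]$ by $u^{n,\tau}(t,x)=u^{n,\tau}(t_i,\kappa_n(x))$ for $t\in[t_i,t_{i+1})$; $u^{n,\tau}(t)$ denotes the function $x\mapsto u^{n,\tau}(t,x)$. Step-size condition (S). (i) If $0\le\theta<\frac12$: $n^2\tau\le\rho<\frac1{2-4\theta}$ for some fixed constant $\rho>0$. (ii) If $\theta=\frac12$: $n^2\tau\le\frac1\epsilon-\frac12$ for a fixed $\epsilon\in(0,\frac12)$. (iii) If $\frac12<\theta\le1$: no coupling requirement on $n,\tau$. Spaces. For $r\in\mathbb R$, $H^r$ is the periodic Sobolev space on $[0,1]$ with norm $\|v\|_{H^r}=\big(\sum_{k\in\mathbb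 Z}(1+4\pi^2k^2)^r|c_k(v)|^2\big)^{1/2}$, $c_k(v)=\int_0^1v(y)e^{-2\pi\mathbf iky}dy$. $D([0,T];H^r)$ is the space of càdlàg functions $[0,T]\to H^r$ with the Skorohod topology.
   Formalization: D([0,T];H^r) carries the Skorohod topology of paths extended as constants after T (time changes need not fix T); with time changes fixing T the claim fails, e.g. θ=0, σ=0, n=3, non-constant u_0, mτ increasing to T. *)

theory Defs
  imports "HOL-Probability.Probability"
begin

section \<open>The periodic Sobolev spaces\<close>

definition fourier_coeff :: "(real \<Rightarrow> complex) \<Rightarrow> int \<Rightarrow> complex" where
  "fourier_coeff v k =
     (LINT y:{0..1}|lborel. v y * exp (- (2 * of_real pi * \<i> * of_int k * of_real y)))"

definition sobolev_weight :: "real \<Rightarrow> int \<Rightarrow> real" where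
  "sobolev_weight r k = (1 + 4 * pi\<^sup>2 * (of_int k)\<^sup>2) powr r"

definition sobolev_norm :: "real \<Rightarrow> (int \<Rightarrow> complex) \<Rightarrow> real" where
  "sobolev_norm r c = sqrt (\<Sum>\<^sub>\<infinity>k. sobolev_weight r k * (cmod (c k))\<^sup>2)"

text \<open>A periodic distribution is represented by its family of Fourier coefficients; a function
  \<open>v\<close> on the unit interval is the element \<open>fourier_coeff v\<close>. For negative \<open>r\<close> the space contains
  families that are not the coefficients of any function.\<close>

definition sobolev_carrier :: "real \<Rightarrow> (int \<Rightarrow> complex) set" where
  "sobolev_carrier r = {c. (\<lambda>k. sobolev_weight r k * (cmod (c k))\<^sup>2) summable_on UNIV}"

definition sobolev_dist :: "real \<Rightarrow> (int \<Rightarrow> complex) \<Rightarrow> (int \<Rightarrow> complex) \<Rightarrow> real" where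
  "sobolev_dist r c d = sobolev_norm r (\<lambda>k. c k - d k)"

definition sobolev :: "real \<Rightarrow> (int \<Rightarrow> complex) metric" where
  "sobolev r = metric (sobolev_carrier r, sobolev_dist r)"

lemma sobolev_weight_pos: "sobolev_weight r k > 0"
proof -
  have "1 + 4 * pi\<^sup>2 * (of_int k)\<^sup>2 > (0::real)"
    by (rule add_pos_nonneg) auto
  then show ?thesis by (simp add: sobolev_weight_def)
qed

lemma sobolev_sum_le:
  assumes "c \<in> sobolev_carrier r" "finite A"
  shows "L2_set (\<lambda>k. sqrt (sobolev_weight r k) * cmod (c k)) A \<le> sobolev_norm r c"
proof -
  have "(\<Sum>k\<in>A. sobolev_weight r k * (cmod (c k))\<^sup>2)
      \<le> (\<Sum>\<^sub>\<infinity>k. sobolev_weight r k * (cmod (c k))\<^sup>2)"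
    using assms less_imp_le[OF sobolev_weight_pos[of r]]
    by (intro finite_sum_le_infsum) (auto simp: sobolev_carrier_def)
  then show ?thesis
    using sobolev_weight_pos[of r]
    by (simp add: L2_set_def sobolev_norm_def power_mult_distrib less_imp_le)
qed

lemma sobolev_bounded:
  assumes "\<And>A. finite A \<Longrightarrow> L2_set (\<lambda>k. sqrt (sobolev_weight r k) * cmod (c k)) A \<le> B"
  shows "c \<in> sobolev_carrier r" "sobolev_norm r c \<le> B"
proof -
  have B: "B \<ge> 0" using assms[of "{}"] by simp
  have fin: "(\<Sum>k\<in>A. sobolev_weight r k * (cmod (c k))\<^sup>2) \<le> B\<^sup>2" if "finite A" for A
  proof -
    have "(L2_set (\<lambda>k. sqrt (sobolev_weight r k) * cmod (c k)) A)\<^sup>2 \<le> B\<^sup>2"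
      using assms[OF that] by (intro power_mono) (auto simp: L2_set_nonneg)
    moreover have "(L2_set (\<lambda>k. sqrt (sobolev_weight r k) * cmod (c k)) A)\<^sup>2
        = (\<Sum>k\<in>A. sobolev_weight r k * (cmod (c k))\<^sup>2)"
      using sobolev_weight_pos[of r]
      by (simp add: L2_set_def power_mult_distrib less_imp_le sum_nonneg)
    ultimately show ?thesis by simp
  qed
  have sm: "(\<lambda>k. sobolev_weight r k * (cmod (c k))\<^sup>2) summable_on UNIV"
    using sobolev_weight_pos[of r] fin
    by (intro nonneg_bdd_above_summable_on) (auto simp: less_imp_le intro!: bdd_aboveI[of _ "B\<^sup>2"])
  then show "c \<in> sobolev_carrier r" by (simp add: sobolev_carrier_def)
  have "(\<Sum>\<^sub>\<infinity>k. sobolev_weight r k * (cmod (c k))\<^sup>2) \<le> B\<^sup>2"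
    using sm fin by (intro infsum_le_finite_sums) auto
  then show "sobolev_norm r c \<le> B"
    using B by (simp add: sobolev_norm_def real_le_lsqrt)
qed

lemma sobolev_diff:
  assumes "c \<in> sobolev_carrier r" "d \<in> sobolev_carrier r"
  shows "(\<lambda>k. c k - d k) \<in> sobolev_carrier r"
    "sobolev_norm r (\<lambda>k. c k - d k) \<le> sobolev_norm r c + sobolev_norm r d"
proof -
  have "L2_set (\<lambda>k. sqrt (sobolev_weight r k) * cmod (c k - d k)) A
      \<le> sobolev_norm r c + sobolev_norm r d" if "finite A" for A
  proof -
    have "L2_set (\<lambda>k. sqrt (sobolev_weight r k) * cmod (c k - d k)) A
      \<le> L2_set (\<lambda>k. sqrt (sobolev_weight r k) * cmod (c k)
            + sqrt (sobolev_weight r k) * cmod (d k)) A"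
    proof (rule L2_set_mono)
      fix k
      have "sqrt (sobolev_weight r k) * cmod (c k - d k)
          \<le> sqrt (sobolev_weight r k) * (cmod (c k) + cmod (d k))"
        using sobolev_weight_pos[of r k] by (intro mult_left_mono norm_triangle_ineq4) simp
      then show "sqrt (sobolev_weight r k) * cmod (c k - d k)
          \<le> sqrt (sobolev_weight r k) * cmod (c k) + sqrt (sobolev_weight r k) * cmod (d k)"
        by (simp add: distrib_left)
    qed (use sobolev_weight_pos[of r] in \<open>simp add: less_imp_le\<close>)
    also have "\<dots> \<le> L2_set (\<lambda>k. sqrt (sobolev_weight r k) * cmod (c k)) A
         + L2_set (\<lambda>k. sqrt (sobolev_weight r k) * cmod (d k)) A"
      by (rule L2_set_triangle_ineq)
    also have "\<dots> \<le> sobolev_norm r c + sobolev_norm r d"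
      using assms that by (intro add_mono sobolev_sum_le)
    finally show ?thesis .
  qed
  from sobolev_bounded[of r "\<lambda>k. c k - d k", OF this]
  show "(\<lambda>k. c k - d k) \<in> sobolev_carrier r"
    "sobolev_norm r (\<lambda>k. c k - d k) \<le> sobolev_norm r c + sobolev_norm r d"
    by simp_all
qed

lemma Metric_space_sobolev: "Metric_space (sobolev_carrier r) (sobolev_dist r)"
proof
  show "0 \<le> sobolev_dist r x y" for x y
    using sobolev_weight_pos[of r]
    by (auto simp: sobolev_dist_def sobolev_norm_def less_imp_le intro!: infsum_nonneg)
  show comm: "sobolev_dist r x y = sobolev_dist r y x" for x y
    by (simp add: sobolev_dist_def sobolev_norm_def norm_minus_commute)
  show "sobolev_dist r x z \<le> sobolev_dist r x y + sobolev_dist r y z"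
    if "x \<in> sobolev_carrier r" "y \<in> sobolev_carrier r" "z \<in> sobolev_carrier r" for x y z
    using sobolev_diff(2)[OF sobolev_diff(1)[OF that(1,2)] sobolev_diff(1)[OF that(3,2)]]
      comm[of z y] by (simp add: sobolev_dist_def)
  show "sobolev_dist r x y = 0 \<longleftrightarrow> x = y"
    if "x \<in> sobolev_carrier r" "y \<in> sobolev_carrier r" for x y
  proof
    assume "sobolev_dist r x y = 0"
    then have "L2_set (\<lambda>k. sqrt (sobolev_weight r k) * cmod (x k - y k)) {k} \<le> 0" for k
      using sobolev_sum_le[OF sobolev_diff(1)[OF that], of "{k}"] by (simp add: sobolev_dist_def)
    then have "\<bar>sqrt (sobolev_weight r k) * cmod (x k - y k)\<bar> \<le> 0" for k
      by (simp add: L2_set_def)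
    then have "sobolev_weight r k = 0 \<or> x k = y k" for k
      by simp
    then have "x k = y k" for k
      using sobolev_weight_pos[of r k] by (metis less_irrefl)
    then show "x = y" ..
  qed (simp add: sobolev_dist_def sobolev_norm_def)
qed

lemma mspace_sobolev [simp]: "mspace (sobolev r) = sobolev_carrier r"
  and mdist_sobolev [simp]: "mdist (sobolev r) = sobolev_dist r"
  by (simp_all add: sobolev_def Metric_space.mspace_metric Metric_space.mdist_metric
      Metric_space_sobolev)


section \<open>The Skorohod space\<close>

definition cadlag_on :: "'a metric \<Rightarrow> real \<Rightarrow> (real \<Rightarrow> 'a) \<Rightarrow> bool" where
  "cadlag_on m T f \<longleftrightarrow>
     (\<forall>t\<in>{0..<T}. limitin (mtopology_of m) f (f t) (at_right t)) \<and>
     (\<forall>t\<in>{0<..T}. \<exists>l. limitin (mtopology_of m) f l (at_left t))"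

definition skorohod_carrier :: "'a metric \<Rightarrow> real \<Rightarrow> (real \<Rightarrow> 'a) set" where
  "skorohod_carrier m T = {f \<in> {0..T} \<rightarrow>\<^sub>E mspace m. cadlag_on m T f}"

definition time_change :: "(real \<Rightarrow> real) \<Rightarrow> bool" where
  "time_change l \<longleftrightarrow> strict_mono_on {0..} l \<and> l ` {0..} = {0..}"

text \<open>Convention at the right end point: a path on \<open>{0..T}\<close> is identified with the path on
  \<open>{0..}\<close> that is constant from time \<open>T\<close> on, and the topology is the one inherited from the
  Skorohod (J1) topology on \<open>{0..}\<close>, so time changes need not fix \<open>T\<close>. Jump times may thus
  converge to \<open>T\<close> from the left. If time changes were required to fix \<open>T\<close>, then the indicators
  of \<open>{s..T}\<close> would have no limit point as \<open>s\<close> increases to \<open>T\<close>. The schemes do produce such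
  paths: with \<open>n\<close> fixed and \<open>\<tau>\<close> increasing to \<open>T / m\<close>, the \<open>m\<close>-th grid time increases to \<open>T\<close>.\<close>

definition skorohod_close ::
    "'a metric \<Rightarrow> real \<Rightarrow> (real \<Rightarrow> 'a) \<Rightarrow> (real \<Rightarrow> 'a) \<Rightarrow> real \<Rightarrow> bool" where
  "skorohod_close m T f g e \<longleftrightarrow> (\<exists>l. time_change l \<and>
     (\<forall>t\<ge>0. \<bar>l t - t\<bar> \<le> e \<and> mdist m (f (min t T)) (g (min (l t) T)) \<le> e))"

definition skorohod_dist :: "'a metric \<Rightarrow> real \<Rightarrow> (real \<Rightarrow> 'a) \<Rightarrow> (real \<Rightarrow> 'a) \<Rightarrow> real" where
  "skorohod_dist m T f g =
     (if f \<in> skorohod_carrier m T \<and> g \<in> skorohod_carrier m T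
      then Inf {e. skorohod_close m T f g e} else 0)"

definition skorohod_topology :: "'a metric \<Rightarrow> real \<Rightarrow> (real \<Rightarrow> 'a) topology" where
  "skorohod_topology m T = mtopology_of (metric (skorohod_carrier m T, skorohod_dist m T))"

lemma time_change_id: "time_change (\<lambda>t. t)"
  by (auto simp: time_change_def strict_mono_on_def)

lemma time_change_nonneg: "time_change l \<Longrightarrow> t \<ge> 0 \<Longrightarrow> l t \<ge> 0"
  by (auto simp: time_change_def)

lemma time_change_comp:
  assumes "time_change l" "time_change k"
  shows "time_change (\<lambda>t. k (l t))"
proof -
  have "(\<lambda>t. k (l t)) ` {0..} = k ` (l ` {0..})" by (simp add: image_image)
  then have "(\<lambda>t. k (l t)) ` {0..} = {0..}" using assms by (simp add: time_change_def)
  moreover have "strict_mono_on {0..} (\<lambda>t. k (l t))"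
  proof (rule strict_mono_onI)
    fix s t :: real assume st: "s \<in> {0..}" "t \<in> {0..}" "s < t"
    then have "l s < l t"
      using assms(1) by (simp add: time_change_def strict_mono_on_def)
    moreover have "l s \<ge> 0" "l t \<ge> 0" using time_change_nonneg[OF assms(1)] st by auto
    ultimately show "k (l s) < k (l t)"
      using assms(2) by (simp add: time_change_def strict_mono_on_def)
  qed
  ultimately show ?thesis by (simp add: time_change_def)
qed

lemma time_change_inv:
  assumes "time_change l"
  obtains k where "time_change k" "\<And>t. t \<ge> 0 \<Longrightarrow> l (k t) = t"
proof -
  let ?k = "the_inv_into {0..} l"
  have inj: "inj_on l {0..}" and im: "l ` {0..} = {0..}"
    using assms by (simp_all add: time_change_def strict_mono_on_imp_inj_on)
  have r: "l (?k t) = t" if "t \<ge> 0" for t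
    using f_the_inv_into_f[OF inj, of t] that im by simp
  have in0: "?k t \<ge> 0" if "t \<ge> 0" for t
    using the_inv_into_into[OF inj, of t "{0..}"] that im by auto
  have "strict_mono_on {0..} ?k"
  proof (rule strict_mono_onI)
    fix s t :: real assume st: "s \<in> {0..}" "t \<in> {0..}" "s < t"
    show "?k s < ?k t"
    proof (rule ccontr)
      assume "\<not> ?k s < ?k t"
      then consider "?k t < ?k s" | "?k t = ?k s" by linarith
      then have "l (?k t) \<le> l (?k s)"
      proof cases
        case 1
        have "strict_mono_on {0..} l" using assms by (simp add: time_change_def)
        from strict_mono_onD[OF this _ _ 1] show ?thesis using in0[of s] in0[of t] st by simp
      qed simp
      then show False using r[of s] r[of t] st by auto
    qed
  qed
  moreover have "?k ` {0..} = {0..}"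
    using the_inv_into_onto[OF inj] im by simp
  ultimately have "time_change ?k" by (simp add: time_change_def)
  then show ?thesis using that r by blast
qed

lemma skorohod_mem:
  "f \<in> skorohod_carrier m T \<Longrightarrow> t \<ge> 0 \<Longrightarrow> T > 0 \<Longrightarrow> f (min t T) \<in> mspace m"
  by (auto simp: skorohod_carrier_def PiE_iff)

lemma skorohod_close_commute:
  assumes "skorohod_close m T f g e"
  shows "skorohod_close m T g f e"
proof -
  interpret Metric_space "mspace m" "mdist m" by (rule Metric_space_mspace_mdist)
  from assms obtain l where l: "time_change l"
    "\<And>t. t \<ge> 0 \<Longrightarrow> \<bar>l t - t\<bar> \<le> e \<and> mdist m (f (min t T)) (g (min (l t) T)) \<le> e"
    unfolding skorohod_close_def by blast
  from time_change_inv[OF l(1)] obtain k where k: "time_change k" "\<And>t. t \<ge> 0 \<Longrightarrow> l (k t) = t"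
    by blast
  have "\<bar>k t - t\<bar> \<le> e \<and> mdist m (g (min t T)) (f (min (k t) T)) \<le> e" if "t \<ge> 0" for t
    using l(2)[OF time_change_nonneg[OF k(1) that]] k(2)[OF that]
    by (simp add: commute abs_minus_commute)
  with k(1) show ?thesis unfolding skorohod_close_def by blast
qed

lemma skorohod_close_triangle:
  assumes "skorohod_close m T f g d" "skorohod_close m T g h e" "T > 0"
    and mem: "f \<in> skorohod_carrier m T" "g \<in> skorohod_carrier m T" "h \<in> skorohod_carrier m T"
  shows "skorohod_close m T f h (d + e)"
proof -
  interpret Metric_space "mspace m" "mdist m" by (rule Metric_space_mspace_mdist)
  from assms obtain l k where l: "time_change l"
    "\<And>t. t \<ge> 0 \<Longrightarrow> \<bar>l t - t\<bar> \<le> d \<and> mdist m (f (min t T)) (g (min (l t) T)) \<le> d"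
    and k: "time_change k"
    "\<And>t. t \<ge> 0 \<Longrightarrow> \<bar>k t - t\<bar> \<le> e \<and> mdist m (g (min t T)) (h (min (k t) T)) \<le> e"
    unfolding skorohod_close_def by blast
  have "\<bar>k (l t) - t\<bar> \<le> d + e \<and> mdist m (f (min t T)) (h (min (k (l t)) T)) \<le> d + e"
    if t: "t \<ge> 0" for t
  proof
    have lt: "l t \<ge> 0" and klt: "k (l t) \<ge> 0"
      using time_change_nonneg l(1) k(1) t by blast+
    show "\<bar>k (l t) - t\<bar> \<le> d + e" using l(2)[OF t] k(2)[OF lt] by linarith
    show "mdist m (f (min t T)) (h (min (k (l t)) T)) \<le> d + e"
      using triangle[OF skorohod_mem[OF mem(1) t \<open>T > 0\<close>] skorohod_mem[OF mem(2) lt \<open>T > 0\<close>]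
          skorohod_mem[OF mem(3) klt \<open>T > 0\<close>]] l(2)[OF t] k(2)[OF lt] by linarith
  qed
  with time_change_comp[OF l(1) k(1)] show ?thesis unfolding skorohod_close_def by blast
qed

lemma cadlag_bounded:
  assumes f: "f \<in> skorohod_carrier m T" and x: "x \<in> mspace m"
  shows "\<exists>B. \<forall>t\<in>{0..T}. mdist m x (f t) \<le> B"
proof -
  interpret Metric_space "mspace m" "mdist m" by (rule Metric_space_mspace_mdist)
  have right: "\<exists>B d. d > 0 \<and> (\<forall>s. t < s \<and> s < t + d \<longrightarrow> mdist m x (f s) \<le> B)" 
    if "t \<in> {0..<T}" for t
  proof -
    have "limitin mtopology f (f t) (at_right t)"
      using f that by (auto simp: skorohod_carrier_def cadlag_on_def mtopology_of_def)
    then have ft: "f t \<in> mspace m"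
      and ev: "eventually (\<lambda>s. f s \<in> mspace m \<and> mdist m (f s) (f t) < 1) (at_right t)"
      by (auto simp: limitin_metric)
    from ev obtain b where b: "b > t"
      "\<And>s. t < s \<Longrightarrow> s < b \<Longrightarrow> f s \<in> mspace m \<and> mdist m (f s) (f t) < 1"
      unfolding eventually_at_right_field by blast
    have "mdist m x (f s) \<le> mdist m x (f t) + 1" if "t < s" "s < t + (b - t)" for s
      using triangle[OF x ft, of "f s"] b(2)[of s] that by (simp add: commute)
    with b(1) show ?thesis by (intro exI[of _ "mdist m x (f t) + 1"] exI[of _ "b - t"]) auto
  qed
  have left: "\<exists>B d. d > 0 \<and> (\<forall>s. t - d < s \<and> s < t \<longrightarrow> mdist m x (f s) \<le> B)" 
    if "t \<in> {0<..T}" for t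
  proof -
    have "\<exists>y. limitin mtopology f y (at_left t)"
      using f that by (auto simp: skorohod_carrier_def cadlag_on_def mtopology_of_def)
    then obtain y where "limitin mtopology f y (at_left t)" ..
    then have y: "y \<in> mspace m"
      and ev: "eventually (\<lambda>s. f s \<in> mspace m \<and> mdist m (f s) y < 1) (at_left t)"
      by (auto simp: limitin_metric)
    from ev obtain b where b: "b < t"
      "\<And>s. b < s \<Longrightarrow> s < t \<Longrightarrow> f s \<in> mspace m \<and> mdist m (f s) y < 1"
      unfolding eventually_at_left_field by blast
    have "mdist m x (f s) \<le> mdist m x y + 1" if "t - (t - b) < s" "s < t" for s
      using triangle[OF x y, of "f s"] b(2)[of s] that by (simp add: commute)
    with b(1) show ?thesis by (intro exI[of _ "mdist m x y + 1"] exI[of _ "t - b"]) auto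
  qed
  have loc: "\<exists>B d. d > 0 \<and> (\<forall>s\<in>{0..T}. \<bar>s - t\<bar> < d \<longrightarrow> mdist m x (f s) \<le> B)" 
    if t: "t \<in> {0..T}" for t
  proof -
    have "\<exists>B d. d > 0 \<and> (\<forall>s. t < s \<and> s < t + d \<and> s \<le> T \<longrightarrow> mdist m x (f s) \<le> B)"
    proof (cases "t < T")
      case True with right[of t] t show ?thesis by fastforce
    next
      case False then show ?thesis using t by (intro exI[of _ 0] exI[of _ 1]) auto
    qed
    then obtain B d where 1: "d > 0"
      "\<And>s. t < s \<Longrightarrow> s < t + d \<Longrightarrow> s \<le> T \<Longrightarrow> mdist m x (f s) \<le> B" by blast
    have "\<exists>B d. d > 0 \<and> (\<forall>s. t - d < s \<and> s < t \<and> 0 \<le> s \<longrightarrow> mdist m x (f s) \<le> B)"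
    proof (cases "t > 0")
      case True with left[of t] t show ?thesis by fastforce
    next
      case False then show ?thesis using t by (intro exI[of _ 0] exI[of _ 1]) auto
    qed
    then obtain B' d' where 2: "d' > 0"
      "\<And>s. t - d' < s \<Longrightarrow> s < t \<Longrightarrow> 0 \<le> s \<Longrightarrow> mdist m x (f s) \<le> B'" by blast
    have "mdist m x (f s) \<le> max (mdist m x (f t)) (max B B')"
      if "s \<in> {0..T}" "\<bar>s - t\<bar> < min d d'" for s
      using 1(2)[of s] 2(2)[of s] that by (cases s t rule: linorder_cases) auto
    with 1(1) 2(1) show ?thesis
      by (intro exI[of _ "max (mdist m x (f t)) (max B B')"] exI[of _ "min d d'"]) auto
  qed
  then obtain B d where Bd: "\<And>t. t \<in> {0..T} \<Longrightarrow> d t > 0"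
    "\<And>t s. t \<in> {0..T} \<Longrightarrow> s \<in> {0..T} \<Longrightarrow> \<bar>s - t\<bar> < d t \<Longrightarrow> mdist m x (f s) \<le> B t"
    by metis
  have "{0..T} \<subseteq> (\<Union>t\<in>{0..T}. ball t (d t))"
    using Bd(1) by force
  then obtain C where C: "C \<subseteq> {0..T}" "finite C" "{0..T} \<subseteq> (\<Union>t\<in>C. ball t (d t))"
    using compactE_image[of "{0..T}" "{0..T}" "\<lambda>t. ball t (d t)"] by auto
  have "mdist m x (f s) \<le> Max (insert 0 (B ` C))" if s: "s \<in> {0..T}" for s
  proof -
    obtain t where t: "t \<in> C" "\<bar>s - t\<bar> < d t"
      using C(3) s by (force simp: dist_real_def)
    then have "mdist m x (f s) \<le> B t" using Bd(2) C(1) s by blast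
    also have "\<dots> \<le> Max (insert 0 (B ` C))" using t C(2) by (intro Max_ge) auto
    finally show ?thesis .
  qed
  then show ?thesis by blast
qed

lemma skorohod_close_ex:
  assumes f: "f \<in> skorohod_carrier m T" and g: "g \<in> skorohod_carrier m T" and T: "T > 0"
  shows "\<exists>e. skorohod_close m T f g e"
proof -
  interpret Metric_space "mspace m" "mdist m" by (rule Metric_space_mspace_mdist)
  have x: "f (min 0 T) \<in> mspace m" using skorohod_mem[OF f, of 0] T by simp
  obtain A B where A: "\<And>t. t \<in> {0..T} \<Longrightarrow> mdist m (f (min 0 T)) (f t) \<le> A"
    and B: "\<And>t. t \<in> {0..T} \<Longrightarrow> mdist m (f (min 0 T)) (g t) \<le> B"
    using cadlag_bounded[OF f x] cadlag_bounded[OF g x] by metis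
  have pos: "A + B \<ge> 0"
    using order_trans[OF nonneg A[of 0]] order_trans[OF nonneg B[of 0]] T by simp
  have "mdist m (f (min t T)) (g (min t T)) \<le> A + B" if t: "t \<ge> 0" for t
    using triangle[OF skorohod_mem[OF f t T] x skorohod_mem[OF g t T]] A[of "min t T"]
      B[of "min t T"] t T by (simp add: commute)
  with time_change_id pos show ?thesis unfolding skorohod_close_def
    by (intro exI[of _ "A + B"] exI[of _ "\<lambda>t. t"]) auto
qed

lemma skorohod_close_imp_eq:
  assumes f: "f \<in> skorohod_carrier m T" and g: "g \<in> skorohod_carrier m T" and T: "T > 0"
    and cl: "\<And>e. e > 0 \<Longrightarrow> skorohod_close m T f g e"
  shows "f = g"
proof -
  interpret Metric_space "mspace m" "mdist m" by (rule Metric_space_mspace_mdist)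
  have mem: "f t \<in> mspace m" "g t \<in> mspace m" if "t \<in> {0..T}" for t
    using f g that by (auto simp: skorohod_carrier_def PiE_iff)
  have eqT: "f T = g T"
  proof (rule ccontr)
    assume "f T \<noteq> g T"
    then have pos: "mdist m (f T) (g T) > 0" using mem[of T] T by simp
    define e where "e = min 1 (mdist m (f T) (g T) / 2)"
    have e: "e > 0" "e \<le> 1" "e < mdist m (f T) (g T)" using pos by (auto simp: e_def)
    obtain l where l:
      "\<bar>l (T + 1) - (T + 1)\<bar> \<le> e" "mdist m (f (min (T + 1) T)) (g (min (l (T + 1)) T)) \<le> e"
    proof -
      obtain l where "\<forall>t\<ge>0. \<bar>l t - t\<bar> \<le> e \<and> mdist m (f (min t T)) (g (min (l t) T)) \<le> e"
        using cl[OF e(1)] unfolding skorohod_close_def by blast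
      with T have "\<bar>l (T + 1) - (T + 1)\<bar> \<le> e \<and>
          mdist m (f (min (T + 1) T)) (g (min (l (T + 1)) T)) \<le> e"
        by (meson add_nonneg_nonneg less_imp_le zero_le_one)
      then show ?thesis using that by blast
    qed
    have "min (l (T + 1)) T = T" "min (T + 1) T = T" using l(1) e(2) by auto
    then have "mdist m (f T) (g T) \<le> e" using l(2) by simp
    with e(3) show False by simp
  qed
  have eqs: "f s = g s" if s: "s \<in> {0..<T}" for s
  proof (rule ccontr)
    assume "f s \<noteq> g s"
    then have pos: "mdist m (f s) (g s) > 0" using mem[of s] s by simp
    define e where "e = mdist m (f s) (g s) / 4"
    have e0: "e > 0" using pos by (simp add: e_def)
    have "eventually (\<lambda>t. f t \<in> mspace m \<and> mdist m (f t) (f s) < e) (at_right s)"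
      "eventually (\<lambda>t. g t \<in> mspace m \<and> mdist m (g t) (g s) < e) (at_right s)"
      using f g s e0
      by (auto simp: skorohod_carrier_def cadlag_on_def mtopology_of_def limitin_metric)
    then obtain b c where b: "b > s" "\<And>t. s < t \<Longrightarrow> t < b \<Longrightarrow> mdist m (f t) (f s) < e"
      and c: "c > s" "\<And>t. s < t \<Longrightarrow> t < c \<Longrightarrow> mdist m (g t) (g s) < e"
      unfolding eventually_at_right_field by blast
    define a where "a = (min (min b c) T - s) / 2"
    have a: "a > 0" "s + 2 * a \<le> b" "s + 2 * a \<le> c" "s + 2 * a \<le> T"
      using b(1) c(1) s by (auto simp: a_def field_simps)
    define d where "d = min e (a / 2)"
    have d: "d > 0" "d \<le> e" "d < a" using a e0 by (auto simp: d_def)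
    obtain l where l: "\<bar>l (s + a) - (s + a)\<bar> \<le> d"
      "mdist m (f (min (s + a) T)) (g (min (l (s + a)) T)) \<le> d"
    proof -
      obtain l where "\<forall>t\<ge>0. \<bar>l t - t\<bar> \<le> d \<and> mdist m (f (min t T)) (g (min (l t) T)) \<le> d"
        using cl[OF d(1)] unfolding skorohod_close_def by blast
      moreover have "s + a \<ge> 0" using s a(1) by simp
      ultimately have "\<bar>l (s + a) - (s + a)\<bar> \<le> d \<and>
          mdist m (f (min (s + a) T)) (g (min (l (s + a)) T)) \<le> d" by blast
      then show ?thesis using that by blast
    qed
    have ls: "s < l (s + a)" "l (s + a) < s + 2 * a" using l(1) d(3) by linarith+
    have mins: "min (s + a) T = s + a" "min (l (s + a)) T = l (s + a)"
      using a ls by linarith+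
    have m: "f s \<in> mspace m" "g s \<in> mspace m" "f (s + a) \<in> mspace m" "g (l (s + a)) \<in> mspace m"
      using mem s a ls by auto
    have "mdist m (f s) (g s) \<le> mdist m (f s) (f (s + a)) + mdist m (f (s + a)) (g (l (s + a)))
        + mdist m (g (l (s + a))) (g s)"
      using triangle[OF m(1,3,2)] triangle[OF m(3,4,2)] by linarith
    also have "\<dots> < e + e + e"
      using b(2)[of "s + a"] c(2)[of "l (s + a)"] l(2) d a ls
      unfolding mins by (simp add: commute)
    finally show False using pos by (simp add: e_def)
  qed
  show ?thesis
  proof
    fix t show "f t = g t"
      using f g eqT eqs[of t]
      by (cases "t \<in> {0..T}") (auto simp: skorohod_carrier_def PiE_iff extensional_def less_le)
  qed
qed

lemma Metric_space_skorohod: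
  assumes T: "T > 0"
  shows "Metric_space (skorohod_carrier m T) (skorohod_dist m T)"
proof -
  let ?D = "skorohod_carrier m T"
  have d_eq: "skorohod_dist m T f g = Inf {e. skorohod_close m T f g e}"
    if "f \<in> ?D" "g \<in> ?D" for f g
    using that by (simp add: skorohod_dist_def)
  have nn: "e \<ge> 0" if "skorohod_close m T f g e" for f g e
    using that unfolding skorohod_close_def by (meson abs_ge_zero order.trans order_refl)
  have bdd: "bdd_below {e. skorohod_close m T f g e}" for f g
    using nn by (auto intro!: bdd_belowI[of _ 0])
  have approx: "\<exists>e'<e. skorohod_close m T f g e'"
    if "f \<in> ?D" "g \<in> ?D" "skorohod_dist m T f g < e" for f g e
  proof -
    have "{e. skorohod_close m T f g e} \<noteq> {}" using skorohod_close_ex[OF that(1,2) T] by auto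
    from cInf_lessD[OF this, of e] that d_eq[OF that(1,2)] show ?thesis by auto
  qed
  have upper: "skorohod_dist m T f g \<le> e"
    if "f \<in> ?D" "g \<in> ?D" "skorohod_close m T f g e" for f g e
    using d_eq[OF that(1,2)] cInf_lower[OF _ bdd] that(3) by auto
  have nonneg: "0 \<le> skorohod_dist m T f g" for f g
  proof (cases "f \<in> ?D \<and> g \<in> ?D")
    case True
    then have "{e. skorohod_close m T f g e} \<noteq> {}" using skorohod_close_ex[OF _ _ T] by blast
    then show ?thesis
      using True d_eq nn by (auto intro!: cInf_greatest)
  qed (auto simp: skorohod_dist_def)
  have comm: "skorohod_dist m T f g = skorohod_dist m T g f" for f g
  proof (cases "f \<in> ?D \<and> g \<in> ?D")
    case True
    have "{e. skorohod_close m T f g e} = {e. skorohod_close m T g f e}"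
      using skorohod_close_commute by blast
    then show ?thesis using True d_eq by simp
  qed (auto simp: skorohod_dist_def)
  have mono: "skorohod_close m T f g e'" if "skorohod_close m T f g e" "e \<le> e'" for f g e e'
    using that unfolding skorohod_close_def by (meson order.trans)
  show ?thesis
  proof
    show "0 \<le> skorohod_dist m T f g" for f g by (rule nonneg)
    show "skorohod_dist m T f g = skorohod_dist m T g f" for f g by (rule comm)
    show "skorohod_dist m T f g = 0 \<longleftrightarrow> f = g" if fg: "f \<in> ?D" "g \<in> ?D" for f g
    proof
      assume "skorohod_dist m T f g = 0"
      then have "skorohod_close m T f g e" if "e > 0" for e
        using approx[OF fg, of e] that mono less_imp_le by metis
      then show "f = g" using skorohod_close_imp_eq[OF fg T] by blast
    next
      assume "f = g"
      moreover have "mdist m (f (min t T)) (f (min t T)) = 0" if "t \<ge> 0" for t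
        by (rule Metric_space.mdist_zero[OF Metric_space_mspace_mdist skorohod_mem[OF fg(1) that T]])
      then have "skorohod_close m T f f 0"
        unfolding skorohod_close_def by (intro exI[of _ "\<lambda>t. t"]) (simp add: time_change_id)
      ultimately show "skorohod_dist m T f g = 0"
        using upper[OF fg] nonneg[of f g] by force
    qed
    show "skorohod_dist m T f h \<le> skorohod_dist m T f g + skorohod_dist m T g h"
      if fgh: "f \<in> ?D" "g \<in> ?D" "h \<in> ?D" for f g h
    proof (rule field_le_epsilon)
      fix e :: real assume e: "e > 0"
      obtain a b where "a < skorohod_dist m T f g + e / 2" "skorohod_close m T f g a"
        "b < skorohod_dist m T g h + e / 2" "skorohod_close m T g h b"
        using approx[OF fgh(1,2), of "skorohod_dist m T f g + e / 2"]
          approx[OF fgh(2,3), of "skorohod_dist m T g h + e / 2"] e by auto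
      moreover from this have "skorohod_dist m T f h \<le> a + b"
        using skorohod_close_triangle[OF _ _ T fgh] upper[OF fgh(1,3)] by blast
      ultimately show "skorohod_dist m T f h \<le> skorohod_dist m T f g + skorohod_dist m T g h + e"
        by linarith
    qed
  qed
qed

lemma topspace_skorohod_topology [simp]:
  "T > 0 \<Longrightarrow> topspace (skorohod_topology m T) = skorohod_carrier m T"
  by (simp add: skorohod_topology_def Metric_space.mspace_metric Metric_space_skorohod)


section \<open>Weak convergence of probability measures on a topological space\<close>

definition borel_of :: "'a topology \<Rightarrow> 'a measure" where
  "borel_of X = sigma (topspace X) {U. openin X U}"

definition prob_measures_on :: "'a topology \<Rightarrow> 'a measure set" where
  "prob_measures_on X = {N. sets N = sets (borel_of X) \<and> prob_space N}"

text \<open>The coarsest topology for which integration against every bounded continuous function is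
  continuous.\<close>

definition weak_topology :: "'a topology \<Rightarrow> 'a measure topology" where
  "weak_topology X = topology_generated_by
     {{N \<in> prob_measures_on X. (LINT x|N. f x) \<in> U} | f U.
        continuous_map X euclideanreal f \<and> bounded (f ` topspace X) \<and> open U}"

definition relatively_compactin :: "'a topology \<Rightarrow> 'a set \<Rightarrow> bool" where
  "relatively_compactin X A \<longleftrightarrow> A \<subseteq> topspace X \<and> compactin X (X closure_of A)"

definition weakly_relatively_compact ::
    "'w measure \<Rightarrow> 'a topology \<Rightarrow> 'i set \<Rightarrow> ('i \<Rightarrow> 'w \<Rightarrow> 'a) \<Rightarrow> bool" where
  "weakly_relatively_compact M X I Y \<longleftrightarrow>
     (\<forall>i\<in>I. Y i \<in> M \<rightarrow>\<^sub>M borel_of X) \<and>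
     relatively_compactin (weak_topology X) ((\<lambda>i. distr M (borel_of X) (Y i)) ` I)"

lemma topspace_weak_topology [simp]: "topspace (weak_topology X) = prob_measures_on X"
proof -
  have "prob_measures_on X \<in> {{N \<in> prob_measures_on X. (LINT x|N. f x) \<in> U} | f U.
        continuous_map X euclideanreal f \<and> bounded (f ` topspace X) \<and> open U}"
    by (rule CollectI, rule exI[of _ "\<lambda>_. 0"], rule exI[of _ UNIV])
      (auto intro!: boundedI[of _ 0])
  then show ?thesis unfolding weak_topology_def by auto
qed


section \<open>The noise\<close>

definition complete_filtered_prob_space :: "'w measure \<Rightarrow> (real \<Rightarrow> 'w measure) \<Rightarrow> bool" where
  "complete_filtered_prob_space M F \<longleftrightarrow>
     prob_space M \<and> complete_measure M \<and>
     (\<forall>t\<ge>0. subalgebra M (F t)) \<and>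
     (\<forall>s t. 0 \<le> s \<longrightarrow> s \<le> t \<longrightarrow> sets (F s) \<subseteq> sets (F t)) \<and>
     null_sets M \<subseteq> sets (F 0)"

definition levy_measure :: "real measure \<Rightarrow> bool" where
  "levy_measure lam \<longleftrightarrow>
     sets lam = sets borel \<and> emeasure lam {0} = 0 \<and> (\<integral>\<^sup>+z. ennreal (min 1 (\<bar>z\<bar>\<^sup>2)) \<partial>lam) < \<infinity>"

definition intensity :: "real measure \<Rightarrow> (real \<times> real \<times> real) measure" where
  "intensity lam = restrict_space lborel {0<..} \<Otimes>\<^sub>M (restrict_space lborel {0..1} \<Otimes>\<^sub>M lam)"

text \<open>The last two conditions express that the random measure is adapted to the filtration and
  that its restriction to times after \<open>t\<close> is independent of the past up to \<open>t\<close>.\<close>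

definition poisson_random_measure ::
    "'w measure \<Rightarrow> (real \<Rightarrow> 'w measure) \<Rightarrow> real measure \<Rightarrow>
     ('w \<Rightarrow> (real \<times> real \<times> real) measure) \<Rightarrow> bool" where
  "poisson_random_measure M F lam mu \<longleftrightarrow>
     (\<forall>w\<in>space M. sets (mu w) = sets (intensity lam) \<and>
        (\<forall>A\<in>sets (intensity lam). emeasure (mu w) A \<in> insert \<infinity> (range of_nat))) \<and>
     (\<forall>A\<in>sets (intensity lam). (\<lambda>w. emeasure (mu w) A) \<in> borel_measurable M) \<and>
     (\<forall>A\<in>sets (intensity lam). emeasure (intensity lam) A < \<infinity> \<longrightarrow>
        (\<forall>k. measure M {w\<in>space M. emeasure (mu w) A = of_nat k} =
           exp (- measure (intensity lam) A) * measure (intensity lam) A ^ k / fact k)) \<and>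
     (\<forall>A\<in>sets (intensity lam). emeasure (intensity lam) A = \<infinity> \<longrightarrow>
        (AE w in M. emeasure (mu w) A = \<infinity>)) \<and>
     (\<forall>A. range A \<subseteq> sets (intensity lam) \<longrightarrow> disjoint_family A \<longrightarrow>
        prob_space.indep_vars M (\<lambda>_. borel) (\<lambda>(i::nat) w. emeasure (mu w) (A i)) UNIV) \<and>
     (\<forall>t\<ge>0. \<forall>A\<in>sets (intensity lam). A \<subseteq> {0<..t} \<times> UNIV \<longrightarrow>
        (\<lambda>w. emeasure (mu w) A) \<in> borel_measurable (F t)) \<and>
     (\<forall>t\<ge>0. prob_space.indep_set M (sets (F t))
        (sigma_sets (space M) {(\<lambda>w. emeasure (mu w) A) -` B \<inter> space M | A B.
           A \<in> sets (intensity lam) \<and> A \<subseteq> {t<..} \<times> UNIV \<and> B \<in> sets borel}))"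

text \<open>\<open>I\<close> is a version of the integral of the deterministic function \<open>f\<close> against the compensated
  random measure: the mean-square limit, as \<open>e\<close> decreases to \<open>0\<close>, of the compensated integrals
  over the jumps of size larger than \<open>e\<close>.\<close>

definition is_compensated_integral ::
    "'w measure \<Rightarrow> real measure \<Rightarrow> ('w \<Rightarrow> (real \<times> real \<times> real) measure) \<Rightarrow>
     (real \<times> real \<times> real \<Rightarrow> real) \<Rightarrow> ('w \<Rightarrow> real) \<Rightarrow> bool" where
  "is_compensated_integral M lam mu f I \<longleftrightarrow>
     I \<in> borel_measurable M \<and>
     ((\<lambda>e. \<integral>\<^sup>+w. ennreal ((I w -
          ((LINT p:{(t, x, z). \<bar>z\<bar> > e}|mu w. f p) -
           (LINT p:{(t, x, z). \<bar>z\<bar> > e}|intensity lam. f p)))\<^sup>2) \<partial>M) \<longlongrightarrow> 0) (at_right 0)"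

definition is_levy_noise ::
    "'w measure \<Rightarrow> real \<Rightarrow> real measure \<Rightarrow> ('w \<Rightarrow> (real \<times> real \<times> real) measure) \<Rightarrow>
     ((real \<times> real) set \<Rightarrow> 'w \<Rightarrow> real) \<Rightarrow> bool" where
  "is_levy_noise M b lam mu L \<longleftrightarrow>
     (\<forall>B\<in>sets borel. B \<subseteq> {0..} \<times> {0..1} \<longrightarrow> emeasure lborel B < \<infinity> \<longrightarrow>
        L B \<in> borel_measurable M \<and>
        (\<exists>I. is_compensated_integral M lam mu
               (\<lambda>(t, x, z). z * indicator B (t, x) * indicator {z. \<bar>z\<bar> \<le> 1} z) I \<and>
             (AE w in M. L B w = b * measure lborel B + I w +
                (LINT (t, x, z)|mu w. z * indicator B (t, x) * indicator {z. \<bar>z\<bar> > 1} z))))"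


section \<open>The fully discrete scheme\<close>

definition grid_point :: "nat \<Rightarrow> int \<Rightarrow> real" where
  "grid_point n j = of_int j / of_nat n"

definition discrete_laplacian :: "nat \<Rightarrow> (real \<Rightarrow> real) \<Rightarrow> int \<Rightarrow> real" where
  "discrete_laplacian n v j = (of_nat n)\<^sup>2 *
     (v (grid_point n (j + 1)) - 2 * v (grid_point n j) + v (grid_point n (j - 1)))"

definition kappa :: "nat \<Rightarrow> real \<Rightarrow> real" where
  "kappa n y = of_int \<lfloor>of_nat n * y\<rfloor> / of_nat n"

text \<open>\<open>L\<close> is one realization of the noise, and \<open>u t x\<close> is the extended numerical solution; its
  values are constrained only for \<open>x\<close> in the unit interval and, as boundary values at grid times,
  for \<open>x = -1/n\<close>.\<close>

definition fully_discrete_scheme ::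
    "real \<Rightarrow> (real \<Rightarrow> real) \<Rightarrow> (real \<Rightarrow> real) \<Rightarrow> nat \<Rightarrow> real \<Rightarrow> ((real \<times> real) set \<Rightarrow> real) \<Rightarrow>
     (real \<Rightarrow> real \<Rightarrow> real) \<Rightarrow> bool" where
  "fully_discrete_scheme \<theta> \<sigma> u0 n \<tau> L u \<longleftrightarrow>
     (\<forall>j\<in>{0..<int n}. u 0 (grid_point n j) = u0 (grid_point n j)) \<and>
     (\<forall>i::nat. u (of_nat i * \<tau>) 0 = u (of_nat i * \<tau>) 1 \<and>
        u (of_nat i * \<tau>) (grid_point n (- 1)) = u (of_nat i * \<tau>) (grid_point n (int n - 1))) \<and>
     (\<forall>i::nat. \<forall>j\<in>{0..<int n}.
        u (of_nat (Suc i) * \<tau>) (grid_point n j) =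
          u (of_nat i * \<tau>) (grid_point n j)
          + (1 - \<theta>) * \<tau> * discrete_laplacian n (u (of_nat i * \<tau>)) j
          + \<theta> * \<tau> * discrete_laplacian n (u (of_nat (Suc i) * \<tau>)) j
          + of_nat n * \<sigma> (u (of_nat i * \<tau>) (grid_point n j)) *
            L ({of_nat i * \<tau>..<of_nat (Suc i) * \<tau>} \<times> {grid_point n j..<grid_point n (j + 1)})) \<and>
     (\<forall>i::nat. \<forall>t\<in>{of_nat i * \<tau>..<of_nat (Suc i) * \<tau>}. \<forall>x\<in>{0..1}.
        u t x = u (of_nat i * \<tau>) (kappa n x))"

text \<open>\<open>\<rho>\<close> plays a role only for \<open>\<theta> < 1/2\<close>, and \<open>\<epsilon>\<close> only for \<open>\<theta> = 1/2\<close>.\<close>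

definition step_size_condition :: "real \<Rightarrow> real \<Rightarrow> real \<Rightarrow> nat \<Rightarrow> real \<Rightarrow> bool" where
  "step_size_condition \<theta> \<rho> \<epsilon> n \<tau> \<longleftrightarrow>
     (\<theta> < 1/2 \<longrightarrow> 0 < \<rho> \<and> (of_nat n)\<^sup>2 * \<tau> \<le> \<rho> \<and> \<rho> < 1 / (2 - 4 * \<theta>)) \<and>
     (\<theta> = 1/2 \<longrightarrow> 0 < \<epsilon> \<and> \<epsilon> < 1/2 \<and> (of_nat n)\<^sup>2 * \<tau> \<le> 1 / \<epsilon> - 1/2)"

definition admissible :: "real \<Rightarrow> real \<Rightarrow> real \<Rightarrow> (nat \<times> real) set" where
  "admissible \<theta> \<rho> \<epsilon> =
     {(n, \<tau>). 3 \<le> n \<and> 0 < \<tau> \<and> \<tau> < 1/2 \<and> step_size_condition \<theta> \<rho> \<epsilon> n \<tau>}"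

text \<open>The function \<open>t \<mapsto> u t\<close> as a path with values in a Sobolev space.\<close>

definition sobolev_path :: "real \<Rightarrow> (real \<Rightarrow> real \<Rightarrow> real) \<Rightarrow> real \<Rightarrow> int \<Rightarrow> complex" where
  "sobolev_path T u = (\<lambda>t\<in>{0..T}. fourier_coeff (\<lambda>x. of_real (u t x)))"

end

(*
  Since the Levy measure has a finite first moment, the noise has finite variation: the absolute
  noise in a space-time cell is bounded by a drift term plus the sum of the sizes of the jumps in
  the cell. For each Fourier mode the scheme is a scalar recursion with multipliers of modulus at
  most 1 (this is the only use of the step-size condition), so for bounded sigma all Fourier
  coefficients are bounded, uniformly in time and mode, by the initial value plus the total noise
  mass. A bounded set of Fourier coefficients is compact in H^r for r < -1/2, and on it the metric
  is controlled by finitely many modes; each of these changes little over a short time in which the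
  noise has no large jump. Large jumps are finitely many and, with high probability, separated from
  each other and from time 0, by a union bound for the Poisson counts over short time windows. So,
  outside an event of small probability that does not depend on the step sizes, all paths lie in one
  compact subset of the Skorohod space. Tight families of laws on a metric space are relatively
  compact, by Tychonoff's theorem and a Riesz representation of tight functionals.
*)
theory Submission
  imports Defs "HOL-Library.Diagonal_Subsequence"
begin

section \<open>Relative compactness of tight families of measures\<close>

text \<open>Two exceptional sets are kept apart: the event of small probability is fixed before the
  step sizes, while the comparison of the noise with its jump mass holds almost surely with a null
  set depending on the uncountable parameter (n, \<tau>), and is discarded separately for each law.
  A mode is controlled by the noise mass because the factor \<open>n\<close> in front of the noise
  cancels the 1/n of the discrete Fourier transform. The Skorohod metric in use puts no bound on the
  slopes of time changes and is not complete in general, so total boundedness would not suffice;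
  limit paths are constructed by hand. A pointwise limit of integrals need not be an integral, but
  the tightness inequality is a closed condition, survives the limit, and restores continuity along
  decreasing sequences. The scheme is implicit, so even measurability of its values goes through the
  discrete Fourier transform.\<close>

lemma space_borel_of [simp]: "space (borel_of X) = topspace X"
  unfolding borel_of_def by (rule space_measure_of) (auto dest: openin_subset)

lemma borel_of_open: "openin X U \<Longrightarrow> U \<in> sets (borel_of X)"
  unfolding borel_of_def by (subst sets_measure_of) (auto dest: openin_subset)

section \<open>Bounded continuous functions and distances to complements of open sets\<close>

context Metric_space
begin

definition bounded_continuous :: "('a \<Rightarrow> real) set" where
  "bounded_continuous = {f. continuous_map mtopology euclideanreal f \<and> bounded (f ` M)}"

lemma bounded_continuousI:
  assumes "continuous_map mtopology euclideanreal f" "\<And>x. x \<in> M \<Longrightarrow> \<bar>f x\<bar> \<le> B"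
  shows "f \<in> bounded_continuous"
  using assms by (auto simp: bounded_continuous_def intro!: boundedI[of _ B])

lemma bounded_continuousE:
  assumes "f \<in> bounded_continuous"
  obtains B where "continuous_map mtopology euclideanreal f" "\<And>x. x \<in> M \<Longrightarrow> \<bar>f x\<bar> \<le> B"
  using assms by (auto simp: bounded_continuous_def bounded_iff)

lemma bounded_continuous_const [simp]: "(\<lambda>_. c) \<in> bounded_continuous"
  by (rule bounded_continuousI[of _ "\<bar>c\<bar>"]) auto

lemma bounded_continuous_add [simp]:
  assumes "f \<in> bounded_continuous" "g \<in> bounded_continuous"
  shows "(\<lambda>x. f x + g x) \<in> bounded_continuous"
proof -
  from assms(1) obtain A where A: "continuous_map mtopology euclideanreal f" "\<And>x. x \<in> M \<Longrightarrow> \<bar>f x\<bar> \<le> A"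
    by (elim bounded_continuousE) blast
  from assms(2) obtain B where B: "continuous_map mtopology euclideanreal g" "\<And>x. x \<in> M \<Longrightarrow> \<bar>g x\<bar> \<le> B"
    by (elim bounded_continuousE) blast
  show ?thesis
  proof (rule bounded_continuousI[of _ "A + B"])
    fix x assume "x \<in> M"
    then show "\<bar>f x + g x\<bar> \<le> A + B" using A(2)[of x] B(2)[of x] by linarith
  qed (intro continuous_map_add A B)
qed

lemma bounded_continuous_scale [simp]:
  assumes "f \<in> bounded_continuous"
  shows "(\<lambda>x. c * f x) \<in> bounded_continuous"
proof -
  from assms obtain A where A: "continuous_map mtopology euclideanreal f" "\<And>x. x \<in> M \<Longrightarrow> \<bar>f x\<bar> \<le> A"
    by (elim bounded_continuousE) blast
  show ?thesis
  proof (rule bounded_continuousI[of _ "\<bar>c\<bar> * A"])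
    fix x assume "x \<in> M"
    then show "\<bar>c * f x\<bar> \<le> \<bar>c\<bar> * A" using A(2)[of x] by (simp add: abs_mult mult_left_mono)
  qed (intro continuous_map_real_mult_left A)
qed

lemma bounded_continuous_diff [simp]:
  assumes "f \<in> bounded_continuous" "g \<in> bounded_continuous"
  shows "(\<lambda>x. f x - g x) \<in> bounded_continuous"
  using bounded_continuous_add[OF assms(1) bounded_continuous_scale[OF assms(2), of "-1"]] by simp

lemma bounded_continuous_max [simp]:
  assumes "f \<in> bounded_continuous" "g \<in> bounded_continuous"
  shows "(\<lambda>x. max (f x) (g x)) \<in> bounded_continuous"
proof -
  from assms(1) obtain A where A: "continuous_map mtopology euclideanreal f" "\<And>x. x \<in> M \<Longrightarrow> \<bar>f x\<bar> \<le> A"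
    by (elim bounded_continuousE) blast
  from assms(2) obtain B where B: "continuous_map mtopology euclideanreal g" "\<And>x. x \<in> M \<Longrightarrow> \<bar>g x\<bar> \<le> B"
    by (elim bounded_continuousE) blast
  show ?thesis
  proof (rule bounded_continuousI[of _ "max A B"])
    fix x assume "x \<in> M"
    then show "\<bar>max (f x) (g x)\<bar> \<le> max A B" using A(2)[of x] B(2)[of x] by linarith
  qed (intro continuous_map_real_max A B)
qed

lemma bounded_continuous_min [simp]:
  assumes "f \<in> bounded_continuous" "g \<in> bounded_continuous"
  shows "(\<lambda>x. min (f x) (g x)) \<in> bounded_continuous"
proof -
  have "(\<lambda>x. -1 * max (-1 * f x) (-1 * g x)) \<in> bounded_continuous"
    using assms by (intro bounded_continuous_scale bounded_continuous_max)
  moreover have "(\<lambda>x. -1 * max (-1 * f x) (-1 * g x)) = (\<lambda>x. min (f x) (g x))"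
    by (auto simp: fun_eq_iff max_def min_def)
  ultimately show ?thesis by simp
qed

lemma bounded_continuous_sum [simp]:
  assumes "\<And>i. i \<in> I \<Longrightarrow> f i \<in> bounded_continuous"
  shows "(\<lambda>x. \<Sum>i\<in>I. f i x) \<in> bounded_continuous"
  using assms by (induction I rule: infinite_finite_induct) auto

text \<open>The test functions below the indicator of \<open>U\<close>. Vanishing off
  \<open>U\<close> replaces compact support in \<open>U\<close>, since the space need not be locally
  compact.\<close>

definition urysohn_sets :: "'a set \<Rightarrow> ('a \<Rightarrow> real) set" where
  "urysohn_sets U = {f \<in> bounded_continuous. (\<forall>x\<in>M. 0 \<le> f x \<and> f x \<le> 1) \<and> (\<forall>x\<in>M-U. f x = 0)}"

text \<open>Distance to the complement of \<open>U\<close>, truncated at 1. The inserted 1 also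
  keeps the infimum meaningful when the complement is empty.\<close>

definition codist :: "'a set \<Rightarrow> 'a \<Rightarrow> real" where
  "codist U x = Inf (insert 1 (d x ` (M - U)))"

lemma codist_le: "codist U x \<le> 1" "y \<in> M - U \<Longrightarrow> codist U x \<le> d x y"
  unfolding codist_def by (auto intro!: cInf_lower bdd_belowI[of _ 0])

lemma codist_ge: "c \<le> 1 \<Longrightarrow> (\<And>y. y \<in> M - U \<Longrightarrow> c \<le> d x y) \<Longrightarrow> c \<le> codist U x"
  unfolding codist_def by (rule cInf_greatest) auto

lemma codist_nonneg: "0 \<le> codist U x"
  by (rule codist_ge) auto

lemma codist_eq_0: "x \<in> M - U \<Longrightarrow> codist U x = 0"
  using codist_le(2)[of x U x] codist_nonneg[of U x] by auto

lemma codist_pos: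
  assumes "openin mtopology U" "x \<in> U"
  shows "0 < codist U x"
proof -
  obtain r where r: "r > 0" "mball x r \<subseteq> U" and x: "x \<in> M" using assms unfolding openin_mtopology by blast
  have "min 1 r \<le> codist U x"
  proof (rule codist_ge)
    fix y assume "y \<in> M - U"
    then have "y \<notin> mball x r" using r by auto
    then show "min 1 r \<le> d x y" using x \<open>y \<in> M - U\<close> by (auto simp: in_mball)
  qed auto
  with r show ?thesis by linarith
qed

lemma codist_lipschitz:
  assumes "x \<in> M" "y \<in> M"
  shows "codist U x \<le> codist U y + d x y"
proof -
  have "codist U x - d x y \<le> codist U y"
  proof (rule codist_ge)
    show "codist U x - d x y \<le> 1" using codist_le(1)[of U x] nonneg[of x y] by linarith
    fix z assume z: "z \<in> M - U"
    show "codist U x - d x y \<le> d y z"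
      using codist_le(2)[OF z, of x] triangle[OF assms, of z] z by auto
  qed
  then show ?thesis by linarith
qed

lemma bounded_continuous_codist [simp]: "codist U \<in> bounded_continuous"
proof (rule bounded_continuousI[of _ 1])
  have "continuous_map mtopology (Metric_space.mtopology UNIV dist) (codist U)"
  proof (subst metric_continuous_map, rule Met_TC.Metric_space_axioms, safe)
    fix a and e :: real assume a: "a \<in> M" "e > 0"
    have "dist (codist U a) (codist U x) < e" if "x \<in> M" "d a x < e" for x
      using codist_lipschitz[of a x U] codist_lipschitz[of x a U] a that
      by (auto simp: dist_real_def commute)
    with a show "\<exists>\<delta>>0. \<forall>x. x \<in> M \<and> d a x < \<delta> \<longrightarrow> dist (codist U a) (codist U x) < e" by blast
  qed simp
  then show "continuous_map mtopology euclideanreal (codist U)" by simp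
qed (use codist_le codist_nonneg in auto)

lemma bounded_continuous_measurable:
  assumes N: "sets N = sets (borel_of mtopology)" and f: "f \<in> bounded_continuous"
  shows "f \<in> borel_measurable N"
proof -
  have spN: "space N = M" using sets_eq_imp_space_eq[OF N] by simp
  show ?thesis
  proof (rule borel_measurableI)
    fix S :: "real set" assume S: "open S"
    have "openin mtopology {x \<in> topspace mtopology. f x \<in> S}"
      using f S by (intro openin_continuous_map_preimage[of _ euclideanreal]) (auto simp: bounded_continuous_def)
    moreover have "f -` S \<inter> space N = {x \<in> topspace mtopology. f x \<in> S}" using spN by auto
    ultimately show "f -` S \<inter> space N \<in> sets N" by (simp only: N borel_of_open)
  qed
qed

end

section \<open>Riesz representation of tight positive functionals\<close>

lemma min_plus_clamp:
  fixes a p q :: real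
  assumes "0 < p"
  shows "min a q + max 0 (min p (a - q)) = min a (q + p)"
proof (cases "a \<le> q")
  case True
  have "min a q = a" "min a (q + p) = a" using True assms by (intro min_absorb1; linarith)+
  moreover have "max 0 (min p (a - q)) = 0" using True by (intro max_absorb1 min.coboundedI2) linarith
  ultimately show ?thesis by (simp only: add_0_right)
next
  case False
  then have 1: "min a q = q" "max 0 (min p (a - q)) = min p (a - q)" using assms by (intro min_absorb2 max_absorb2 min.boundedI; linarith)+
  have "q + min p (a - q) = min (q + p) (q + (a - q))" by (rule min_add_distrib_right)
  then show ?thesis unfolding 1 by (simp only: add_diff_cancel_left' diff_add_cancel min.commute add.commute)
qed

text \<open>Each axiom on the functional is an equation or a weak inequality between finitely many
  of its values, hence a closed condition for pointwise convergence. The last one expresses, without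
  any measure, that at most 1 / Suc m of the mass lies outside \<open>K m\<close>.\<close>

locale tight_functional = Metric_space M d for M :: "'a set" and d +
  fixes \<phi> :: "('a \<Rightarrow> real) \<Rightarrow> real" and K :: "nat \<Rightarrow> 'a set"
  assumes add: "f \<in> bounded_continuous \<Longrightarrow> g \<in> bounded_continuous \<Longrightarrow> \<phi> (\<lambda>x. f x + g x) = \<phi> f + \<phi> g"
    and scale: "f \<in> bounded_continuous \<Longrightarrow> \<phi> (\<lambda>x. c * f x) = c * \<phi> f"
    and one: "\<phi> (\<lambda>_. 1) = 1"
    and pos: "f \<in> bounded_continuous \<Longrightarrow> (\<And>x. x \<in> M \<Longrightarrow> 0 \<le> f x) \<Longrightarrow> 0 \<le> \<phi> f"
    and compact: "compactin mtopology (K m)"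
    and tight: "f \<in> bounded_continuous \<Longrightarrow> (\<And>x. x \<in> M \<Longrightarrow> 0 \<le> f x \<and> f x \<le> 1) \<Longrightarrow>
      (\<And>x. x \<in> K m \<Longrightarrow> f x = 0) \<Longrightarrow> \<phi> f \<le> 1 / Suc m"
begin

lemma const: "\<phi> (\<lambda>_. c) = c"
  using scale[of "\<lambda>_. 1" c] one by simp

lemma diff:
  assumes "f \<in> bounded_continuous" "g \<in> bounded_continuous"
  shows "\<phi> (\<lambda>x. f x - g x) = \<phi> f - \<phi> g"
  using add[OF assms(1) bounded_continuous_scale[OF assms(2), of "-1"]] scale[OF assms(2), of "-1"] by simp

lemma mono:
  assumes "f \<in> bounded_continuous" "g \<in> bounded_continuous" "\<And>x. x \<in> M \<Longrightarrow> f x \<le> g x"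
  shows "\<phi> f \<le> \<phi> g"
  using pos[of "\<lambda>x. g x - f x"] diff[OF assms(2,1)] assms by simp

lemma sum:
  assumes "finite I" "\<And>i. i \<in> I \<Longrightarrow> f i \<in> bounded_continuous"
  shows "\<phi> (\<lambda>x. \<Sum>i\<in>I. f i x) = (\<Sum>i\<in>I. \<phi> (f i))"
  using assms by (induction I) (simp_all add: const add)

lemma urysohn_bounds:
  assumes "f \<in> urysohn_sets U"
  shows "f \<in> bounded_continuous" "0 \<le> \<phi> f" "\<phi> f \<le> 1"
proof -
  show f: "f \<in> bounded_continuous" using assms by (simp add: urysohn_sets_def)
  show "0 \<le> \<phi> f" using assms by (intro pos f) (auto simp: urysohn_sets_def)
  show "\<phi> f \<le> 1" using mono[OF f bounded_continuous_const[of 1]] one assms by (auto simp: urysohn_sets_def)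
qed

text \<open>Dini's theorem on the compact sets, with tightness controlling the rest.\<close>

lemma sigma_smooth:
  assumes f: "\<And>n. f n \<in> bounded_continuous" and f01: "\<And>n x. x \<in> M \<Longrightarrow> 0 \<le> f n x \<and> f n x \<le> 1"
    and dec: "\<And>n x. x \<in> M \<Longrightarrow> f (Suc n) x \<le> f n x"
    and lim: "\<And>x. x \<in> M \<Longrightarrow> (\<lambda>n. f n x) \<longlonglongrightarrow> 0" and e: "e > 0"
  shows "\<exists>n. \<phi> (f n) \<le> e"
proof -
  obtain m where m: "1 / Suc m < e / 2" using e nat_approx_posE[of "e/2"] by auto
  let ?U = "\<lambda>n. {x \<in> M. f n x < e / 2}"
  have open_U: "openin mtopology (?U n)" for n
  proof -
    have "openin mtopology {x \<in> topspace mtopology. f n x \<in> {..<e/2}}"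
      using f[of n] by (intro openin_continuous_map_preimage[of _ euclideanreal]) (auto simp: bounded_continuous_def)
    then show ?thesis by simp
  qed
  have KM: "K m \<subseteq> M" using compactin_subset_topspace[OF compact] by simp
  have "K m \<subseteq> \<Union>(range ?U)"
  proof
    fix x assume "x \<in> K m"
    then have "x \<in> M" using KM by auto
    from lim[OF this] e have "eventually (\<lambda>n. f n x < e / 2) sequentially" by (intro order_tendstoD(2)) auto
    then obtain n where "f n x < e / 2" by (auto simp: eventually_sequentially)
    with \<open>x \<in> M\<close> show "x \<in> \<Union>(range ?U)" by blast
  qed
  then obtain \<F> where F: "finite \<F>" "\<F> \<subseteq> range ?U" "K m \<subseteq> \<Union>\<F>"
    using compactinD[OF compact[of m], of "range ?U"] open_U by auto
  then obtain N where N: "finite N" "\<F> = ?U ` N" using finite_subset_image[OF F(1,2)] by blast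
  define n where "n = Max (insert 0 N)"
  have antim: "f n x \<le> f k x" if "x \<in> M" "k \<le> n" for x k
    using that(2) by (induction rule: dec_induct) (use dec[OF that(1)] order_trans in blast)+
  have small: "f n x \<le> e / 2" if x: "x \<in> K m" for x
  proof -
    obtain k where k: "k \<in> N" "x \<in> ?U k" using F(3) N x by blast
    then have "k \<le> n" using N by (simp add: n_def)
    with antim[of x k] k show ?thesis by auto
  qed
  \<comment> \<open>Lowering \<open>f n\<close> by e / 2 makes it vanish on \<open>K m\<close>, so
    that the tightness axiom applies; the constant removed costs e / 2.\<close>
  define g where "g x = max 0 (f n x - e / 2)" for x
  have g: "g \<in> bounded_continuous" unfolding g_def using f by simp
  have "\<phi> g \<le> 1 / Suc m"
  proof (rule tight[OF g])
    fix x assume "x \<in> M"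
    with f01[of x n] e show "0 \<le> g x \<and> g x \<le> 1" by (simp add: g_def)
  next
    fix x assume "x \<in> K m"
    with small[of x] show "g x = 0" by (simp add: g_def)
  qed
  moreover have "\<phi> (f n) \<le> \<phi> (\<lambda>x. g x + e / 2)"
    using f g by (intro mono) (auto simp: g_def)
  ultimately have "\<phi> (f n) \<le> e" using add[OF g, of "\<lambda>_. e / 2"] const[of "e / 2"] m by simp
  then show ?thesis ..
qed

text \<open>The Riesz value of an open set; \<open>outer\<close> extends it by outer regularity, and
  Caratheodory's construction then turns it into the measure \<open>rep\<close>.\<close>

definition content :: "'a set \<Rightarrow> ennreal" where
  "content U = (SUP f\<in>urysohn_sets U. ennreal (\<phi> f))"

definition outer :: "'a set \<Rightarrow> ennreal" where
  "outer A = (INF U\<in>{U. openin mtopology U \<and> A \<subseteq> U}. content U)"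

lemma content_ge: "f \<in> urysohn_sets U \<Longrightarrow> ennreal (\<phi> f) \<le> content U"
  unfolding content_def by (rule SUP_upper)

lemma content_le: "(\<And>f. f \<in> urysohn_sets U \<Longrightarrow> ennreal (\<phi> f) \<le> c) \<Longrightarrow> content U \<le> c"
  unfolding content_def by (rule SUP_least)

lemma content_le_1: "content U \<le> 1"
  using urysohn_bounds(3) by (intro content_le) (auto simp: ennreal_le_1)

lemma content_mono: "U \<subseteq> V \<Longrightarrow> content U \<le> content V"
  by (intro content_le content_ge) (auto simp: urysohn_sets_def)

lemma content_approx:
  assumes "e > 0"
  obtains f where "f \<in> urysohn_sets U" "content U \<le> ennreal (\<phi> f + e)"
proof -
  have "\<exists>f\<in>urysohn_sets U. content U < ennreal (\<phi> f) + ennreal e"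
  proof (rule ccontr)
    assume "\<not> ?thesis"
    then have *: "ennreal (\<phi> f) + ennreal e \<le> content U" if "f \<in> urysohn_sets U" for f using that by (auto simp: not_less)
    have ne: "urysohn_sets U \<noteq> {}" by (auto simp: urysohn_sets_def intro!: exI[of _ "\<lambda>_. 0"])
    have "content U + ennreal e = (SUP f\<in>urysohn_sets U. ennreal (\<phi> f) + ennreal e)"
      unfolding content_def using ne by (simp add: ennreal_SUP_add_left)
    also have "\<dots> \<le> content U" using * by (intro SUP_least) auto
    finally have "content U + ennreal e \<le> content U + 0" by simp
    then show False using assms content_le_1[of U]
      by (subst (asm) ennreal_add_left_cancel_le) (auto simp: top_unique)
  qed
  then obtain f where f: "f \<in> urysohn_sets U" "content U < ennreal (\<phi> f) + ennreal e" by blast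
  with urysohn_bounds(2)[OF f(1)] assms have "content U \<le> ennreal (\<phi> f + e)" by (simp add: ennreal_plus)
  with f(1) that show ?thesis by blast
qed

text \<open>This is where \<open>sigma_smooth\<close> enters. Finite sums of test functions of the
  sets \<open>U i\<close> eventually exceed \<open>f\<close> at each point, so the excess of
  \<open>f\<close> over these sums decreases to 0 and its value under the functional becomes
  negligible.\<close>

lemma content_UN:
  assumes U: "\<And>i. openin mtopology (U i)"
  shows "content (\<Union>i::nat. U i) \<le> (\<Sum>i. content (U i))"
proof (rule content_le)
  fix f assume f: "f \<in> urysohn_sets (\<Union>i. U i)"
  note fb = urysohn_bounds[OF f]
  \<comment> \<open>Increases in \<open>k\<close> to the indicator of \<open>U i\<close>. The same
    \<open>k\<close> is the steepness here and the number of sets in \<open>G k\<close>, so that one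
    monotone sequence of functions suffices.\<close>
  define h where "h k i x = min 1 (real k * codist (U i) x)" for k i x
  have h: "h k i \<in> urysohn_sets (U i)" for k i
    unfolding urysohn_sets_def h_def using codist_nonneg[of "U i"] codist_eq_0[of _ "U i"] by auto
  define G where "G k x = (\<Sum>i<k. h k i x)" for k x
  have G: "G k \<in> bounded_continuous" for k
    unfolding G_def[abs_def] using h by (intro bounded_continuous_sum) (simp add: urysohn_sets_def)
  have h01: "0 \<le> h k i x \<and> h k i x \<le> 1" for k i x using codist_nonneg by (auto simp: h_def)
  have G0: "0 \<le> G k x" for k x using h01 by (auto simp: G_def intro: sum_nonneg)
  have hmono: "h k i x \<le> h (Suc k) i x" for k i x
    using codist_nonneg[of "U i" x] by (auto simp: h_def min_def algebra_simps)
  have Gmono: "G k x \<le> G (Suc k) x" for k x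
    unfolding G_def by (simp add: add_increasing2 h01 hmono sum_mono)
  define F where "F k x = max 0 (f x - G k x)" for k x
  have F: "F k \<in> bounded_continuous" for k
    unfolding F_def using fb(1) G by simp
  have key: "\<exists>k. \<phi> (F k) \<le> e" if e: "e > 0" for e
  proof (rule sigma_smooth[OF F _ _ _ e])
    fix n x assume x: "x \<in> M"
    have fx: "0 \<le> f x" "f x \<le> 1" using f x by (auto simp: urysohn_sets_def)
    show "0 \<le> F n x \<and> F n x \<le> 1" using fx G0[of n x] by (auto simp: F_def)
    show "F (Suc n) x \<le> F n x" using Gmono[of n x] by (auto simp: F_def)
    show "(\<lambda>n. F n x) \<longlonglongrightarrow> 0"
    proof (cases "x \<in> (\<Union>i. U i)")
      case False
      then have "f x = 0" using f x by (auto simp: urysohn_sets_def)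
      then have "F n x = 0" for n using G0[of n x] by (simp add: F_def)
      then show ?thesis by simp
    next
      case True
      then obtain i where i: "x \<in> U i" by blast
      define c where "c = codist (U i) x"
      have c: "c > 0" using codist_pos[OF U i] by (simp add: c_def)
      obtain N :: nat where N: "1 / c < real N" using reals_Archimedean2 by blast
      have "F k x = 0" if "k \<ge> max N (Suc i)" for k
      proof -
        have "1 < real N * c" using N c by (simp add: field_simps)
        also have "\<dots> \<le> real k * c" using that c by simp
        finally have "h k i x = 1" by (simp add: h_def c_def)
        moreover have "h k i x \<le> G k x" unfolding G_def using that h01 by (intro member_le_sum) auto
        ultimately show ?thesis using fx by (simp add: F_def)
      qed
      then have "eventually (\<lambda>k. F k x = 0) sequentially" unfolding eventually_sequentially by blast
      then show ?thesis by (rule tendsto_eventually)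
    qed
  qed
  show "ennreal (\<phi> f) \<le> (\<Sum>i. content (U i))"
  proof (rule ennreal_le_epsilon)
    fix e :: real assume e: "e > 0"
    obtain k where k: "\<phi> (F k) \<le> e" using key[OF e] by blast
    have "\<phi> f \<le> \<phi> (\<lambda>x. G k x + F k x)" using fb(1) G F by (intro mono) (auto simp: F_def)
    also have "\<dots> = (\<Sum>i<k. \<phi> (h k i)) + \<phi> (F k)"
    proof -
      have "\<phi> (G k) = (\<Sum>i<k. \<phi> (h k i))"
        unfolding G_def[abs_def] using urysohn_bounds(1)[OF h] by (intro sum) auto
      then show ?thesis by (subst add[OF G F]) simp
    qed
    finally have "\<phi> f \<le> (\<Sum>i<k. \<phi> (h k i)) + e" using k by simp
    then have "ennreal (\<phi> f) \<le> ennreal (\<Sum>i<k. \<phi> (h k i)) + ennreal e"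
      using urysohn_bounds(2)[OF h] e by (subst ennreal_plus[symmetric]) (auto intro!: sum_nonneg ennreal_leI)
    also have "ennreal (\<Sum>i<k. \<phi> (h k i)) = (\<Sum>i<k. ennreal (\<phi> (h k i)))"
      using urysohn_bounds(2)[OF h] by (subst sum_ennreal) auto
    also have "\<dots> \<le> (\<Sum>i<k. content (U i))" by (intro sum_mono content_ge h)
    also have "\<dots> \<le> (\<Sum>i. content (U i))" by (intro sum_le_suminf) auto
    finally show "ennreal (\<phi> f) \<le> (\<Sum>i. content (U i)) + ennreal e" by simp
  qed
qed

lemma outer_le: "openin mtopology U \<Longrightarrow> A \<subseteq> U \<Longrightarrow> outer A \<le> content U"
  unfolding outer_def by (rule INF_lower) auto

lemma outer_open: "openin mtopology U \<Longrightarrow> outer U = content U"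
  by (intro antisym outer_le) (auto simp: outer_def intro!: INF_greatest content_mono)

lemma outer_mono: "A \<subseteq> B \<Longrightarrow> outer A \<le> outer B"
  unfolding outer_def by (rule INF_superset_mono) auto

lemma outer_empty: "outer {} = 0"
proof -
  have "content {} \<le> ennreal 0"
  proof (rule content_le)
    fix f assume "f \<in> urysohn_sets {}"
    then have "\<phi> f \<le> \<phi> (\<lambda>_. 0)" by (intro mono) (auto simp: urysohn_sets_def)
    then show "ennreal (\<phi> f) \<le> ennreal 0" using const[of 0] by (auto simp: ennreal_neg)
  qed
  then show ?thesis using outer_open[of "{}"] by simp
qed

lemma outer_approx:
  assumes "A \<subseteq> M" "e > 0"
  obtains U where "openin mtopology U" "A \<subseteq> U" "content U \<le> outer A + ennreal e"
proof -
  have "outer A \<le> content M" using assms openin_topspace[of mtopology] by (intro outer_le) auto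
  then have "outer A \<noteq> top" using content_le_1[of M] by (auto simp: top_unique)
  then have "outer A < outer A + ennreal e" using assms by (simp add: ennreal_add_left_cancel_less less_top)
  then obtain U where "openin mtopology U" "A \<subseteq> U" "content U < outer A + ennreal e"
    unfolding outer_def by (auto simp: INF_less_iff)
  then show ?thesis using that by (auto intro: less_imp_le)
qed

lemma outer_measure_space_outer: "outer_measure_space (Pow M) outer"
  unfolding outer_measure_space_def
proof (intro conjI)
  show "positive (Pow M) outer" by (simp add: positive_def outer_empty)
  show "increasing (Pow M) outer" by (auto simp: increasing_def intro: outer_mono)
  show "countably_subadditive (Pow M) outer"
    unfolding countably_subadditive_def
  proof safe
    fix A :: "nat \<Rightarrow> 'a set" assume A: "range A \<subseteq> Pow M"
    show "outer (\<Union>i. A i) \<le> (\<Sum>i. outer (A i))"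
    proof (rule ennreal_le_epsilon)
      fix e :: real assume e: "e > 0"
      have "\<exists>U. openin mtopology U \<and> A i \<subseteq> U \<and> content U \<le> outer (A i) + ennreal (e * (1/2) ^ Suc i)" for i
        using outer_approx[of "A i" "e * (1/2) ^ Suc i"] A e by (metis PowD mult_pos_pos half_gt_zero_iff range_subsetD zero_less_one zero_less_power)
      then obtain U where U: "\<And>i. openin mtopology (U i)" "\<And>i. A i \<subseteq> U i"
        "\<And>i. content (U i) \<le> outer (A i) + ennreal (e * (1/2) ^ Suc i)" by metis
      have "outer (\<Union>i. A i) \<le> content (\<Union>i. U i)" using U by (intro outer_le openin_Union UN_mono) auto
      also have "\<dots> \<le> (\<Sum>i. content (U i))" by (rule content_UN[OF U(1)])
      also have "\<dots> \<le> (\<Sum>i. outer (A i) + ennreal (e * (1/2) ^ Suc i))" using U(3) by (intro suminf_le) auto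
      also have "\<dots> = (\<Sum>i. outer (A i)) + (\<Sum>i. ennreal (e * (1/2) ^ Suc i))" by (intro suminf_add[symmetric]) auto
      also have "(\<Sum>i. ennreal (e * (1/2) ^ Suc i)) = ennreal e"
        using sums_mult[OF power_half_series, of e] e by (intro suminf_ennreal_eq) auto
      finally show "outer (\<Union>i. A i) \<le> (\<Sum>i. outer (A i)) + ennreal e" .
    qed
  qed
qed

text \<open>Caratheodory measurability of an open set. A nearly optimal \<open>f\<close> for V
  \<inter> U is cut at a small level: the set where \<open>f\<close> reaches the level is closed and
  inside \<open>U\<close>, so its complement in \<open>V\<close> still covers A - U. The lowered
  \<open>f\<close> and a test function \<open>g\<close> of that complement live on disjoint sets,
  and their sum is a test function of \<open>V\<close>.\<close>

lemma open_lambda_system: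
  assumes U: "openin mtopology U"
  shows "U \<in> lambda_system M (Pow M) outer"
proof -
  have UM: "U \<subseteq> M" using openin_subset[OF U] by simp
  interpret P: sigma_algebra M "Pow M" by (rule sigma_algebra_Pow)
  have "outer (A \<inter> U) + outer (A - U) = outer A" if A: "A \<subseteq> M" for A
  proof (rule antisym)
    show "outer (A \<inter> U) + outer (A - U) \<le> outer A"
    proof (rule ennreal_le_epsilon)
      fix e :: real assume e: "e > 0"
      \<comment> \<open>Four errors of this size add up: one for \<open>V\<close>, one each for
        \<open>f\<close> and \<open>g\<close>, and one for lowering \<open>f\<close> to
        \<open>f'\<close>.\<close>
      define e' where "e' = e / 4"
      have e': "e' > 0" using e by (simp add: e'_def)
      obtain V where V: "openin mtopology V" "A \<subseteq> V" "content V \<le> outer A + ennreal e'"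
        using outer_approx[OF A e'] .
      have VU: "openin mtopology (V \<inter> U)" using V U by blast
      obtain f where f: "f \<in> urysohn_sets (V \<inter> U)" "content (V \<inter> U) \<le> ennreal (\<phi> f + e')"
        using content_approx[OF e'] .
      note fb = urysohn_bounds[OF f(1)]
      let ?F = "{x \<in> M. f x \<ge> e'}"
      have "closedin mtopology {x \<in> topspace mtopology. f x \<in> {e'..}}"
        using fb(1) by (intro closedin_continuous_map_preimage[of _ euclideanreal]) (auto simp: bounded_continuous_def)
      then have "closedin mtopology ?F" by simp
      then have VF: "openin mtopology (V - ?F)" using V by blast
      obtain g where g: "g \<in> urysohn_sets (V - ?F)" "content (V - ?F) \<le> ennreal (\<phi> g + e')"
        using content_approx[OF e'] .
      note gb = urysohn_bounds[OF g(1)]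
      define f' where "f' x = max 0 (f x - e')" for x
      have f': "f' \<in> bounded_continuous" unfolding f'_def using fb by simp
      have "(\<lambda>x. f' x + g x) \<in> urysohn_sets V"
        using f(1) g(1) e' bounded_continuous_add[OF f' gb(1)] unfolding urysohn_sets_def
        by (auto simp: f'_def max_def)
      then have 1: "ennreal (\<phi> f' + \<phi> g) \<le> content V" using content_ge add[OF f' gb(1)] by metis
      have "\<phi> f \<le> \<phi> (\<lambda>x. f' x + e')" using fb f' by (intro mono) (auto simp: f'_def)
      then have 2: "\<phi> f \<le> \<phi> f' + e'" using add[OF f', of "\<lambda>_. e'"] const[of e'] by simp
      have f'0: "\<phi> f' \<ge> 0" using f' by (intro pos) (auto simp: f'_def)
      have "outer (A \<inter> U) + outer (A - U) \<le> content (V \<inter> U) + content (V - ?F)"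
        using V VU VF f(1) e' A by (intro add_mono outer_le) (auto simp: urysohn_sets_def)
      also have "\<dots> \<le> ennreal (\<phi> f + e') + ennreal (\<phi> g + e')" using f g by (intro add_mono) auto
      also have "\<dots> = ennreal (\<phi> f + e' + (\<phi> g + e'))" using fb gb e' by (intro ennreal_plus[symmetric]) auto
      also have "\<dots> \<le> ennreal ((\<phi> f' + \<phi> g) + 3 * e')" using 2 by (intro ennreal_leI) auto
      also have "\<dots> = ennreal (\<phi> f' + \<phi> g) + ennreal (3 * e')" using f'0 gb e' by (intro ennreal_plus) auto
      also have "\<dots> \<le> outer A + ennreal e' + ennreal (3 * e')" using 1 V(3) by (intro add_mono) auto
      also have "\<dots> = outer A + ennreal e" using e' by (simp add: add.assoc ennreal_plus[symmetric] e'_def del: ennreal_plus)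
      finally show "outer (A \<inter> U) + outer (A - U) \<le> outer A + ennreal e" .
    qed
    \<comment> \<open>Countable subadditivity for two sets, padded with empty ones.\<close>
    let ?B = "\<lambda>i::nat. if i = 0 then A \<inter> U else if i = 1 then A - U else {}"
    have "outer A = outer (\<Union>i. ?B i)"
      by (rule arg_cong[of _ _ outer]) (auto split: if_splits)
    also have "\<dots> \<le> (\<Sum>i. outer (?B i))"
    proof -
      have "countably_subadditive (Pow M) outer"
        using outer_measure_space_outer by (simp add: outer_measure_space_def)
      moreover have "range ?B \<subseteq> Pow M" "disjoint_family ?B" using A by (auto simp: disjoint_family_on_def)
      ultimately show ?thesis using A unfolding countably_subadditive_def by blast
    qed
    also have "\<dots> = (\<Sum>i\<in>{0, 1}. outer (?B i))"
      by (rule suminf_finite) (auto simp: outer_empty)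
    finally show "outer A \<le> outer (A \<inter> U) + outer (A - U)" by simp
  qed
  then show ?thesis using UM by (auto simp: P.lambda_system_eq)
qed

definition rep :: "'a measure" where
  "rep = measure_of M {U. openin mtopology U} outer"

lemma
  shows space_rep: "space rep = M"
    and sets_rep: "sets rep = sets (borel_of mtopology)"
    and emeasure_rep_open: "openin mtopology U \<Longrightarrow> emeasure rep U = content U"
    and prob_space_rep: "prob_space rep"
proof -
  have sub: "{U. openin mtopology U} \<subseteq> Pow M" using openin_subset by fastforce
  show space: "space rep = M" using sub by (simp add: rep_def space_measure_of)
  show "sets rep = sets (borel_of mtopology)" using sub by (simp add: rep_def borel_of_def)
  interpret P: sigma_algebra M "Pow M" by (rule sigma_algebra_Pow)
  have L: "measure_space M (lambda_system M (Pow M) outer) outer"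
    by (rule P.caratheodory_lemma[OF outer_measure_space_outer])
  then interpret L: sigma_algebra M "lambda_system M (Pow M) outer" by (simp add: measure_space_def)
  have "sigma_sets M {U. openin mtopology U} \<subseteq> lambda_system M (Pow M) outer"
    using open_lambda_system by (intro L.sigma_sets_subset) auto
  with L have ms: "measure_space M (sigma_sets M {U. openin mtopology U}) outer"
    using sub by (intro measure_down[OF L] sigma_algebra_sigma_sets)
  show em: "emeasure rep U = content U" if "openin mtopology U" for U
    using that ms sub space
    by (subst emeasure_measure_of[OF rep_def]) (auto simp: measure_space_def outer_open rep_def)
  have "content M = 1"
    using content_ge[of "\<lambda>_. 1" M] one by (intro antisym content_le_1) (auto simp: urysohn_sets_def)
  then show "prob_space rep"
    using em[of M] openin_topspace[of mtopology] by (intro prob_spaceI) (simp add: space)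
qed


text \<open>Slice \<open>f\<close> into \<open>n\<close> layers of height 1 / n. A layer rescaled by
  \<open>n\<close> is a test function of the open set where \<open>f\<close> exceeds the lower level
  of the layer, so its value is at most 1 / n times the measure of that set. These indicators,
  divided by \<open>n\<close>, sum to at most f + 1 / n.\<close>

lemma le_integral_rep:
  assumes f: "f \<in> bounded_continuous" and f01: "\<And>x. x \<in> M \<Longrightarrow> 0 \<le> f x \<and> f x \<le> 1"
  shows "\<phi> f \<le> (LINT x|rep. f x)"
proof (rule field_le_epsilon)
  fix e :: real assume e: "e > 0"
  interpret R: prob_space rep by (rule prob_space_rep)
  have meas[measurable]: "f \<in> borel_measurable rep" by (rule bounded_continuous_measurable[OF sets_rep f])
  obtain m where m: "1 / real (Suc m) < e" using nat_approx_posE[OF e] by metis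
  define n where "n = Suc m"
  have n: "real n > 0" "1 / real n < e" using m by (auto simp: n_def)
  \<comment> \<open>The part of \<open>f\<close> between the levels i / n and (i + 1) / n; by
    \<open>min_plus_clamp\<close> the layers telescope to \<open>f\<close>.\<close>
  define g where "g i x = max 0 (min (1 / n) (f x - i / n))" for i :: nat and x
  define V where "V i = {x \<in> M. f x > i / n}" for i :: nat
  have g: "g i \<in> bounded_continuous" for i unfolding g_def[abs_def] using f by simp
  have sum_g: "(\<Sum>i<k. g i x) = min (f x) (k / n)" if "x \<in> M" for x k
  proof (induction k)
    case 0 then show ?case using f01[OF that] by simp
  next
    case (Suc k)
    have "(\<Sum>i<Suc k. g i x) = min (f x) (k / n) + max 0 (min (1 / n) (f x - k / n))"
      using Suc by (simp add: g_def)
    also have "\<dots> = min (f x) (k / n + 1 / n)" using n by (intro min_plus_clamp) simp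
    also have "k / n + 1 / n = real (Suc k) / n" by (simp add: add_divide_distrib)
    finally show ?case .
  qed
  have sum_V: "(\<Sum>i<k. (1 / n) * indicator (V i) x) \<le> min (f x + 1 / n) (k / n)" if "x \<in> M" for x k
  proof (induction k)
    case 0 then show ?case using f01[OF that] n by (simp add: add_nonneg_nonneg)
  next
    case (Suc k)
    have k: "real (Suc k) / n = k / n + 1 / n" by (simp add: add_divide_distrib)
    show ?case
    proof (cases "f x > k / n")
      case True
      then have "indicator (V k) x = (1::real)" using that by (simp add: V_def)
      then have "(\<Sum>i<Suc k. (1 / n) * indicator (V i) x) \<le> k / n + 1 / n"
        using Suc by (simp add: min.bounded_iff)
      also have "\<dots> \<le> min (f x + 1 / n) (real (Suc k) / n)" using True k by (intro min.boundedI) simp_all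
      finally show ?thesis .
    next
      case False
      then have "(\<Sum>i<Suc k. (1 / n) * indicator (V i) x) \<le> min (f x + 1 / n) (k / n)"
        using Suc by (simp add: V_def)
      also have "\<dots> \<le> min (f x + 1 / n) (real (Suc k) / n)" using n unfolding k by (intro min.mono) simp_all
      finally show ?thesis .
    qed
  qed
  have V: "openin mtopology (V i)" for i
  proof -
    have "openin mtopology {x \<in> topspace mtopology. f x \<in> {i / n<..}}"
      using f by (intro openin_continuous_map_preimage[of _ euclideanreal]) (auto simp: bounded_continuous_def)
    then show ?thesis by (simp add: V_def)
  qed
  have [measurable]: "V i \<in> sets rep" for i
    using borel_of_open[OF V] by (simp add: sets_rep)
  have le: "\<phi> (g i) \<le> (1 / n) * measure rep (V i)" for i
  proof -
    have "(\<lambda>x. real n * g i x) \<in> urysohn_sets (V i)"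
      unfolding urysohn_sets_def
    proof (intro CollectI conjI ballI)
      show "(\<lambda>x. real n * g i x) \<in> bounded_continuous" using g by (rule bounded_continuous_scale)
      fix x
      show "0 \<le> real n * g i x" using n by (simp add: g_def)
      have "g i x \<le> 1 / n" using n by (simp add: g_def)
      then show "real n * g i x \<le> 1" using n by (simp add: field_simps)
    next
      fix x assume "x \<in> M - V i"
      then have "f x - i / n \<le> 0" by (auto simp: V_def)
      then show "real n * g i x = 0" by (simp add: g_def)
    qed
    then have "ennreal (\<phi> (\<lambda>x. real n * g i x)) \<le> emeasure rep (V i)"
      using content_ge emeasure_rep_open[OF V] by simp
    then have "\<phi> (\<lambda>x. real n * g i x) \<le> measure rep (V i)"
      by (simp add: R.emeasure_eq_measure)
    then show ?thesis using scale[OF g] n by (simp add: field_simps)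
  qed
  have int_f: "integrable rep f"
    using f01 by (intro R.integrable_const_bound[of _ 1]) (auto simp: space_rep)
  have "f x = (\<Sum>i<n. g i x)" if "x \<in> M" for x
    using sum_g[OF that, of n] f01[OF that] n by simp
  then have "\<phi> f \<le> \<phi> (\<lambda>x. \<Sum>i<n. g i x)"
    by (intro mono[OF f] bounded_continuous_sum g) (simp only: order_refl)
  also have "\<dots> = (\<Sum>i<n. \<phi> (g i))" using g by (intro sum) auto
  also have "\<dots> \<le> (\<Sum>i<n. (1 / n) * measure rep (V i))" by (intro sum_mono le)
  also have "\<dots> = (LINT x|rep. (\<Sum>i<n. (1 / n) * indicator (V i) x))"
    by (subst Bochner_Integration.integral_sum) (auto simp: R.emeasure_eq_measure)
  also have "\<dots> \<le> (LINT x|rep. f x + 1 / n)"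
    using sum_V[of _ n] int_f by (intro integral_mono) (auto simp: space_rep R.emeasure_eq_measure)
  also have "\<dots> = (LINT x|rep. f x) + 1 / n" using int_f by (simp add: R.prob_space)
  finally show "\<phi> f \<le> (LINT x|rep. f x) + e" using n by simp
qed

text \<open>An affine change of scale brings any bounded \<open>f\<close> into the range of
  \<open>le_integral_rep\<close>; applying the resulting inequality to \<open>f\<close> and to its
  negative gives equality.\<close>

lemma integral_rep:
  assumes f: "f \<in> bounded_continuous"
  shows "(LINT x|rep. f x) = \<phi> f"
proof -
  interpret R: prob_space rep by (rule prob_space_rep)
  from f obtain A where A: "\<And>x. x \<in> M \<Longrightarrow> \<bar>f x\<bar> \<le> A" by (elim bounded_continuousE) blast
  define B where "B = max A 1"
  have B: "B > 0" "\<And>x. x \<in> M \<Longrightarrow> \<bar>f x\<bar> \<le> B" using A by (force simp: B_def)+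
  have int: "integrable rep f"
    using B(2) bounded_continuous_measurable[OF sets_rep f]
    by (intro R.integrable_const_bound[of _ B]) (auto simp: space_rep)
  have half: "\<phi> g \<le> (LINT x|rep. g x)" if g: "g \<in> bounded_continuous" "\<And>x. x \<in> M \<Longrightarrow> \<bar>g x\<bar> \<le> B"
    "integrable rep g" for g
  proof -
    let ?h = "\<lambda>x. (1 / (2 * B)) * (g x + B)"
    have "\<phi> ?h \<le> (LINT x|rep. ?h x)"
    proof (rule le_integral_rep)
      fix x assume "x \<in> M"
      from g(2)[OF this] B(1) show "0 \<le> ?h x \<and> ?h x \<le> 1" by (auto simp: field_simps abs_le_iff)
    qed (intro bounded_continuous_scale bounded_continuous_add bounded_continuous_const g)
    moreover have "\<phi> ?h = (1 / (2 * B)) * (\<phi> g + B)"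
      using g by (subst scale) (simp_all add: add const)
    moreover have "(LINT x|rep. ?h x) = (1 / (2 * B)) * ((LINT x|rep. g x) + B)"
      using g(3) by (simp add: R.prob_space)
    ultimately show ?thesis using B by (simp add: field_simps)
  qed
  have "\<phi> (\<lambda>x. -1 * f x) \<le> (LINT x|rep. -1 * f x)"
    using f B(2) int by (intro half bounded_continuous_scale) auto
  then have "(LINT x|rep. f x) \<le> \<phi> f" using scale[OF f, of "-1"] by simp
  with half[OF f B(2) int] show ?thesis by simp
qed

end

lemma openin_weak_topology_basic:
  assumes "continuous_map X euclideanreal f" "bounded (f ` topspace X)" "open U"
  shows "openin (weak_topology X) {N \<in> prob_measures_on X. (LINT x|N. f x) \<in> U}"
  unfolding weak_topology_def using assms
  by (intro topology_generated_by_Basis) blast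

section \<open>Prokhorov's theorem: tight families are relatively compact\<close>

context Metric_space
begin

text \<open>The weak topology is the one pulled back from the product of lines indexed by the test
  functions, so that Tychonoff's theorem applies to the positive normalized linear functionals that
  are tight along a fixed sequence of compact sets; these are all given by measures.\<close>

theorem tight_imp_relatively_compactin:
  assumes A: "A \<subseteq> prob_measures_on mtopology"
    and tight: "\<And>e. e > 0 \<Longrightarrow> \<exists>K. compactin mtopology K \<and> (\<forall>N\<in>A. measure N (M - K) \<le> e)"
  shows "relatively_compactin (weak_topology mtopology) A"
proof -
  let ?W = "weak_topology mtopology" and ?I = bounded_continuous
  have "\<forall>m. \<exists>K. compactin mtopology K \<and> (\<forall>N\<in>A. measure N (M - K) \<le> 1 / real (Suc m))"
    using tight by simp
  then obtain K where K: "\<And>m. compactin mtopology (K m)"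
    "\<And>m N. N \<in> A \<Longrightarrow> measure N (M - K m) \<le> 1 / real (Suc m)" by metis
  have "\<forall>f\<in>?I. \<exists>B. \<forall>x\<in>M. \<bar>f x\<bar> \<le> B" using bounded_continuousE by metis
  then obtain B where B: "\<And>f x. f \<in> ?I \<Longrightarrow> x \<in> M \<Longrightarrow> \<bar>f x\<bar> \<le> B f" by metis
  define P where "P = product_topology (\<lambda>_. euclideanreal) ?I"
  define \<iota> where "\<iota> N = (\<lambda>f\<in>?I. LINT x|N. f x)" for N :: "'a measure"
  have topP: "topspace P = PiE ?I (\<lambda>_. UNIV)" by (simp add: P_def)
  have proj: "continuous_map P euclideanreal (\<lambda>\<psi>. \<psi> f)" if "f \<in> ?I" for f
    unfolding P_def using continuous_map_product_projection[OF that, of "\<lambda>_. euclideanreal"] by simp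
  define Q where "Q = PiE ?I (\<lambda>f. {- B f..B f})"
  define S where "S g = {\<psi> \<in> topspace P. g \<psi> \<in> {0::real..}}" for g
  \<comment> \<open>\<open>G1\<close> to \<open>G5\<close> translate the axioms of
    \<open>tight_functional\<close> (additivity, homogeneity, normalization, positivity, tightness)
    into continuous functions of \<psi> required to be nonnegative; the equations in
    \<open>G1\<close> to \<open>G3\<close> also enter with the opposite sign. \<open>C\<close> is
    thus a closed subset of the compact product \<open>Q\<close> of intervals.\<close>
  define G1 :: "((('a \<Rightarrow> real) \<Rightarrow> real) \<Rightarrow> real) set"
    where "G1 = (\<lambda>(f, g) \<psi>. \<psi> (\<lambda>x. f x + g x) - \<psi> f - \<psi> g) ` (?I \<times> ?I)"
  define G2 :: "((('a \<Rightarrow> real) \<Rightarrow> real) \<Rightarrow> real) set" where "G2 = (\<lambda>(c, f) \<psi>. \<psi> (\<lambda>x. c * f x) - c * \<psi> f) ` (UNIV \<times> ?I)"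
  define G3 :: "((('a \<Rightarrow> real) \<Rightarrow> real) \<Rightarrow> real) set" where "G3 = {\<lambda>\<psi>. \<psi> (\<lambda>_. 1) - 1}"
  define G4 :: "((('a \<Rightarrow> real) \<Rightarrow> real) \<Rightarrow> real) set" where "G4 = (\<lambda>f \<psi>. \<psi> f) ` {f \<in> ?I. \<forall>x\<in>M. 0 \<le> f x}"
  define G5 :: "((('a \<Rightarrow> real) \<Rightarrow> real) \<Rightarrow> real) set" where "G5 = (\<lambda>(m::nat, f) \<psi>. 1 / Suc m - \<psi> f) `
    {(m, f). f \<in> ?I \<and> (\<forall>x\<in>M. 0 \<le> f x \<and> f x \<le> 1) \<and> (\<forall>x\<in>K m. f x = 0)}"
  define G where "G = (G1 \<union> G2 \<union> G3) \<union> (\<lambda>g \<psi>. - g \<psi>) ` (G1 \<union> G2 \<union> G3) \<union> G4 \<union> G5"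
  define C where "C = \<Inter>(insert Q (S ` G))"
  have Gc: "continuous_map P euclideanreal g" if "g \<in> G" for g
  proof -
    have 1: "continuous_map P euclideanreal g" if "g \<in> G1 \<union> G2 \<union> G3" for g
      using that unfolding G1_def G2_def G3_def
      by (elim UnE imageE singletonE)
        (simp_all add: split_beta mem_Times_iff continuous_map_diff continuous_map_real_mult_left proj)
    have "continuous_map P euclideanreal g" if "g \<in> G4 \<union> G5" for g
      using that unfolding G4_def G5_def
      by (elim UnE imageE) (auto intro!: continuous_map_diff simp: proj)
    with 1 that show ?thesis unfolding G_def by auto
  qed
  have Q: "compactin P Q" "closedin P Q"
    unfolding P_def Q_def by (auto simp: compactin_PiE closedin_product_topology)
  have closed_S: "closedin P (S g)" if "g \<in> G" for g
    unfolding S_def using Gc[OF that] by (rule closedin_continuous_map_preimage) auto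
  have closed_C: "closedin P C"
    unfolding C_def using Q closed_S by (intro closedin_Inter) auto
  have compact_C: "compactin P C"
    by (rule closed_compactin[OF Q(1) _ closed_C]) (auto simp: C_def)
  have C_iff: "\<psi> \<in> C \<longleftrightarrow> \<psi> \<in> Q \<and> (\<forall>g\<in>G. 0 \<le> g \<psi>)" for \<psi>
    using closedin_subset[OF Q(2)] by (auto simp: C_def S_def)
  \<comment> \<open>By the Riesz representation, every point of \<open>C\<close> comes from a
    probability measure; without this, a cover of \<open>D\<close> would not give a cover of
    \<open>C\<close>.\<close>
  have rep: "\<exists>N\<in>prob_measures_on mtopology. \<iota> N = \<psi>" if "\<psi> \<in> C" for \<psi>
  proof -
    have "\<forall>g\<in>G. 0 \<le> g \<psi>" using \<open>\<psi> \<in> C\<close> by (simp add: C_iff)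
    note G = bspec[OF this]
    have eq0: "g \<psi> = 0" if "g \<in> G1 \<union> G2 \<union> G3" for g
    proof -
      have "g \<in> G" unfolding G_def by (rule UnI1, rule UnI1, rule UnI1, rule that)
      moreover have "(\<lambda>\<psi>. - g \<psi>) \<in> G"
        unfolding G_def by (rule UnI1, rule UnI1, rule UnI2, rule imageI, rule that)
      ultimately show ?thesis using G[of g] G[of "\<lambda>\<psi>. - g \<psi>"] by linarith
    qed
    interpret tight_functional M d \<psi> K
    proof
      show "\<psi> (\<lambda>x. f x + g x) = \<psi> f + \<psi> g" if "f \<in> ?I" "g \<in> ?I" for f g
      proof -
        have "(\<lambda>\<psi>. \<psi> (\<lambda>x. f x + g x) - \<psi> f - \<psi> g) \<in> G1"
          unfolding G1_def by (rule image_eqI[of _ _ "(f, g)"]) (simp_all add: that)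
        from eq0[OF UnI1[OF UnI1[OF this]]] show ?thesis by simp
      qed
      show "\<psi> (\<lambda>x. c * f x) = c * \<psi> f" if "f \<in> ?I" for f c
      proof -
        have "(\<lambda>\<psi>. \<psi> (\<lambda>x. c * f x) - c * \<psi> f) \<in> G2"
          unfolding G2_def by (rule image_eqI[of _ _ "(c, f)"]) (simp_all add: that)
        from eq0[OF UnI1[OF UnI2[OF this]]] show ?thesis by simp
      qed
      show "\<psi> (\<lambda>_. 1) = 1"
        using eq0[OF UnI2, of "\<lambda>\<psi>. \<psi> (\<lambda>_. 1) - 1"] unfolding G3_def by simp
      show "0 \<le> \<psi> f" if "f \<in> ?I" "\<And>x. x \<in> M \<Longrightarrow> 0 \<le> f x" for f
      proof -
        have "(\<lambda>\<psi>. \<psi> f) \<in> G"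
          unfolding G_def G4_def by (rule UnI1, rule UnI2, rule image_eqI[OF refl]) (simp add: that)
        from G[OF this] show ?thesis .
      qed
      show "compactin mtopology (K m)" for m by (rule K)
      show "\<psi> f \<le> 1 / Suc m" if "f \<in> ?I" "\<And>x. x \<in> M \<Longrightarrow> 0 \<le> f x \<and> f x \<le> 1"
        "\<And>x. x \<in> K m \<Longrightarrow> f x = 0" for f m
      proof -
        have "(\<lambda>(m::nat, f) \<psi>. 1 / Suc m - \<psi> f) (m, f) \<in> G"
          unfolding G_def G5_def using that by (intro UnI2 imageI) simp
        from G[OF this] show ?thesis by simp
      qed
    qed
    have "\<iota> rep = \<psi>"
    proof
      fix f
      have "\<psi> \<in> extensional ?I" using \<open>\<psi> \<in> C\<close> by (auto simp: C_iff Q_def PiE_def)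
      then show "\<iota> rep f = \<psi> f"
        using integral_rep[of f] by (cases "f \<in> ?I") (simp_all add: \<iota>_def extensional_def)
    qed
    moreover have "rep \<in> prob_measures_on mtopology"
      by (simp add: prob_measures_on_def sets_rep prob_space_rep)
    ultimately show ?thesis by blast
  qed
  have cont: "continuous_map ?W P \<iota>"
    unfolding P_def continuous_map_componentwise
  proof (intro conjI ballI)
    show "\<iota> ` topspace ?W \<subseteq> extensional ?I" by (auto simp: \<iota>_def)
    fix f assume f: "f \<in> ?I"
    show "continuous_map ?W euclideanreal (\<lambda>N. \<iota> N f)"
      unfolding continuous_map_def
    proof (intro conjI allI impI)
      fix U :: "real set" assume "openin euclideanreal U"
      then show "openin ?W {N \<in> topspace ?W. \<iota> N f \<in> U}"
        using openin_weak_topology_basic[of mtopology f U] f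
        by (simp add: \<iota>_def bounded_continuous_def)
    qed simp
  qed
  define D where "D = {N \<in> topspace ?W. \<iota> N \<in> C}"
  have closed_D: "closedin ?W D"
    unfolding D_def by (rule closedin_continuous_map_preimage[OF cont closed_C])
  have AD: "A \<subseteq> D"
  proof
    fix N assume N: "N \<in> A"
    then have Np: "sets N = sets (borel_of mtopology)" "prob_space N" using A by (auto simp: prob_measures_on_def)
    interpret N: prob_space N by fact
    have spN: "space N = M" using sets_eq_imp_space_eq[OF Np(1)] by simp
    have meas: "f \<in> borel_measurable N" if "f \<in> ?I" for f
      by (rule bounded_continuous_measurable[OF Np(1) that])
    have int: "integrable N f" if "f \<in> ?I" for f
      using B[OF that] meas[OF that] by (intro N.integrable_const_bound[of _ "B f"]) (auto simp: spN)
    have inQ: "\<iota> N \<in> Q"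
    proof -
      have "(LINT x|N. f x) \<in> {- B f..B f}" if "f \<in> ?I" for f
      proof -
        have "(LINT x|N. f x) \<le> B f" "- B f \<le> (LINT x|N. f x)"
          using B[OF that] int[OF that]
          by (auto intro!: N.integral_le_const N.integral_ge_const simp: spN abs_le_iff minus_le_iff)
        then show ?thesis by simp
      qed
      then show ?thesis by (auto simp: Q_def \<iota>_def)
    qed
    have K_sets: "M - K m \<in> sets N" for m
    proof -
      have "openin mtopology (M - K m)"
        using compactin_imp_closedin[OF Hausdorff_space_mtopology K(1)] by blast
      then show ?thesis by (simp only: Np(1) borel_of_open)
    qed
    have "0 \<le> g (\<iota> N)" if "g \<in> G5" for g
    proof -
      obtain m f where g: "g = (\<lambda>\<psi>. 1 / Suc m - \<psi> f)" and f: "f \<in> ?I"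
        "\<And>x. x \<in> M \<Longrightarrow> 0 \<le> f x \<and> f x \<le> 1" "\<And>x. x \<in> K m \<Longrightarrow> f x = 0"
        using \<open>g \<in> G5\<close> by (auto simp: G5_def)
      have "(LINT x|N. f x) \<le> (LINT x|N. indicator (M - K m) x)"
      proof (rule integral_mono[OF int[OF f(1)] integrable_real_indicator[OF K_sets]])
        show "emeasure N (M - K m) < \<infinity>" by (simp add: N.emeasure_eq_measure)
        fix x assume "x \<in> space N"
        then show "f x \<le> indicator (M - K m) x" using f(2,3)[of x] by (auto simp: spN indicator_def)
      qed
      also have "\<dots> \<le> 1 / Suc m"
        using K(2)[OF N, of m] sets.sets_into_space[OF K_sets[of m]] by (simp add: Int_absorb2)
      finally show ?thesis using f g by (simp add: \<iota>_def)
    qed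
    then have "\<forall>g\<in>G5. 0 \<le> g (\<iota> N)" ..
    moreover have "g (\<iota> N) = 0" if "g \<in> G1 \<union> G2 \<union> G3" for g
      using that int by (auto simp: G1_def G2_def G3_def \<iota>_def N.prob_space)
    then have *: "\<forall>g\<in>G1 \<union> G2 \<union> G3. g (\<iota> N) = 0" ..
    have "\<forall>g\<in>G1 \<union> G2 \<union> G3. 0 \<le> g (\<iota> N)"
    proof
      fix g assume "g \<in> G1 \<union> G2 \<union> G3"
      from bspec[OF * this] show "0 \<le> g (\<iota> N)" by simp
    qed
    moreover have "\<forall>g\<in>(\<lambda>g \<psi>. - g \<psi>) ` (G1 \<union> G2 \<union> G3). 0 \<le> g (\<iota> N)"
    proof
      fix g assume "g \<in> (\<lambda>g \<psi>. - g \<psi>) ` (G1 \<union> G2 \<union> G3)"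
      then obtain g' where g': "g = (\<lambda>\<psi>. - g' \<psi>)" "g' \<in> G1 \<union> G2 \<union> G3" by (rule imageE)
      from bspec[OF * g'(2)] g'(1) show "0 \<le> g (\<iota> N)" by simp
    qed
    moreover have "\<forall>g\<in>G4. 0 \<le> g (\<iota> N)"
      by (auto simp: G4_def \<iota>_def spN intro!: Bochner_Integration.integral_nonneg_AE AE_I2)
    ultimately have "\<forall>g\<in>G. 0 \<le> g (\<iota> N)"
      unfolding G_def ball_Un by (auto simp only: ball_simps)
    then have "\<iota> N \<in> C" using inQ by (simp add: C_iff)
    then show "N \<in> D" using A N by (auto simp: D_def)
  qed
  \<comment> \<open>All weakly open sets are preimages of open sets of the product, so an open cover
    of \<open>D\<close> comes from one of the compact set \<open>C\<close>.\<close>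
  have pull: "\<exists>V. openin P V \<and> W = {N \<in> topspace ?W. \<iota> N \<in> V}" if "openin ?W W" for W
  proof -
    let ?S = "{{N \<in> prob_measures_on mtopology. (LINT x|N. f x) \<in> U} | f U.
        continuous_map mtopology euclideanreal f \<and> bounded (f ` topspace mtopology) \<and> open U}"
    have "generate_topology_on ?S W" using that unfolding weak_topology_def by (rule openin_topology_generated_by)
    then show ?thesis
    proof (induction rule: generate_topology_on.induct)
      case Empty then show ?case by (intro exI[of _ "{}"]) auto
    next
      case (Int a b)
      then obtain V V' where "openin P V" "a = {N \<in> topspace ?W. \<iota> N \<in> V}"
        "openin P V'" "b = {N \<in> topspace ?W. \<iota> N \<in> V'}" by blast
      then show ?case by (intro exI[of _ "V \<inter> V'"]) auto
    next
      case (UN k)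
      then have "\<forall>a\<in>k. \<exists>V. openin P V \<and> a = {N \<in> topspace ?W. \<iota> N \<in> V}" by blast
      from bchoice[OF this] obtain V where
        "\<forall>a\<in>k. openin P (V a) \<and> a = {N \<in> topspace ?W. \<iota> N \<in> V a}" ..
      then have V: "\<And>a. a \<in> k \<Longrightarrow> openin P (V a)" "\<And>a. a \<in> k \<Longrightarrow> a = {N \<in> topspace ?W. \<iota> N \<in> V a}"
        by blast+
      have "\<Union>k = (\<Union>a\<in>k. a)" by simp
      also have "\<dots> = (\<Union>a\<in>k. {N \<in> topspace ?W. \<iota> N \<in> V a})" by (rule SUP_cong[OF refl V(2)])
      also have "\<dots> = {N \<in> topspace ?W. \<iota> N \<in> \<Union>(V ` k)}" by auto
      finally have "\<Union>k = {N \<in> topspace ?W. \<iota> N \<in> \<Union>(V ` k)}" .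
      moreover have "openin P (\<Union>(V ` k))" using V(1) by (intro openin_Union) auto
      ultimately show ?case by blast
    next
      case (Basis s)
      then obtain f U where s: "s = {N \<in> prob_measures_on mtopology. (LINT x|N. f x) \<in> U}"
        "f \<in> ?I" "open U" by (auto simp: bounded_continuous_def)
      have "openin P {\<psi> \<in> topspace P. \<psi> f \<in> U}"
        using proj[OF s(2)] s(3) by (intro openin_continuous_map_preimage) auto
      moreover have "s = {N \<in> topspace ?W. \<iota> N \<in> {\<psi> \<in> topspace P. \<psi> f \<in> U}}"
        using s by (auto simp: \<iota>_def topP)
      ultimately show ?case by blast
    qed
  qed
  have compact_D: "compactin ?W D"
    unfolding compactin_def
  proof (intro conjI allI impI)
    show "D \<subseteq> topspace ?W" by (auto simp: D_def)
    fix \<U> assume U: "Ball \<U> (openin ?W) \<and> D \<subseteq> \<Union>\<U>"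
    then have "\<forall>W\<in>\<U>. \<exists>V. openin P V \<and> W = {N \<in> topspace ?W. \<iota> N \<in> V}" using pull by blast
    from bchoice[OF this] obtain V where
      "\<forall>W\<in>\<U>. openin P (V W) \<and> W = {N \<in> topspace ?W. \<iota> N \<in> V W}" ..
    then have V: "\<And>W. W \<in> \<U> \<Longrightarrow> openin P (V W)"
      "\<And>W. W \<in> \<U> \<Longrightarrow> W = {N \<in> topspace ?W. \<iota> N \<in> V W}" by blast+
    have "C \<subseteq> \<Union>(V ` \<U>)"
    proof
      fix \<psi> assume "\<psi> \<in> C"
      then obtain N where N: "N \<in> prob_measures_on mtopology" "\<iota> N = \<psi>" using rep by blast
      then have "N \<in> D" using \<open>\<psi> \<in> C\<close> by (simp add: D_def)
      then obtain W where "W \<in> \<U>" "N \<in> W" using U by blast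
      then have "\<iota> N \<in> V W" using V(2)[OF \<open>W \<in> \<U>\<close>] by blast
      then show "\<psi> \<in> \<Union>(V ` \<U>)" using \<open>W \<in> \<U>\<close> N by blast
    qed
    then obtain \<F> where F: "finite \<F>" "\<F> \<subseteq> V ` \<U>" "C \<subseteq> \<Union>\<F>"
      using compactinD[OF compact_C, of "V ` \<U>"] V(1) by auto
    then obtain \<F>' where F': "finite \<F>'" "\<F>' \<subseteq> \<U>" "\<F> = V ` \<F>'" using finite_subset_image[OF F(1,2)] by blast
    have "D \<subseteq> \<Union>\<F>'"
    proof
      fix N assume "N \<in> D"
      then obtain W where "W \<in> \<F>'" "\<iota> N \<in> V W" "N \<in> topspace ?W" using F F' by (auto simp: D_def)
      then have "N \<in> W" using V(2)[of W] F'(2) by blast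
      then show "N \<in> \<Union>\<F>'" using \<open>W \<in> \<F>'\<close> by blast
    qed
    with F' show "\<exists>\<F>. finite \<F> \<and> \<F> \<subseteq> \<U> \<and> D \<subseteq> \<Union>\<F>" by blast
  qed
  have "?W closure_of A \<subseteq> D" using AD closed_D by (rule closure_of_minimal)
  then have "compactin ?W (?W closure_of A)"
    by (rule closed_compactin[OF compact_D _ closedin_closure_of])
  then show ?thesis using A by (simp add: relatively_compactin_def)
qed

end

section \<open>Compactness in the Skorohod space\<close>

subsection \<open>Separated sequences of times and time changes\<close>

text \<open>The bound on \<open>s 0\<close> keeps jumps away from time 0, which every time change
  fixes: a jump close to 0 could not be moved there.\<close>

definition separated :: "real \<Rightarrow> (nat \<Rightarrow> real) \<Rightarrow> bool" where
  "separated \<delta> s \<longleftrightarrow> \<delta> \<le> s 0 \<and> (\<forall>i. s i + \<delta> \<le> s (Suc i))"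

lemma separated_lower: "separated \<delta> s \<Longrightarrow> (real i + 1) * \<delta> \<le> s i"
proof (induction i)
  case (Suc i)
  then have "(real i + 1) * \<delta> \<le> s i" "s i + \<delta> \<le> s (Suc i)" by (simp_all add: separated_def)
  moreover have "(real (Suc i) + 1) * \<delta> = (real i + 1) * \<delta> + \<delta>" by (simp add: algebra_simps)
  ultimately show ?case by linarith
qed (simp add: separated_def)

lemma separated_less:
  assumes "separated \<delta> s" "0 < \<delta>" "i < j"
  shows "s i + \<delta> \<le> s j"
  using assms(3)
proof (induction rule: less_Suc_induct)
  case (1 i) then show ?case using assms(1) by (simp add: separated_def)
next
  case (2 i j k) then show ?case using assms(2) by linarith
qed

lemma separated_ge:
  assumes "separated \<delta> s" "0 < \<delta>"
  shows "\<delta> \<le> s i"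
proof (cases i)
  case (Suc j)
  have "\<delta> \<le> s 0" "s 0 + \<delta> \<le> s (Suc j)"
    using assms separated_less[OF assms, of 0 "Suc j"] by (simp_all add: separated_def)
  then show ?thesis using assms(2) Suc by simp
qed (use assms in \<open>simp add: separated_def\<close>)

lemma separated_gap:
  assumes "separated \<delta> s" "0 < \<delta>" "i \<noteq> j"
  shows "\<delta> \<le> \<bar>s i - s j\<bar>"
  using separated_less[OF assms(1,2), of i j] separated_less[OF assms(1,2), of j i] assms(3)
  by (cases "i < j") auto

lemma separated_no_right:
  assumes "separated \<delta> s" "0 < \<delta>"
  shows "\<exists>\<rho>>0. \<forall>i. \<not> (t < s i \<and> s i < t + \<rho>)"
proof (cases "\<exists>i. t < s i \<and> s i < t + \<delta>")
  case True
  then obtain i where i: "t < s i" "s i < t + \<delta>" by blast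
  have "\<not> (t < s j \<and> s j < t + (s i - t))" for j
    using separated_gap[OF assms, of i j] i by (cases "i = j") auto
  with i show ?thesis by (intro exI[of _ "s i - t"]) auto
qed (use assms in blast)

lemma separated_no_left:
  assumes "separated \<delta> s" "0 < \<delta>"
  shows "\<exists>\<rho>>0. \<forall>i. \<not> (t - \<rho> < s i \<and> s i < t)"
proof (cases "\<exists>i. t - \<delta> < s i \<and> s i < t")
  case True
  then obtain i where i: "t - \<delta> < s i" "s i < t" by blast
  have "\<not> (t - (t - s i) < s j \<and> s j < t)" for j
    using separated_gap[OF assms, of i j] i by (cases "i = j") auto
  with i show ?thesis by (intro exI[of _ "t - s i"]) auto
qed (use assms in blast)

text \<open>A time close to a jump time is pushed away from it, staying on its side. The new point
  lies in the same interval between jump times but keeps its position when the jump times are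
  slightly perturbed.\<close>

lemma separated_point:
  assumes s: "separated \<delta> s" "0 < \<delta>" and t: "0 \<le> t"
  obtains u where "0 \<le> u" "\<bar>u - t\<bar> \<le> \<delta> / 4" "\<And>i. \<delta> / 4 \<le> \<bar>s i - u\<bar>" "\<And>i. s i \<le> t \<longleftrightarrow> s i \<le> u"
proof (cases "\<exists>i. \<bar>s i - t\<bar> < \<delta> / 4")
  case False
  then show ?thesis using that[of t] t s(2) by (auto simp: not_less)
next
  case True
  then obtain i where i: "\<bar>s i - t\<bar> < \<delta> / 4" by blast
  have gap: "\<delta> \<le> \<bar>s i - s j\<bar>" if "j \<noteq> i" for j using separated_gap[OF s, of i j] that by simp
  have i0: "\<delta> \<le> s i" by (rule separated_ge[OF s])
  show ?thesis
  proof (cases "s i \<le> t")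
    case True
    show ?thesis
    proof (rule that[of "s i + \<delta> / 4"])
      show "\<delta> / 4 \<le> \<bar>s j - (s i + \<delta> / 4)\<bar>" for j
      proof (cases "j = i")
        case False
        from gap[OF this] s(2) show ?thesis by linarith
      qed (use s(2) in simp)
      show "(s j \<le> t) = (s j \<le> s i + \<delta> / 4)" for j
      proof (cases "j = i")
        case False
        from gap[OF this] i True s(2) show ?thesis by linarith
      qed (use True s(2) in simp)
    qed (use i i0 s(2) True in linarith)+
  next
    case False
    show ?thesis
    proof (rule that[of "s i - \<delta> / 4"])
      show "\<delta> / 4 \<le> \<bar>s j - (s i - \<delta> / 4)\<bar>" for j
      proof (cases "j = i")
        case False
        from gap[OF this] s(2) show ?thesis by linarith
      qed (use s(2) in simp)
      show "(s j \<le> t) = (s j \<le> s i - \<delta> / 4)" for j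
      proof (cases "j = i")
        assume "j \<noteq> i"
        from gap[OF this] i False s(2) show ?thesis by linarith
      qed (use False s(2) in simp)
    qed (use i i0 s(2) False in linarith)+
  qed
qed

text \<open>A tent of height \<open>a\<close> and half-width \<open>h\<close> has slopes smaller
  than 1 in modulus, so adding it to the identity keeps strict monotonicity. The condition h \<le> c
  leaves 0 fixed.\<close>

lemma time_change_bump:
  assumes h: "0 < h" "h \<le> c" and a: "\<bar>a\<bar> < h"
  shows "time_change (\<lambda>t. t + a * max 0 (1 - \<bar>t - c\<bar> / h))"
proof -
  define p where "p t = max 0 (1 - \<bar>t - c\<bar> / h)" for t
  have p: "0 \<le> p t" "p t \<le> 1" for t using h by (auto simp: p_def)
  have lip: "\<bar>p t - p u\<bar> \<le> \<bar>t - u\<bar> / h" for t u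
  proof -
    have "\<bar>p t - p u\<bar> \<le> \<bar>\<bar>t - c\<bar> / h - \<bar>u - c\<bar> / h\<bar>" unfolding p_def by linarith
    also have "\<dots> = \<bar>\<bar>t - c\<bar> - \<bar>u - c\<bar>\<bar> / h" using h by (simp add: diff_divide_distrib[symmetric] abs_divide)
    also have "\<dots> \<le> \<bar>t - u\<bar> / h" using h by (intro divide_right_mono) auto
    finally show ?thesis .
  qed
  have ap: "\<bar>a * p t\<bar> \<le> \<bar>a\<bar>" for t using p[of t] by (simp add: abs_mult mult_left_le)
  have mono: "t + a * p t < u + a * p u" if "t < u" for t u
  proof -
    have "\<bar>a * (p t - p u)\<bar> \<le> \<bar>a\<bar> * (\<bar>t - u\<bar> / h)" unfolding abs_mult by (intro mult_left_mono lip) simp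
    also have "\<dots> < u - t"
    proof -
      have "\<bar>a\<bar> * (u - t) < h * (u - t)" using that a by (intro mult_strict_right_mono) auto
      then show ?thesis using that h by (simp add: field_simps)
    qed
    finally show ?thesis by (simp add: algebra_simps abs_less_iff)
  qed
  have p0: "p 0 = 0" using h by (simp add: p_def)
  have "(\<lambda>t. t + a * p t) ` {0..} = {0..}"
  proof (intro equalityI subsetI)
    fix y assume "y \<in> (\<lambda>t. t + a * p t) ` {0..}"
    then obtain t where t: "t \<ge> 0" "y = t + a * p t" by auto
    then show "y \<in> {0..}" using mono[of 0 t] p0 by (cases "t = 0") auto
  next
    fix y :: real assume y: "y \<in> {0..}"
    have "\<exists>t\<ge>0. t \<le> y + \<bar>a\<bar> \<and> t + a * p t = y"
    proof (rule IVT')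
      show "y \<le> y + \<bar>a\<bar> + a * p (y + \<bar>a\<bar>)" using ap[of "y + \<bar>a\<bar>"] by linarith
      show "continuous_on {0..y + \<bar>a\<bar>} (\<lambda>t. t + a * p t)"
        unfolding p_def using h by (intro continuous_intros) auto
    qed (use y p0 in auto)
    then show "y \<in> (\<lambda>t. t + a * p t) ` {0..}" by auto
  qed
  with mono show ?thesis unfolding p_def by (auto simp: time_change_def strict_mono_on_def)
qed

text \<open>One tent of half-width \<delta> / 2 per jump time; the tents do not overlap, so the
  displacements do not accumulate under composition. The last clause is the induction invariant: the
  earlier tents have ended before the next one begins.\<close>

lemma time_change_through:
  assumes s: "separated \<delta> s" "0 < \<delta>" and e: "0 \<le> e" "e < \<delta> / 2" and s': "\<And>i. i < I \<Longrightarrow> \<bar>s' i - s i\<bar> \<le> e"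
  shows "\<exists>l. time_change l \<and> (\<forall>t\<ge>0. \<bar>l t - t\<bar> \<le> e) \<and> (\<forall>i<I. l (s i) = s' i) \<and>
    (\<forall>t. (\<forall>i<I. s i + \<delta> / 2 \<le> t) \<longrightarrow> l t = t)"
  using s'
proof (induction I)
  case 0
  show ?case using time_change_id e by (intro exI[of _ "\<lambda>t. t"]) auto
next
  case (Suc I)
  then obtain l where l: "time_change l" "\<And>t. t \<ge> 0 \<Longrightarrow> \<bar>l t - t\<bar> \<le> e" "\<And>i. i < I \<Longrightarrow> l (s i) = s' i"
    "\<And>t. (\<forall>i<I. s i + \<delta> / 2 \<le> t) \<Longrightarrow> l t = t" by auto
  define a where "a = s' I - s I"
  have a: "\<bar>a\<bar> \<le> e" using Suc.prems[of I] by (simp add: a_def)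
  have low: "\<delta> \<le> s i" for i by (rule separated_ge[OF s])
  define k where "k t = t + a * max 0 (1 - \<bar>t - s I\<bar> / (\<delta> / 2))" for t
  have k: "time_change k" unfolding k_def by (rule time_change_bump) (use s e a low[of I] in auto)
  have k_fix: "k t = t" if "\<delta> / 2 \<le> \<bar>t - s I\<bar>" for t
  proof -
    have "1 \<le> \<bar>t - s I\<bar> / (\<delta> / 2)" using that s(2) by (simp add: field_simps)
    then show ?thesis by (simp add: k_def)
  qed
  have k_near: "\<bar>k t - t\<bar> \<le> e" for t
  proof -
    have "max 0 (1 - \<bar>t - s I\<bar> / (\<delta> / 2)) \<in> {0..1}" using s(2) by auto
    then have "\<bar>a * max 0 (1 - \<bar>t - s I\<bar> / (\<delta> / 2))\<bar> \<le> \<bar>a\<bar>" unfolding abs_mult by (intro mult_left_le) auto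
    then show ?thesis unfolding k_def using a by linarith
  qed
  have l_fix: "l t = t" if "s I - \<delta> / 2 \<le> t" for t
    using separated_less[OF s, of _ I] that s(2) by (intro l(4)) fastforce
  have l_less: "l t < s I - \<delta> / 2" if t: "0 \<le> t" "t < s I - \<delta> / 2" for t
  proof -
    have "l t < l (s I - \<delta> / 2)"
      using l(1) t low[of I] s(2) by (auto simp: time_change_def strict_mono_on_def)
    then show ?thesis using l_fix[of "s I - \<delta> / 2"] by simp
  qed
  show ?case
  proof (intro exI[of _ "\<lambda>t. k (l t)"] conjI allI impI)
    show "time_change (\<lambda>t. k (l t))" by (rule time_change_comp[OF l(1) k])
    fix t :: real assume t: "0 \<le> t"
    show "\<bar>k (l t) - t\<bar> \<le> e"
    proof (cases "t < s I - \<delta> / 2")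
      case True
      with l_less[OF t] have "k (l t) = l t" by (intro k_fix) linarith
      with l(2)[OF t] show ?thesis by simp
    next
      case False
      with l_fix[of t] k_near[of t] show ?thesis by simp
    qed
  next
    fix i assume i: "i < Suc I"
    show "k (l (s i)) = s' i"
    proof (cases "i = I")
      case True
      with l_fix[of "s I"] s(2) show ?thesis by (simp add: k_def a_def)
    next
      case False
      then have "i < I" using i by simp
      then have "s i < s I - \<delta> / 2" using separated_less[OF s, of i I] s(2) by auto
      then have "k (l (s i)) = l (s i)" using l_less[of "s i"] low[of i] s(2) by (intro k_fix) linarith
      with l(3)[OF \<open>i < I\<close>] show ?thesis by simp
    qed
  next
    fix t assume t: "\<forall>i<Suc I. s i + \<delta> / 2 \<le> t"
    then have "l t = t" by (intro l(4)) auto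
    moreover have "s I + \<delta> / 2 \<le> t" using t by auto
    then have "k t = t" by (intro k_fix) linarith
    ultimately show "k (l t) = t" by simp
  qed
qed

subsection \<open>Limits along subsequences and filters in compact sets\<close>

context Metric_space
begin

text \<open>A sequence chosen through the sets witnessing the Cauchy condition has a convergent
  subsequence in \<open>P\<close>, and the Cauchy condition forces the whole filter to follow. The
  filter is kept general to cover both left limits and limits along a dense set of times.\<close>

lemma cauchy_filter_limit:
  assumes P: "compactin mtopology P" and F: "F \<noteq> bot" and ev: "eventually (\<lambda>x. f x \<in> P) F"
    and cauchy: "\<And>e. e > 0 \<Longrightarrow> \<exists>A. eventually A F \<and> (\<forall>x y. A x \<longrightarrow> A y \<longrightarrow> d (f x) (f y) \<le> e)"
  shows "\<exists>l\<in>P. limitin mtopology f l F"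
proof -
  have PM: "P \<subseteq> M" using compactin_subset_topspace[OF P] by simp
  have "\<forall>n. \<exists>A. eventually A F \<and> (\<forall>x y. A x \<longrightarrow> A y \<longrightarrow> d (f x) (f y) \<le> 1 / real (Suc n))"
    by (intro allI cauchy) simp
  from choice[OF this] obtain A where
    "\<forall>n. eventually (A n) F \<and> (\<forall>x y. A n x \<longrightarrow> A n y \<longrightarrow> d (f x) (f y) \<le> 1 / real (Suc n))" ..
  then have A: "\<And>n. eventually (A n) F"
    "\<And>n x y. A n x \<Longrightarrow> A n y \<Longrightarrow> d (f x) (f y) \<le> 1 / real (Suc n)" by simp_all
  have "\<exists>x. f x \<in> P \<and> (\<forall>i\<in>{..n}. A i x)" for n
  proof -
    have "eventually (\<lambda>x. \<forall>i\<in>{..n}. A i x) F" using A(1) by (intro eventually_ball_finite) auto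
    from eventually_happens'[OF F eventually_conj[OF ev this]] show ?thesis .
  qed
  then have "\<forall>n. \<exists>x. f x \<in> P \<and> (\<forall>i\<in>{..n}. A i x)" ..
  from choice[OF this] obtain x where "\<forall>n. f (x n) \<in> P \<and> (\<forall>i\<in>{..n}. A i (x n))" ..
  then have x: "\<And>n. f (x n) \<in> P" "\<And>n i. i \<le> n \<Longrightarrow> A i (x n)" by simp_all
  have "range (f \<circ> x) \<subseteq> P" using x(1) by auto
  then obtain l r where l: "l \<in> P" "strict_mono r" "limitin mtopology ((f \<circ> x) \<circ> r) l sequentially"
    using P unfolding compactin_sequentially by blast
  have "limitin mtopology f l F"
    unfolding limitin_metric
  proof (intro conjI allI impI)
    show "l \<in> M" using l PM by auto
    fix e :: real assume e: "e > 0"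
    obtain n where n: "1 / real (Suc n) < e / 2" using nat_approx_posE[of "e/2"] e by (metis half_gt_zero)
    have "eventually (\<lambda>k. d (f (x (r k))) l < e / 2) sequentially"
    proof -
      have "\<forall>e>0. eventually (\<lambda>k. ((f \<circ> x) \<circ> r) k \<in> M \<and> d (((f \<circ> x) \<circ> r) k) l < e) sequentially"
        using l(3) unfolding limitin_metric by (rule conjunct2)
      from this[rule_format, OF half_gt_zero[OF e]] show ?thesis by (rule eventually_mono) simp
    qed
    then obtain k0 where k0: "\<And>k. k \<ge> k0 \<Longrightarrow> d (f (x (r k))) l < e / 2"
      unfolding eventually_sequentially by blast
    define k where "k = max n k0"
    have k: "n \<le> r k" "d (f (x (r k))) l < e / 2"
      using k0[of k] seq_suble[OF l(2), of k] by (auto simp: k_def)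
    show "eventually (\<lambda>y. f y \<in> M \<and> d (f y) l < e) F"
      using A(1)[of n] ev
    proof eventually_elim
      case (elim y)
      have "d (f y) (f (x (r k))) \<le> 1 / real (Suc n)" by (rule A(2)[OF elim(1) x(2)[OF k(1)]])
      moreover have "d (f y) l \<le> d (f y) (f (x (r k))) + d (f (x (r k))) l"
        by (rule triangle) (use elim(2) x(1)[of "r k"] l(1) PM in blast)+
      moreover have "f y \<in> M" using elim(2) PM by blast
      ultimately show ?case using n k(2) by linarith
    qed
  qed
  with l(1) show ?thesis by blast
qed

lemma diagonal_limits:
  fixes f :: "nat \<Rightarrow> nat \<Rightarrow> 'a"
  assumes C: "\<And>n. compactin mtopology (C n)" and f: "\<And>j n. f j n \<in> C n"
  shows "\<exists>r l. strict_mono r \<and> (\<forall>n. l n \<in> C n \<and> limitin mtopology (\<lambda>j. f (r j) n) (l n) sequentially)"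
proof -
  let ?Q = "\<lambda>n s. \<exists>l\<in>C n. limitin mtopology (\<lambda>j. f (s j) n) l sequentially"
  interpret subseqs ?Q
  proof
    fix n and s :: "nat \<Rightarrow> nat"
    have "range (\<lambda>j. f (s j) n) \<subseteq> C n" using f by auto
    then obtain l r where "l \<in> C n" "strict_mono r" "limitin mtopology ((\<lambda>j. f (s j) n) \<circ> r) l sequentially"
      using C[of n] unfolding compactin_sequentially by blast
    then show "\<exists>r'. strict_mono r' \<and> ?Q n (s \<circ> r')" by (auto simp: o_def)
  qed
  have "?Q n diagseq" for n
  proof -
    \<comment> \<open>The diagonal sequence is a subsequence of the stage that settles coordinate
      \<open>n\<close> only after a shift by \<open>Suc n\<close>; the shift is removed
      afterwards.\<close>
    have "?Q n (diagseq \<circ> (+) (Suc n))"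
    proof (rule diagseq_holds)
      fix r s :: "nat \<Rightarrow> nat" and n assume "strict_mono r" "?Q n s"
      then obtain l where "l \<in> C n" "limitin mtopology (\<lambda>j. f (s j) n) l sequentially" by blast
      then show "?Q n (s \<circ> r)"
        using limitin_subsequence[OF \<open>strict_mono r\<close>, of mtopology "\<lambda>j. f (s j) n" l]
        by (intro bexI[of _ l]) (simp_all add: o_def)
    qed
    moreover have "diagseq \<circ> (+) (Suc n) = (\<lambda>j. diagseq (j + Suc n))"
      by (simp add: fun_eq_iff add.commute)
    ultimately obtain l where l: "l \<in> C n" "limitin mtopology (\<lambda>j. f (diagseq (j + Suc n)) n) l sequentially"
      by auto
    from limitin_sequentially_offset_rev[OF l(2)] l(1) show ?thesis by blast
  qed
  then have "\<forall>n. \<exists>l. l \<in> C n \<and> limitin mtopology (\<lambda>j. f (diagseq j) n) l sequentially" by blast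
  from choice[OF this] show ?thesis using subseq_diagseq by blast
qed

end

subsection \<open>Paths controlled away from a separated sequence of jump times\<close>

text \<open>The sequence of jump times may contain times at which the path does not jump, so it can be
  taken to be infinite and the number of jumps need not be recorded.\<close>

definition jump_modulus ::
    "'a metric \<Rightarrow> real \<Rightarrow> (real \<Rightarrow> 'a) \<Rightarrow> (nat \<Rightarrow> real) \<Rightarrow> real \<Rightarrow> real \<Rightarrow> bool" where
  "jump_modulus m T f s \<delta> \<eta> \<longleftrightarrow> separated \<delta> s \<and>
     (\<forall>x\<ge>0. \<forall>y\<ge>0. \<bar>x - y\<bar> < \<delta> \<longrightarrow> (\<forall>i. s i \<le> x \<longleftrightarrow> s i \<le> y) \<longrightarrow>
        mdist m (f (min x T)) (f (min y T)) \<le> \<eta>)"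

text \<open>Every level \<open>k\<close> may use its own jump times. The bounds \<open>B k i\<close>
  confine the i-th of them to a compact interval, so that jump times of a sequence of paths converge
  along subsequences.\<close>

definition modulus_class ::
    "'a metric \<Rightarrow> real \<Rightarrow> 'a set \<Rightarrow> (nat \<Rightarrow> real) \<Rightarrow> (nat \<Rightarrow> real) \<Rightarrow> (nat \<Rightarrow> nat \<Rightarrow> real) \<Rightarrow>
     (real \<Rightarrow> 'a) set" where
  "modulus_class m T P \<delta> \<eta> B =
     {f \<in> {0..T} \<rightarrow>\<^sub>E P. \<forall>k. \<exists>s. (\<forall>i. s i \<le> B k i) \<and> jump_modulus m T f s (\<delta> k) (\<eta> k)}"

lemma skorohod_dist_le:
  assumes "f \<in> skorohod_carrier m T" "g \<in> skorohod_carrier m T" "skorohod_close m T f g e"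
  shows "skorohod_dist m T f g \<le> e"
proof -
  have "0 \<le> e'" if "skorohod_close m T f g e'" for e'
    using that unfolding skorohod_close_def by (meson abs_ge_zero order.trans order_refl)
  then have "bdd_below {e. skorohod_close m T f g e}" by (intro bdd_belowI[of _ 0]) auto
  then show ?thesis using assms cInf_lower[of e "{e. skorohod_close m T f g e}"] by (simp add: skorohod_dist_def)
qed

lemma jump_modulusD:
  assumes "jump_modulus m T f s \<delta> \<eta>" "0 \<le> x" "0 \<le> y" "\<bar>x - y\<bar> < \<delta>" "\<And>i. s i \<le> x \<longleftrightarrow> s i \<le> y"
  shows "mdist m (f (min x T)) (f (min y T)) \<le> \<eta>"
  using assms unfolding jump_modulus_def by blast

lemma jump_modulus_separated: "jump_modulus m T f s \<delta> \<eta> \<Longrightarrow> separated \<delta> s"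
  by (simp add: jump_modulus_def)

text \<open>Just to the right of \<open>t\<close>, and just to the left of it, there are no jump
  times, since these are separated. On the right the modulus compares with the value at
  \<open>t\<close> itself, because a jump at \<open>t\<close> counts as having occurred; on the left
  it gives a Cauchy condition, and compactness of \<open>P\<close> supplies the limit.\<close>

lemma modulus_class_subset:
  assumes T: "0 < T" and P: "compactin (mtopology_of m) P" and \<delta>: "\<And>k. 0 < \<delta> k" and \<eta>: "\<eta> \<longlonglongrightarrow> 0"
  shows "modulus_class m T P \<delta> \<eta> B \<subseteq> skorohod_carrier m T"
proof
  interpret Metric_space "mspace m" "mdist m" by (rule Metric_space_mspace_mdist)
  have P': "compactin mtopology P" using P by (simp add: mtopology_of_def)
  have PM: "P \<subseteq> mspace m" using compactin_subset_topspace[OF P'] by simp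
  fix f assume f: "f \<in> modulus_class m T P \<delta> \<eta> B"
  have fP: "f t \<in> P" if "t \<in> {0..T}" for t using f that by (auto simp: modulus_class_def)
  have mod: "\<exists>k s. jump_modulus m T f s (\<delta> k) (\<eta> k) \<and> \<eta> k < e" if "e > 0" for e
  proof -
    have "eventually (\<lambda>k. \<eta> k < e) sequentially" using order_tendstoD(2)[OF \<eta> that] .
    then obtain k where "\<eta> k < e" by (auto simp: eventually_sequentially)
    moreover obtain s where "jump_modulus m T f s (\<delta> k) (\<eta> k)" using f unfolding modulus_class_def by blast
    ultimately show ?thesis by blast
  qed
  have right: "limitin mtopology f (f t) (at_right t)" if t: "t \<in> {0..<T}" for t
    unfolding limitin_metric
  proof (intro conjI allI impI)
    show "f t \<in> mspace m" using fP[of t] t PM by auto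
    fix e :: real assume "e > 0"
    from mod[OF this] obtain k s where ks: "jump_modulus m T f s (\<delta> k) (\<eta> k)" "\<eta> k < e" by blast
    obtain \<rho> where \<rho>: "\<rho> > 0" "\<And>i. \<not> (t < s i \<and> s i < t + \<rho>)"
      using separated_no_right[OF jump_modulus_separated[OF ks(1)] \<delta>] by blast
    show "eventually (\<lambda>x. f x \<in> mspace m \<and> mdist m (f x) (f t) < e) (at_right t)"
      unfolding eventually_at_right_field
    proof (intro exI[of _ "min (t + min \<rho> (\<delta> k)) T"] conjI allI impI)
      show "t < min (t + min \<rho> (\<delta> k)) T" using t \<rho> \<delta>[of k] by auto
      fix y assume y: "t < y" "y < min (t + min \<rho> (\<delta> k)) T"
      show "f y \<in> mspace m" using fP[of y] y t PM by auto
      have "mdist m (f (min y T)) (f (min t T)) \<le> \<eta> k"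
      proof (rule jump_modulusD[OF ks(1)])
        show "s i \<le> y \<longleftrightarrow> s i \<le> t" for i using \<rho>(2)[of i] y by linarith
      qed (use y t in auto)
      moreover have "min y T = y" "min t T = t" using y t by auto
      ultimately show "mdist m (f y) (f t) < e" using ks(2) by simp
    qed
  qed
  have left: "\<exists>l. limitin mtopology f l (at_left t)" if t: "t \<in> {0<..T}" for t
  proof -
    have "\<exists>l\<in>P. limitin mtopology f l (at_left t)"
    proof (rule cauchy_filter_limit[OF P'])
      show "at_left t \<noteq> bot" by simp
      show "eventually (\<lambda>x. f x \<in> P) (at_left t)"
        unfolding eventually_at_left_field using t fP by (intro exI[of _ 0]) auto
      fix e :: real assume "e > 0"
      from mod[OF this] obtain k s where ks: "jump_modulus m T f s (\<delta> k) (\<eta> k)" "\<eta> k < e" by blast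
      obtain \<rho> where \<rho>: "\<rho> > 0" "\<And>i. \<not> (t - \<rho> < s i \<and> s i < t)"
        using separated_no_left[OF jump_modulus_separated[OF ks(1)] \<delta>] by blast
      define a where "a = max 0 (t - min \<rho> (\<delta> k))"
      show "\<exists>A. eventually A (at_left t) \<and> (\<forall>x y. A x \<longrightarrow> A y \<longrightarrow> mdist m (f x) (f y) \<le> e)"
      proof (intro exI[of _ "\<lambda>x. a < x \<and> x < t"] conjI allI impI)
        show "\<forall>\<^sub>F x in at_left t. a < x \<and> x < t"
          unfolding eventually_at_left_field using t \<rho> \<delta>[of k] by (intro exI[of _ a]) (auto simp: a_def)
        fix x y assume xy: "a < x \<and> x < t" "a < y \<and> y < t"
        have "mdist m (f (min x T)) (f (min y T)) \<le> \<eta> k"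
        proof (rule jump_modulusD[OF ks(1)])
          show "s i \<le> x \<longleftrightarrow> s i \<le> y" for i using \<rho>(2)[of i] xy unfolding a_def by linarith
          show "\<bar>x - y\<bar> < \<delta> k" using xy unfolding a_def by linarith
        qed (use xy in \<open>auto simp: a_def\<close>)
        then show "mdist m (f x) (f y) \<le> e" using xy t ks(2) by (simp add: min_def)
      qed
    qed
    then show ?thesis by blast
  qed
  show "f \<in> skorohod_carrier m T"
    using f right left PM by (auto simp: skorohod_carrier_def cadlag_on_def modulus_class_def mtopology_of_def)
qed

text \<open>The situation after a diagonal extraction: the paths \<open>G j\<close> converge to
  \<open>h n\<close> at each time \<open>q n\<close> of a dense sequence, and at every level
  \<open>k\<close> their jump times converge to \<open>sl k\<close>. From these data the limit path
  is rebuilt.\<close>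

locale converging_paths =
  fixes m :: "'a metric" and T :: real and P :: "'a set" and \<delta> \<eta> :: "nat \<Rightarrow> real"
    and G :: "nat \<Rightarrow> real \<Rightarrow> 'a" and S :: "nat \<Rightarrow> nat \<Rightarrow> nat \<Rightarrow> real" and sl :: "nat \<Rightarrow> nat \<Rightarrow> real"
    and q :: "nat \<Rightarrow> real" and h :: "nat \<Rightarrow> 'a"
  assumes T: "0 < T" and P: "compactin (mtopology_of m) P"
    and \<delta>: "\<And>k. 0 < \<delta> k" and \<eta>: "\<eta> \<longlonglongrightarrow> 0"
    and GP: "\<And>j t. t \<in> {0..T} \<Longrightarrow> G j t \<in> P"
    and S: "\<And>j k. jump_modulus m T (G j) (S j k) (\<delta> k) (\<eta> k)"
    and S_lim: "\<And>k i. (\<lambda>j. S j k i) \<longlonglongrightarrow> sl k i"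
    and q0: "\<And>n. 0 \<le> q n" and dense: "\<And>a b. 0 \<le> a \<Longrightarrow> a < b \<Longrightarrow> \<exists>n. a < q n \<and> q n < b"
    and hP: "\<And>n. h n \<in> P"
    and h_lim: "\<And>n. limitin (mtopology_of m) (\<lambda>j. G j (min (q n) T)) (h n) sequentially"
begin

sublocale Metric_space "mspace m" "mdist m" by (rule Metric_space_mspace_mdist)

lemma P': "compactin mtopology P" using P by (simp add: mtopology_of_def)

lemma PM: "x \<in> P \<Longrightarrow> x \<in> mspace m"
  using compactin_subset_topspace[OF P'] by auto

lemma GM: "0 \<le> t \<Longrightarrow> G j (min t T) \<in> mspace m"
  using T by (intro PM GP) auto

lemma \<eta>_small: "0 < e \<Longrightarrow> \<exists>k. \<eta> k < e"
  using order_tendstoD(2)[OF \<eta>, of e] by (auto simp: eventually_sequentially)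

lemma separated_S: "separated (\<delta> k) (S j k)"
  by (rule jump_modulus_separated[OF S])

lemma separated_sl: "separated (\<delta> k) (sl k)"
  unfolding separated_def
proof (intro conjI allI)
  show "\<delta> k \<le> sl k 0"
    using separated_S[of k] by (intro LIMSEQ_le_const[OF S_lim]) (auto simp: separated_def)
  fix i
  show "sl k i + \<delta> k \<le> sl k (Suc i)"
    using separated_S[of k] by (intro LIMSEQ_le[OF tendsto_add[OF S_lim tendsto_const] S_lim]) (auto simp: separated_def)
qed

lemma h_dist: "0 < e \<Longrightarrow> eventually (\<lambda>j. mdist m (G j (min (q n) T)) (h n) < e) sequentially"
  using h_lim[of n] unfolding mtopology_of_def limitin_metric by (auto elim: eventually_mono)

text \<open>Jump times with large index lie beyond \<open>y\<close> for all \<open>j\<close> by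
  separation, and each of the finitely many others eventually leaves the closed interval together
  with its limit.\<close>

lemma same_side_eventually:
  assumes xy: "x \<le> y" and no: "\<And>i. \<not> (x \<le> sl k i \<and> sl k i \<le> y)"
  shows "eventually (\<lambda>j. \<forall>i. S j k i \<le> x \<longleftrightarrow> S j k i \<le> y) sequentially"
proof -
  obtain I :: nat where I: "y / \<delta> k < real I" using reals_Archimedean2 by blast
  have "eventually (\<lambda>j. S j k i \<in> - {x..y}) sequentially" for i
    using no[of i] by (intro topological_tendstoD[OF S_lim]) auto
  then have "eventually (\<lambda>j. \<forall>i\<in>{..<I}. S j k i \<in> - {x..y}) sequentially"
    by (intro eventually_ball_finite) auto
  then show ?thesis
  proof eventually_elim
    case (elim j)
    show ?case
    proof
      fix i
      show "S j k i \<le> x \<longleftrightarrow> S j k i \<le> y"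
      proof (cases "i < I")
        case True
        then have "S j k i \<in> - {x..y}" using elim by blast
        with xy show ?thesis by auto
      next
        case False
        have "y < real I * \<delta> k" using I \<delta>[of k] by (simp add: field_simps)
        also have "\<dots> \<le> (real i + 1) * \<delta> k" using False \<delta>[of k] by (intro mult_right_mono) auto
        also have "\<dots> \<le> S j k i" by (rule separated_lower[OF separated_S])
        finally show ?thesis using xy by auto
      qed
    qed
  qed
qed

text \<open>The modulus in the limit, on the dense set. The closed interval must be free of limiting
  jump times, because the approximating ones may reach an end point from either side.\<close>

lemma h_modulus:
  assumes "q n \<le> q n'" "q n' < q n + \<delta> k" "\<And>i. \<not> (q n \<le> sl k i \<and> sl k i \<le> q n')"
  shows "mdist m (h n) (h n') \<le> \<eta> k"
proof (rule field_le_epsilon)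
  fix e :: real assume e: "e > 0"
  have "eventually (\<lambda>j. mdist m (h n) (h n') \<le> \<eta> k + e) sequentially"
    using same_side_eventually[OF assms(1,3)] h_dist[of "e/2" n, OF half_gt_zero[OF e]]
      h_dist[of "e/2" n', OF half_gt_zero[OF e]]
  proof eventually_elim
    case (elim j)
    have "mdist m (G j (min (q n) T)) (G j (min (q n') T)) \<le> \<eta> k"
      using assms(1,2) elim(1) q0 by (intro jump_modulusD[OF S]) auto
    moreover have "mdist m (h n) (h n') \<le> mdist m (h n) (G j (min (q n) T)) + mdist m (G j (min (q n) T)) (h n')"
      by (intro triangle PM hP GM q0)
    moreover have "mdist m (G j (min (q n) T)) (h n') \<le>
        mdist m (G j (min (q n) T)) (G j (min (q n') T)) + mdist m (G j (min (q n') T)) (h n')"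
      by (intro triangle PM hP GM q0)
    ultimately show ?case using elim(2,3) by (simp add: commute)
  qed
  then show "mdist m (h n) (h n') \<le> \<eta> k + e" by simp
qed

text \<open>Immediately to the right of \<open>t\<close> there is no limiting jump time, so
  \<open>h_modulus\<close> gives the Cauchy condition along the times \<open>q n\<close> decreasing
  to \<open>t\<close>.\<close>

lemma limit_ex:
  assumes t: "0 \<le> t"
  shows "\<exists>l\<in>P. limitin mtopology h l (filtercomap q (at_right t))"
proof (rule cauchy_filter_limit[OF P'])
  show "filtercomap q (at_right t) \<noteq> bot"
  proof (rule filtercomap_neq_bot)
    fix Q assume "eventually Q (at_right t)"
    then obtain b where b: "t < b" "\<And>y. t < y \<Longrightarrow> y < b \<Longrightarrow> Q y" unfolding eventually_at_right_field by blast
    with dense[OF t b(1)] show "\<exists>x. Q (q x)" by blast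
  qed
  show "\<forall>\<^sub>F x in filtercomap q (at_right t). h x \<in> P" using hP by simp
  fix e :: real assume "e > 0"
  from \<eta>_small[OF this] obtain k where k: "\<eta> k < e" by blast
  obtain \<rho> where \<rho>: "\<rho> > 0" "\<And>i. \<not> (t < sl k i \<and> sl k i < t + \<rho>)"
    using separated_no_right[OF separated_sl \<delta>] by blast
  define A where "A n \<longleftrightarrow> t < q n \<and> q n < t + min \<rho> (\<delta> k)" for n
  have A: "mdist m (h x) (h y) \<le> e" if "A x" "A y" "q x \<le> q y" for x y
  proof -
    have "mdist m (h x) (h y) \<le> \<eta> k"
    proof (rule h_modulus)
      show "\<not> (q x \<le> sl k i \<and> sl k i \<le> q y)" for i using that \<rho>(2)[of i] unfolding A_def by linarith
    qed (use that in \<open>auto simp: A_def\<close>)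
    with k show ?thesis by simp
  qed
  show "\<exists>A. eventually A (filtercomap q (at_right t)) \<and> (\<forall>x y. A x \<longrightarrow> A y \<longrightarrow> mdist m (h x) (h y) \<le> e)"
  proof (intro exI[of _ A] conjI allI impI)
    have "eventually (\<lambda>y. t < y \<and> y < t + min \<rho> (\<delta> k)) (at_right t)"
      unfolding eventually_at_right_field using \<rho>(1) \<delta>[of k] by (intro exI[of _ "t + min \<rho> (\<delta> k)"]) auto
    then show "eventually A (filtercomap q (at_right t))"
      unfolding A_def[abs_def] by (rule eventually_filtercomapI)
    fix x y assume "A x" "A y"
    then show "mdist m (h x) (h y) \<le> e" using A[of x y] A[of y x] commute[of "h x" "h y"] by (cases "q x \<le> q y") auto
  qed
qed

text \<open>Right limits are used instead of \<open>h\<close> itself: if \<open>q n\<close> is a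
  limiting jump time, \<open>h n\<close> may still be a value from before the jump.\<close>

definition lim :: "real \<Rightarrow> 'a" where
  "lim t = (SOME l. l \<in> P \<and> limitin mtopology h l (filtercomap q (at_right t)))"

lemma
  assumes "0 \<le> t"
  shows lim_P: "lim t \<in> P" and lim_limitin: "limitin mtopology h (lim t) (filtercomap q (at_right t))"
proof -
  have "lim t \<in> P \<and> limitin mtopology h (lim t) (filtercomap q (at_right t))"
    unfolding lim_def by (rule someI_ex) (use limit_ex[OF assms] in blast)
  then show "lim t \<in> P" "limitin mtopology h (lim t) (filtercomap q (at_right t))" by auto
qed

lemma lim_near:
  assumes t: "0 \<le> t" and e: "0 < e"
  obtains \<rho> where "0 < \<rho>" "\<And>n. t < q n \<Longrightarrow> q n < t + \<rho> \<Longrightarrow> mdist m (h n) (lim t) < e"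
proof -
  have "eventually (\<lambda>n. h n \<in> mspace m \<and> mdist m (h n) (lim t) < e) (filtercomap q (at_right t))"
    using lim_limitin[OF t] e unfolding limitin_metric by blast
  then obtain Q where Q: "eventually Q (at_right t)" "\<And>n. Q (q n) \<Longrightarrow> mdist m (h n) (lim t) < e"
    unfolding eventually_filtercomap by blast
  then obtain b where b: "t < b" "\<And>y. t < y \<Longrightarrow> y < b \<Longrightarrow> Q y" unfolding eventually_at_right_field by blast
  show ?thesis by (rule that[of "b - t"]) (use b Q(2) in auto)
qed

lemma h_const:
  assumes "T \<le> q n" "T \<le> q n'"
  shows "h n = h n'"
proof -
  have "limitin mtopology (\<lambda>j. G j T) (h n) sequentially" "limitin mtopology (\<lambda>j. G j T) (h n') sequentially"
    using h_lim[of n] h_lim[of n'] assms by (simp_all add: mtopology_of_def min_absorb2)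
  then show ?thesis by (rule limitin_Hausdorff_unique) (auto intro: Hausdorff_space_mtopology)
qed

lemma lim_const:
  assumes t: "T \<le> t"
  shows "lim t = lim T"
proof -
  have T0: "0 \<le> T" "0 \<le> t" using T t by auto
  have "mdist m (lim t) (lim T) \<le> 0 + e" if e: "e > 0" for e
  proof -
    obtain a where a: "0 < a" "\<And>n. t < q n \<Longrightarrow> q n < t + a \<Longrightarrow> mdist m (h n) (lim t) < e / 2"
      using lim_near[OF T0(2) half_gt_zero[OF e]] by blast
    obtain b where b: "0 < b" "\<And>n. T < q n \<Longrightarrow> q n < T + b \<Longrightarrow> mdist m (h n) (lim T) < e / 2"
      using lim_near[OF T0(1) half_gt_zero[OF e]] by blast
    obtain n where n: "t < q n" "q n < t + a" using dense[OF T0(2), of "t + a"] a by auto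
    obtain n' where n': "T < q n'" "q n' < T + b" using dense[OF T0(1), of "T + b"] b by auto
    have eq: "h n = h n'" using n n' t by (intro h_const) auto
    have "mdist m (lim t) (lim T) \<le> mdist m (lim t) (h n) + mdist m (h n) (lim T)"
      by (intro triangle PM lim_P hP T0)
    with a(2)[OF n] b(2)[OF n'] eq show ?thesis by (simp add: commute)
  qed
  then have "mdist m (lim t) (lim T) \<le> 0" by (rule field_le_epsilon)
  then show ?thesis using zero[of "lim t" "lim T"] nonneg[of "lim t" "lim T"] PM[OF lim_P[OF T0(1)]] PM[OF lim_P[OF T0(2)]] by auto
qed

text \<open>Both points are approached strictly from the right. A limiting jump time at or before
  \<open>x\<close> then lies before the approximating interval, and one after \<open>y\<close> lies
  behind it, so \<open>h_modulus\<close> applies even when \<open>x\<close> or \<open>y\<close> is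
  itself a jump time.\<close>

lemma lim_modulus_le:
  assumes x: "0 \<le> x" "x \<le> y" "y < x + \<delta> k" and side: "\<And>i. sl k i \<le> x \<longleftrightarrow> sl k i \<le> y"
  shows "mdist m (lim x) (lim y) \<le> \<eta> k"
proof (rule field_le_epsilon)
  fix e :: real assume e: "e > 0"
  have y: "0 \<le> y" using x by simp
  obtain a where a: "0 < a" "\<And>n. x < q n \<Longrightarrow> q n < x + a \<Longrightarrow> mdist m (h n) (lim x) < e / 2"
    using lim_near[OF x(1) half_gt_zero[OF e]] by blast
  obtain b where b: "0 < b" "\<And>n. y < q n \<Longrightarrow> q n < y + b \<Longrightarrow> mdist m (h n) (lim y) < e / 2"
    using lim_near[OF y half_gt_zero[OF e]] by blast
  obtain \<rho> where \<rho>: "\<rho> > 0" "\<And>i. \<not> (y < sl k i \<and> sl k i < y + \<rho>)"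
    using separated_no_right[OF separated_sl \<delta>] by blast
  obtain n' where n': "y < q n'" "q n' < y + b" "q n' < y + \<rho>" "q n' < x + \<delta> k"
    using dense[OF y, of "min (min (y + b) (y + \<rho>)) (x + \<delta> k)"] b \<rho> x by auto
  obtain n where n: "x < q n" "q n < x + a" "q n < q n'"
    using dense[OF x(1), of "min (x + a) (q n')"] a n' x by auto
  have "mdist m (h n) (h n') \<le> \<eta> k"
  proof (rule h_modulus)
    show "\<not> (q n \<le> sl k i \<and> sl k i \<le> q n')" for i
      using side[of i] \<rho>(2)[of i] n n' x by linarith
  qed (use n n' x in auto)
  moreover have "mdist m (lim x) (lim y) \<le> mdist m (lim x) (h n) + mdist m (h n) (lim y)"
    by (intro triangle PM lim_P hP x y)
  moreover have "mdist m (h n) (lim y) \<le> mdist m (h n) (h n') + mdist m (h n') (lim y)"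
    by (intro triangle PM lim_P hP x y)
  ultimately show "mdist m (lim x) (lim y) \<le> \<eta> k + e"
    using a(2)[OF n(1,2)] b(2)[OF n'(1,2)] by (simp add: commute)
qed

lemma lim_modulus:
  assumes "0 \<le> x" "0 \<le> y" "\<bar>x - y\<bar> < \<delta> k" "\<And>i. sl k i \<le> x \<longleftrightarrow> sl k i \<le> y"
  shows "mdist m (lim x) (lim y) \<le> \<eta> k"
proof (cases "x \<le> y")
  case True
  with assms show ?thesis by (intro lim_modulus_le) auto
next
  case False
  with assms have "mdist m (lim y) (lim x) \<le> \<eta> k" by (intro lim_modulus_le) auto
  then show ?thesis by (simp only: commute)
qed

text \<open>Away from limiting jump times \<open>h\<close> nearly agrees with its right limit, which
  links values of \<open>G j\<close> at dense times to the limit path.\<close>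

lemma h_lim_dist:
  assumes no: "\<And>i. sl k i \<noteq> q n"
  shows "mdist m (h n) (lim (q n)) \<le> \<eta> k"
proof (rule field_le_epsilon)
  fix e :: real assume e: "e > 0"
  obtain a where a: "0 < a" "\<And>i. q n < q i \<Longrightarrow> q i < q n + a \<Longrightarrow> mdist m (h i) (lim (q n)) < e"
    using lim_near[OF q0[of n] e] by blast
  obtain \<rho> where \<rho>: "\<rho> > 0" "\<And>i. \<not> (q n < sl k i \<and> sl k i < q n + \<rho>)"
    using separated_no_right[OF separated_sl \<delta>] by blast
  obtain n' where n': "q n < q n'" "q n' < q n + a" "q n' < q n + \<rho>" "q n' < q n + \<delta> k"
    using dense[OF q0, of n "min (min (q n + a) (q n + \<rho>)) (q n + \<delta> k)"] a \<rho> \<delta>[of k] by auto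
  have "mdist m (h n) (h n') \<le> \<eta> k"
  proof (rule h_modulus)
    show "\<not> (q n \<le> sl k i \<and> sl k i \<le> q n')" for i using no[of i] \<rho>(2)[of i] n' by linarith
  qed (use n' in auto)
  moreover have "mdist m (h n) (lim (q n)) \<le> mdist m (h n) (h n') + mdist m (h n') (lim (q n))"
    by (intro triangle PM lim_P hP q0)
  ultimately show "mdist m (h n) (lim (q n)) \<le> \<eta> k + e" using a(2)[OF n'(1,2)] by simp
qed

definition lim_path :: "real \<Rightarrow> 'a" where
  "lim_path = (\<lambda>t\<in>{0..T}. lim t)"

lemma lim_path_min: "0 \<le> t \<Longrightarrow> lim_path (min t T) = lim t"
  using T lim_const[of t] by (auto simp: lim_path_def min_def)

lemma lim_path_modulus: "jump_modulus m T lim_path (sl k) (\<delta> k) (\<eta> k)"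
  unfolding jump_modulus_def
proof (intro conjI allI impI separated_sl)
  fix x y :: real assume "0 \<le> x" "0 \<le> y" "\<bar>x - y\<bar> < \<delta> k" "\<forall>i. (sl k i \<le> x) = (sl k i \<le> y)"
  then show "mdist m (lim_path (min x T)) (lim_path (min y T)) \<le> \<eta> k"
    by (simp only: lim_path_min) (rule lim_modulus, auto)
qed

lemma lim_path_PiE: "lim_path \<in> {0..T} \<rightarrow>\<^sub>E P"
  using lim_P by (auto simp: lim_path_def)

text \<open>A time change carries the jump times of \<open>G j\<close> exactly onto the limiting
  ones, so \<open>t\<close> and \<open>l t\<close> lie in corresponding intervals. Both are compared
  with a time of a finite net in the same interval, where \<open>G j\<close> is already close to
  \<open>h\<close>.\<close>

lemma eventually_close:
  assumes e: "0 < e"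
  shows "eventually (\<lambda>j. skorohod_close m T (G j) lim_path e) sequentially"
proof -
  \<comment> \<open>The final estimate has four terms: three moduli \<eta> k and one pointwise
    error, each below e / 8.\<close>
  obtain k where k: "\<eta> k < e / 8" using \<eta>_small[of "e / 8"] e by auto
  define D where "D = \<delta> k"
  have D: "0 < D" using \<delta> by (simp add: D_def)
  \<comment> \<open>Jump times with index at least \<open>I\<close> lie beyond T + 3D, for the paths
    and for the limit alike, so only finitely many have to be matched.\<close>
  obtain I :: nat where I: "(T + 3 * D) / D < real I" using reals_Archimedean2 by blast
  have beyond: "T + 3 * D < s i" if "separated D s" "\<not> i < I" for s i
  proof -
    have "T + 3 * D < real I * D" using I D by (simp add: field_simps)
    also have "\<dots> \<le> (real i + 1) * D" using that D by (intro mult_right_mono) auto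
    also have "\<dots> \<le> s i" by (rule separated_lower[OF that(1)])
    finally show ?thesis .
  qed
  \<comment> \<open>D / 16 is smaller than the distance D / 8 that the net times below keep from the
    jump times, so shifting a jump time by \<epsilon> cannot carry it across a net time.\<close>
  define \<epsilon> where "\<epsilon> = min (e / 2) (D / 16)"
  have \<epsilon>: "0 < \<epsilon>" "\<epsilon> \<le> e" "\<epsilon> \<le> D / 16" using e D by (auto simp: \<epsilon>_def)
  \<comment> \<open>One dense time in each interval of length D / 16; every time up to T + 2D then
    has one of them within D / 8.\<close>
  have "\<exists>n. real i * (D / 16) < q n \<and> q n < (real i + 1) * (D / 16)" for i :: nat
    using D by (intro dense mult_strict_right_mono) auto
  then obtain nn where nn: "\<And>i. real i * (D / 16) < q (nn i)" "\<And>i. q (nn i) < (real i + 1) * (D / 16)" by metis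
  obtain N :: nat where N: "(T + 2 * D) / (D / 16) < real N" using reals_Archimedean2 by blast
  have net: "\<exists>n\<in>nn ` {..N}. \<bar>q n - t\<bar> < D / 8" if t: "0 \<le> t" "t \<le> T + 2 * D" for t
  proof -
    define i where "i = nat \<lfloor>t / (D / 16)\<rfloor>"
    have fl: "real i \<le> t / (D / 16)" "t / (D / 16) < real i + 1"
      using t(1) D by (auto simp: i_def)
    then have i: "real i * (D / 16) \<le> t" "t < (real i + 1) * (D / 16)" using D by (simp_all add: field_simps)
    have "t / (D / 16) \<le> (T + 2 * D) / (D / 16)" using t D by (intro divide_right_mono) auto
    then have "real i < real N" using fl N by linarith
    then have "nn i \<in> nn ` {..N}" by auto
    moreover have "\<bar>q (nn i) - t\<bar> < D / 8" using nn[of i] i D unfolding distrib_right by linarith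
    ultimately show ?thesis by blast
  qed
  have "eventually (\<lambda>j. \<forall>i\<in>{..<I}. \<bar>S j k i - sl k i\<bar> < \<epsilon>) sequentially"
    using S_lim \<epsilon>(1) by (intro eventually_ball_finite) (auto simp: tendsto_iff dist_real_def)
  moreover have "eventually (\<lambda>j. \<forall>n\<in>nn ` {..N}. mdist m (G j (min (q n) T)) (h n) < e / 8) sequentially"
    using e by (intro eventually_ball_finite ballI h_dist) auto
  ultimately show ?thesis
  proof eventually_elim
    case (elim j)
    define s where "s = S j k"
    have s: "separated D s" using separated_S by (simp add: s_def D_def)
    have sl: "separated D (sl k)" using separated_sl by (simp add: D_def)
    have near: "\<bar>s i - sl k i\<bar> < \<epsilon>" if "i < I" for i using elim(1) that by (simp add: s_def)
    obtain l where l: "time_change l" "\<And>t. t \<ge> 0 \<Longrightarrow> \<bar>l t - t\<bar> \<le> \<epsilon>" "\<And>i. i < I \<Longrightarrow> l (s i) = sl k i"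
    proof -
      have "\<bar>sl k i - s i\<bar> \<le> \<epsilon>" if "i < I" for i using near[OF that] by linarith
      with time_change_through[OF s D, of \<epsilon> I "sl k"] \<epsilon> D that show ?thesis by auto
    qed
    have l0: "0 \<le> l t" if "0 \<le> t" for t using time_change_nonneg[OF l(1) that] .
    have l_mono: "l a \<le> l b \<longleftrightarrow> a \<le> b" if "0 \<le> a" "0 \<le> b" for a b
    proof -
      have "strict_mono_on {0..} l" using l(1) by (simp add: time_change_def)
      then show ?thesis using that by (subst strict_mono_on_less_eq) auto
    qed
    have main: "mdist m (G j (min t T)) (lim (l t)) \<le> e" if t: "0 \<le> t" "t \<le> T + D" for t
    proof -
      \<comment> \<open>\<open>u\<close> replaces \<open>t\<close> by a time at distance D / 4 from
        all jump times; the net time near \<open>u\<close> still keeps the distance D / 8.\<close>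
      obtain u where u: "0 \<le> u" "\<bar>u - t\<bar> \<le> D / 4" "\<And>i. D / 4 \<le> \<bar>s i - u\<bar>" "\<And>i. s i \<le> t \<longleftrightarrow> s i \<le> u"
        using separated_point[OF s D t(1)] by blast
      have uT: "u \<le> T + 2 * D" using u(2) t D by linarith
      from net[OF u(1) uT] obtain n where n: "n \<in> nn ` {..N}" "\<bar>q n - u\<bar> < D / 8" by blast
      have far: "D / 8 < \<bar>s i - q n\<bar>" for i using u(3)[of i] n(2) by linarith
      have side1: "s i \<le> t \<longleftrightarrow> s i \<le> q n" for i using u(3)[of i] u(4)[of i] n(2) by linarith
      have tq: "\<bar>t - q n\<bar> < D / 2" using u(2) n(2) D by linarith
      have ltq: "\<bar>l t - q n\<bar> < D" using tq l(2)[OF t(1)] \<epsilon> D by linarith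
      have side2: "sl k i \<le> l t \<longleftrightarrow> sl k i \<le> q n" for i
      proof (cases "i < I")
        case True
        have "sl k i \<le> l t \<longleftrightarrow> s i \<le> t"
          using l(3)[OF True] l_mono[of "s i" t] separated_ge[OF s D, of i] D t(1) by simp
        also have "\<dots> \<longleftrightarrow> s i \<le> q n" by (rule side1)
        also have "\<dots> \<longleftrightarrow> sl k i \<le> q n" using near[OF True] far[of i] \<epsilon> D by linarith
        finally show ?thesis .
      next
        case False
        have "T + 3 * D < sl k i" by (rule beyond[OF sl False])
        then have "l t < sl k i" "q n < sl k i" using tq ltq t D by linarith+
        then show ?thesis by auto
      qed
      have ne: "sl k i \<noteq> q n" for i
      proof (cases "i < I")
        case True
        with near[OF True] far[of i] \<epsilon> D show ?thesis by auto
      next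
        case False
        with beyond[OF sl False] tq t D show ?thesis by auto
      qed
      have "mdist m (G j (min t T)) (G j (min (q n) T)) \<le> \<eta> k"
        using t(1) q0 tq D side1 by (intro jump_modulusD[OF S]) (auto simp: s_def[symmetric] D_def[symmetric])
      moreover have "mdist m (G j (min (q n) T)) (h n) < e / 8" using elim(2) n(1) by blast
      moreover have "mdist m (h n) (lim (q n)) \<le> \<eta> k" by (rule h_lim_dist[OF ne])
      moreover have "mdist m (lim (q n)) (lim (l t)) \<le> \<eta> k"
        using ltq side2 l0[OF t(1)] q0 by (intro lim_modulus) (auto simp: D_def abs_minus_commute)
      moreover have "mdist m (G j (min t T)) (lim (l t)) \<le> mdist m (G j (min t T)) (G j (min (q n) T)) +
          mdist m (G j (min (q n) T)) (lim (l t))"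
        by (rule triangle[OF GM[OF t(1)] GM[OF q0] PM[OF lim_P[OF l0[OF t(1)]]]])
      moreover have "mdist m (G j (min (q n) T)) (lim (l t)) \<le> mdist m (G j (min (q n) T)) (h n) + mdist m (h n) (lim (l t))"
        using l0[OF t(1)] by (intro triangle) (auto intro: GM q0 PM lim_P hP)
      moreover have "mdist m (h n) (lim (l t)) \<le> mdist m (h n) (lim (q n)) + mdist m (lim (q n)) (lim (l t))"
        using l0[OF t(1)] by (intro triangle) (auto intro: GM q0 PM lim_P hP)
      ultimately show ?thesis using k e by linarith
    qed
    show "skorohod_close m T (G j) lim_path e"
      unfolding skorohod_close_def
    proof (intro exI[of _ l] conjI allI impI l(1))
      fix t :: real assume t: "0 \<le> t"
      show "\<bar>l t - t\<bar> \<le> e" using l(2)[OF t] \<epsilon> by linarith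
      show "mdist m (G j (min t T)) (lim_path (min (l t) T)) \<le> e"
      proof (cases "t \<le> T + D")
        case True
        then show ?thesis using main[OF t] lim_path_min[OF l0[OF t]] by simp
      next
        case False
        \<comment> \<open>After T + D both paths are frozen at their values at \<open>T\<close>,
          which the comparison at T + D has already covered.\<close>
        have "T \<le> l t" "T \<le> l (T + D)" using l(2)[OF t] l(2)[of "T + D"] \<epsilon> D T False by auto
        then have "lim (l t) = lim (l (T + D))" using lim_const by metis
        then show ?thesis using main[of "T + D"] lim_path_min[OF l0[OF t]] False T D by (simp add: min_absorb2)
      qed
    qed
  qed
qed

end

text \<open>In a metric space compactness may be checked on sequences. A first diagonal extraction
  makes the paths converge at a countable dense set of times, a second one makes all jump times of
  all levels converge; the limit inherits the moduli and the bounds on the jump times.\<close>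

theorem compactin_modulus_class:
  assumes T: "0 < T" and P: "compactin (mtopology_of m) P" and \<delta>: "\<And>k. 0 < \<delta> k" and \<eta>: "\<eta> \<longlonglongrightarrow> 0"
  shows "compactin (skorohod_topology m T) (modulus_class m T P \<delta> \<eta> B)"
proof -
  let ?K = "modulus_class m T P \<delta> \<eta> B"
  interpret Metric_space "mspace m" "mdist m" by (rule Metric_space_mspace_mdist)
  interpret Sk: Metric_space "skorohod_carrier m T" "skorohod_dist m T" by (rule Metric_space_skorohod[OF T])
  have topo: "skorohod_topology m T = Sk.mtopology"
    by (simp add: skorohod_topology_def mtopology_of_def Sk.mspace_metric Sk.mdist_metric)
  have P': "compactin mtopology P" using P by (simp add: mtopology_of_def)
  have sub: "?K \<subseteq> skorohod_carrier m T" by (rule modulus_class_subset[OF T P \<delta> \<eta>])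
  show ?thesis
    unfolding topo Sk.compactin_sequentially
  proof (intro conjI allI impI sub)
    fix F :: "nat \<Rightarrow> real \<Rightarrow> 'a" assume F: "range F \<subseteq> ?K"
    have "\<forall>j k. \<exists>s. (\<forall>i. s i \<le> B k i) \<and> jump_modulus m T (F j) s (\<delta> k) (\<eta> k)"
      using F by (auto simp: modulus_class_def)
    then obtain s where s: "\<And>j k i. s j k i \<le> B k i" "\<And>j k. jump_modulus m T (F j) (s j k) (\<delta> k) (\<eta> k)" by metis
    have FP: "F j t \<in> P" if "t \<in> {0..T}" for j t
    proof -
      have "F j \<in> ?K" using F by auto
      then have "F j \<in> {0..T} \<rightarrow>\<^sub>E P" by (simp add: modulus_class_def)
      from PiE_mem[OF this that] show ?thesis .
    qed
    \<comment> \<open>Absolute values of the rationals enumerate a dense sequence of nonnegative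
      times; it also contains times beyond \<open>T\<close>, where paths are frozen.\<close>
    define q where "q n = \<bar>real_of_rat (nat_to_rat_surj n)\<bar>" for n
    have q0: "0 \<le> q n" for n by (simp add: q_def)
    have dense: "\<exists>n. a < q n \<and> q n < b" if ab: "0 \<le> a" "a < b" for a b
    proof -
      obtain x :: rat where x: "a < real_of_rat x" "real_of_rat x < b" using of_rat_dense[OF ab(2)] by blast
      obtain n where "x = nat_to_rat_surj n" using surj_nat_to_rat_surj by (metis surjD)
      moreover have "0 < real_of_rat x" using x ab by linarith
      then have "0 < x" by simp
      ultimately have "q n = real_of_rat x" by (simp add: q_def)
      with x show ?thesis by (intro exI[of _ n]) simp
    qed
    have "\<exists>r h. strict_mono r \<and> (\<forall>n. h n \<in> P \<and>
        limitin mtopology (\<lambda>j. F (r j) (min (q n) T)) (h n) sequentially)"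
      by (rule diagonal_limits[of "\<lambda>_. P" "\<lambda>j n. F j (min (q n) T)"]) (use P' FP q0 T in auto)
    then obtain r1 h where r1: "strict_mono r1"
      and h: "\<And>n. h n \<in> P" "\<And>n. limitin mtopology (\<lambda>j. F (r1 j) (min (q n) T)) (h n) sequentially"
      by blast
    \<comment> \<open>The pairs (level, index) of the jump times are coded by one natural number, so
      that a single extraction treats them all.\<close>
    define C where "C n = (case prod_decode n of (k, i) \<Rightarrow> {0..B k i})" for n
    have s0: "0 \<le> s j k i" for j k i
      using separated_ge[OF jump_modulus_separated[OF s(2)[of j k]] \<delta>[of k], of i] \<delta>[of k] by linarith
    have "\<exists>r l. strict_mono r \<and> (\<forall>n. l n \<in> C n \<and> limitin Met_TC.mtopology
        (\<lambda>j. (case prod_decode n of (k, i) \<Rightarrow> s (r1 (r j)) k i)) (l n) sequentially)"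
      by (rule Met_TC.diagonal_limits[of C "\<lambda>j n. case prod_decode n of (k, i) \<Rightarrow> s (r1 j) k i"])
        (auto simp: C_def s s0 split: prod.splits)
    then obtain r2 l where r2: "strict_mono r2" "\<And>n. l n \<in> C n"
      "\<And>n. ((\<lambda>j. (case prod_decode n of (k, i) \<Rightarrow> s (r1 (r2 j)) k i)) \<longlongrightarrow> l n) sequentially"
      by auto
    define sl where "sl k i = l (prod_encode (k, i))" for k i
    interpret converging_paths m T P \<delta> \<eta> "\<lambda>j. F (r1 (r2 j))" "\<lambda>j. s (r1 (r2 j))" sl q h
    proof
      show "(\<lambda>j. s (r1 (r2 j)) k i) \<longlonglongrightarrow> sl k i" for k i
        using r2(3)[of "prod_encode (k, i)"] by (simp add: sl_def)
      show "limitin (mtopology_of m) (\<lambda>j. F (r1 (r2 j)) (min (q n) T)) (h n) sequentially" for n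
        using limitin_subsequence[OF r2(1) h(2)[of n]] by (simp add: mtopology_of_def o_def)
    qed (use T P \<delta> \<eta> FP s q0 dense h in auto)
    have "\<exists>s. (\<forall>i. s i \<le> B k i) \<and> jump_modulus m T lim_path s (\<delta> k) (\<eta> k)" for k
    proof (intro exI[of _ "sl k"] conjI allI lim_path_modulus)
      show "sl k i \<le> B k i" for i using r2(2)[of "prod_encode (k, i)"] by (simp add: sl_def C_def)
    qed
    then have K: "lim_path \<in> ?K" using lim_path_PiE by (simp add: modulus_class_def)
    have "limitin Sk.mtopology (F \<circ> (r1 \<circ> r2)) lim_path sequentially"
      unfolding Sk.limitin_metric
    proof (intro conjI allI impI)
      show "lim_path \<in> skorohod_carrier m T" using K sub by blast
      fix e :: real assume "e > 0"
      from eventually_close[OF half_gt_zero[OF this]]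
      show "\<forall>\<^sub>F j in sequentially. (F \<circ> (r1 \<circ> r2)) j \<in> skorohod_carrier m T \<and>
          skorohod_dist m T ((F \<circ> (r1 \<circ> r2)) j) lim_path < e"
      proof eventually_elim
        case (elim j)
        have Fj: "F (r1 (r2 j)) \<in> skorohod_carrier m T" using F sub by auto
        have "skorohod_dist m T (F (r1 (r2 j))) lim_path \<le> e / 2"
          using Fj K sub by (intro skorohod_dist_le elim) auto
        with Fj \<open>e > 0\<close> show ?case by auto
      qed
    qed
    then have "lim_path \<in> ?K \<and> strict_mono (r1 \<circ> r2) \<and> limitin Sk.mtopology (F \<circ> (r1 \<circ> r2)) lim_path sequentially"
      using K strict_mono_o[OF r1 r2(1)] by (intro conjI)
    then show "\<exists>l r. l \<in> ?K \<and> strict_mono r \<and> limitin Sk.mtopology (F \<circ> r) l sequentially"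
      by (intro exI)
  qed
qed

section \<open>Noise of finite variation\<close>

lemma measurable_intensity [measurable]:
  assumes "sets lam = sets borel"
  shows "fst \<in> borel_measurable (intensity lam)"
    and "(\<lambda>p. fst (snd p)) \<in> borel_measurable (intensity lam)"
    and "(\<lambda>p. snd (snd p)) \<in> borel_measurable (intensity lam)"
proof -
  have [measurable_cong]: "sets lam = sets borel" by fact
  have id: "(\<lambda>x::real. x) \<in> borel_measurable (restrict_space lborel A)" for A
    by (rule measurable_restrict_space1) simp
  have "(\<lambda>p. fst p) \<in> measurable (intensity lam) (restrict_space lborel {0<..})"
    unfolding intensity_def by measurable
  from measurable_compose[OF this id] show "fst \<in> borel_measurable (intensity lam)" by simp
  have "(\<lambda>p. fst (snd p)) \<in> measurable (intensity lam) (restrict_space lborel {0..1})"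
    unfolding intensity_def by measurable
  from measurable_compose[OF this id] show "(\<lambda>p. fst (snd p)) \<in> borel_measurable (intensity lam)" by simp
  show "(\<lambda>p. snd (snd p)) \<in> borel_measurable (intensity lam)"
    unfolding intensity_def by measurable
qed

lemma jump_density_measurable:
  assumes lam: "sets lam = sets borel" and N: "sets N = sets (intensity lam)"
    and S: "S \<in> sets borel" and X: "X \<in> sets borel" and Z: "Z \<in> sets borel"
  shows "(\<lambda>p. indicator S (fst p) * indicator X (fst (snd p)) * indicator Z (snd (snd p)) *
    ennreal \<bar>snd (snd p)\<bar>) \<in> borel_measurable N"
proof -
  have [measurable]: "(\<lambda>p. fst p) \<in> borel_measurable N" "(\<lambda>p. fst (snd p)) \<in> borel_measurable N"
    "(\<lambda>p. snd (snd p)) \<in> borel_measurable N"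
    using measurable_intensity[OF lam] N by (simp_all cong: measurable_cong_sets)
  have [measurable]: "(\<lambda>p. indicator S (fst p) :: ennreal) \<in> borel_measurable N"
    by (rule measurable_compose[of fst N borel "indicator S"]) (use S in auto)
  have [measurable]: "(\<lambda>p. indicator X (fst (snd p)) :: ennreal) \<in> borel_measurable N"
    by (rule measurable_compose[of "\<lambda>p. fst (snd p)" N borel "indicator X"]) (use X in auto)
  have [measurable]: "(\<lambda>p. indicator Z (snd (snd p)) :: ennreal) \<in> borel_measurable N"
    by (rule measurable_compose[of "\<lambda>p. snd (snd p)" N borel "indicator Z"]) (use Z in auto)
  show ?thesis by measurable
qed

text \<open>The variation of the noise caused by jumps in \<open>S \<times> X\<close> of size in
  \<open>Z\<close>. The indicators form a product so that the integral factors under the intensity,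
  and values in \<open>ennreal\<close> make it meaningful for every sample point.\<close>

definition jump_mass :: "(real \<times> real \<times> real) measure \<Rightarrow> real set \<Rightarrow> real set \<Rightarrow> real set \<Rightarrow> ennreal" where
  "jump_mass N S X Z =
     (\<integral>\<^sup>+p. indicator S (fst p) * indicator X (fst (snd p)) * indicator Z (snd (snd p)) * ennreal \<bar>snd (snd p)\<bar> \<partial>N)"

locale finite_variation_noise =
  fixes M :: "'w measure" and F :: "real \<Rightarrow> 'w measure" and b :: real and lam :: "real measure"
    and mu :: "'w \<Rightarrow> (real \<times> real \<times> real) measure" and L :: "(real \<times> real) set \<Rightarrow> 'w \<Rightarrow> real"
  assumes space: "complete_filtered_prob_space M F" and levy: "levy_measure lam"
    and prm: "poisson_random_measure M F lam mu" and noise: "is_levy_noise M b lam mu L"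
    and first_moment: "(\<integral>\<^sup>+z. ennreal \<bar>z\<bar> \<partial>lam) < \<infinity>"
begin

sublocale prob_space M using space by (simp add: complete_filtered_prob_space_def)

lemma sets_lam [measurable_cong]: "sets lam = sets borel" using levy by (simp add: levy_measure_def)

lemma space_lam: "space lam = UNIV" using sets_eq_imp_space_eq[OF sets_lam] by simp

lemma sets_mu: "w \<in> space M \<Longrightarrow> sets (mu w) = sets (intensity lam)"
  using prm by (simp add: poisson_random_measure_def)

lemma emeasure_mu_measurable: "A \<in> sets (intensity lam) \<Longrightarrow> (\<lambda>w. emeasure (mu w) A) \<in> borel_measurable M"
  using prm by (simp add: poisson_random_measure_def)

lemma poisson:
  "A \<in> sets (intensity lam) \<Longrightarrow> emeasure (intensity lam) A < \<infinity> \<Longrightarrow>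
    prob {w \<in> space M. emeasure (mu w) A = of_nat k} =
      exp (- measure (intensity lam) A) * measure (intensity lam) A ^ k / fact k"
  using prm by (simp add: poisson_random_measure_def)

lemma poisson_infinite:
  "A \<in> sets (intensity lam) \<Longrightarrow> emeasure (intensity lam) A = \<infinity> \<Longrightarrow> AE w in M. emeasure (mu w) A = \<infinity>"
  using prm by (simp add: poisson_random_measure_def)

text \<open>For finite intensity the Poisson probabilities sum to 1, so the count is almost surely a
  finite integer and its mean is the Poisson series. For infinite intensity the count is almost
  surely infinite.\<close>

lemma mean_measure:
  assumes A: "A \<in> sets (intensity lam)"
  shows "(\<integral>\<^sup>+w. emeasure (mu w) A \<partial>M) = emeasure (intensity lam) A"
proof (cases "emeasure (intensity lam) A = \<infinity>")
  case True
  have "(\<integral>\<^sup>+w. emeasure (mu w) A \<partial>M) = (\<integral>\<^sup>+w. \<infinity> \<partial>M)"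
    using poisson_infinite[OF A True] by (intro nn_integral_cong_AE) auto
  then show ?thesis using True by (simp add: emeasure_space_1)
next
  case False
  then have fin: "emeasure (intensity lam) A < \<infinity>" by (simp add: less_top)
  define a where "a = measure (intensity lam) A"
  have a: "0 \<le> a" by (simp add: a_def)
  define X where "X w = emeasure (mu w) A" for w
  have [measurable]: "X \<in> borel_measurable M" using emeasure_mu_measurable[OF A] by (simp add: X_def[abs_def])
  define E where "E k = {w \<in> space M. X w = of_nat k}" for k :: nat
  have [measurable]: "E k \<in> sets M" for k unfolding E_def by measurable
  have pE: "prob (E k) = exp (- a) * (a ^ k / fact k)" for k
    using poisson[OF A fin, of k] by (simp add: E_def X_def a_def)
  have exps: "(\<lambda>k. a ^ k / fact k) sums exp a"
    using exp_converges[of a] by (simp add: field_simps)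
  have disj: "disjoint_family E" by (auto simp: disjoint_family_on_def E_def)
  have "(\<lambda>k. prob (E k)) sums prob (\<Union>k. E k)"
    by (rule finite_measure_UNION) (auto simp: disj)
  moreover have "(\<lambda>k. prob (E k)) sums (exp (- a) * exp a)"
    unfolding pE by (rule sums_mult[OF exps])
  ultimately have "prob (\<Union>k. E k) = 1" using sums_unique2 by (fastforce simp: exp_minus)
  then have "AE w in M. w \<in> (\<Union>k. E k)" by (rule AE_prob_1)
  then have "AE w in M. X w = (\<Sum>k. of_nat k * indicator (E k) w)"
  proof eventually_elim
    case (elim w)
    then obtain k0 where k0: "w \<in> E k0" by blast
    then have "indicator (E k) w = (0::ennreal)" if "k \<noteq> k0" for k
      using that by (auto simp: E_def indicator_def)
    then have "(\<Sum>k. of_nat k * indicator (E k) w :: ennreal) = (\<Sum>k\<in>{k0}. of_nat k * indicator (E k) w)"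
      by (intro suminf_finite) auto
    with k0 show ?case by (simp add: E_def)
  qed
  then have "(\<integral>\<^sup>+w. X w \<partial>M) = (\<integral>\<^sup>+w. (\<Sum>k. of_nat k * indicator (E k) w) \<partial>M)"
    by (rule nn_integral_cong_AE)
  also have "\<dots> = (\<Sum>k. \<integral>\<^sup>+w. of_nat k * indicator (E k) w \<partial>M)"
    by (rule nn_integral_suminf) measurable
  also have "\<dots> = (\<Sum>k. ennreal (real k * prob (E k)))"
    by (subst nn_integral_cmult_indicator)
      (simp_all add: emeasure_eq_measure ennreal_of_nat_eq_real_of_nat ennreal_mult)
  also have "\<dots> = ennreal a"
  proof (rule suminf_ennreal_eq)
    have "(\<lambda>k. (exp (- a) * a) * (a ^ k / fact k)) sums ((exp (- a) * a) * exp a)"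
      by (rule sums_mult[OF exps])
    also have "(exp (- a) * a) * exp a = a" by (simp add: exp_minus)
    also have "(\<lambda>k. (exp (- a) * a) * (a ^ k / fact k)) = (\<lambda>k. real (Suc k) * prob (E (Suc k)))"
      unfolding pE by (simp add: fun_eq_iff field_simps del: of_nat_Suc)
    finally have "(\<lambda>k. real (Suc k) * prob (E (Suc k))) sums a" .
    from sums_Suc[where f = "\<lambda>k. real k * prob (E k)", OF this]
    show "(\<lambda>k. real k * prob (E k)) sums a" by simp
  qed (simp add: pE a)
  also have "ennreal a = emeasure (intensity lam) A"
    using fin by (simp add: a_def emeasure_eq_ennreal_measure less_top)
  finally show ?thesis by (simp add: X_def)
qed

text \<open>Campbell's formula, extended from sets to nonnegative functions. Measurability is
  carried through the induction because the random measure is given as measurable only set by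
  set.\<close>

lemma campbell:
  assumes "f \<in> borel_measurable (intensity lam)"
  shows "(\<lambda>w. \<integral>\<^sup>+p. f p \<partial>mu w) \<in> borel_measurable M \<and>
    (\<integral>\<^sup>+w. (\<integral>\<^sup>+p. f p \<partial>mu w) \<partial>M) = (\<integral>\<^sup>+p. f p \<partial>intensity lam)"
  using assms
proof (induction rule: borel_measurable_induct)
  case (cong f g)
  have "(\<integral>\<^sup>+p. f p \<partial>mu w) = (\<integral>\<^sup>+p. g p \<partial>mu w)" if "w \<in> space M" for w
    using cong(3) sets_eq_imp_space_eq[OF sets_mu[OF that]] by (intro nn_integral_cong) auto
  moreover have "(\<integral>\<^sup>+p. f p \<partial>intensity lam) = (\<integral>\<^sup>+p. g p \<partial>intensity lam)"
    using cong(3) by (intro nn_integral_cong) auto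
  ultimately show ?case using cong(4) by (simp cong: measurable_cong nn_integral_cong)
next
  case (set A)
  have "(\<integral>\<^sup>+p. indicator A p \<partial>mu w) = emeasure (mu w) A" if "w \<in> space M" for w
    using set sets_mu[OF that] by simp
  then show ?case using set emeasure_mu_measurable mean_measure by (simp cong: measurable_cong nn_integral_cong)
next
  case (mult u c)
  have "(\<integral>\<^sup>+p. c * u p \<partial>mu w) = c * (\<integral>\<^sup>+p. u p \<partial>mu w)" if "w \<in> space M" for w
    using mult(2) sets_mu[OF that] by (intro nn_integral_cmult) (simp cong: measurable_cong_sets)
  moreover have [measurable]: "(\<lambda>w. \<integral>\<^sup>+p. u p \<partial>mu w) \<in> borel_measurable M" using mult by blast
  have "(\<lambda>w. c * (\<integral>\<^sup>+p. u p \<partial>mu w)) \<in> borel_measurable M" by measurable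
  ultimately show ?case using mult by (simp add: nn_integral_cmult cong: measurable_cong nn_integral_cong)
next
  case (add u v)
  have "(\<integral>\<^sup>+p. v p + u p \<partial>mu w) = (\<integral>\<^sup>+p. v p \<partial>mu w) + (\<integral>\<^sup>+p. u p \<partial>mu w)" if "w \<in> space M" for w
    using add(1,3) sets_mu[OF that] by (intro nn_integral_add) (simp_all cong: measurable_cong_sets)
  moreover have [measurable]: "(\<lambda>w. \<integral>\<^sup>+p. u p \<partial>mu w) \<in> borel_measurable M" "(\<lambda>w. \<integral>\<^sup>+p. v p \<partial>mu w) \<in> borel_measurable M"
    using add by blast+
  have "(\<lambda>w. (\<integral>\<^sup>+p. v p \<partial>mu w) + (\<integral>\<^sup>+p. u p \<partial>mu w)) \<in> borel_measurable M" by measurable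
  ultimately show ?case using add by (simp add: nn_integral_add cong: measurable_cong nn_integral_cong)
next
  case (seq U)
  have meas: "U i \<in> borel_measurable (mu w)" if "w \<in> space M" for w i
    using seq(1) sets_mu[OF that] by (simp cong: measurable_cong_sets)
  have "(\<integral>\<^sup>+p. (SUP i. U i p) \<partial>mu w) = (SUP i. \<integral>\<^sup>+p. U i p \<partial>mu w)" if "w \<in> space M" for w
    by (rule nn_integral_monotone_convergence_SUP[OF \<open>incseq U\<close> meas[OF that]])
  moreover have "(\<integral>\<^sup>+w. (SUP i. \<integral>\<^sup>+p. U i p \<partial>mu w) \<partial>M) = (SUP i. \<integral>\<^sup>+w. (\<integral>\<^sup>+p. U i p \<partial>mu w) \<partial>M)"
  proof (rule nn_integral_monotone_convergence_SUP)
    show "incseq (\<lambda>i w. \<integral>\<^sup>+p. U i p \<partial>mu w)"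
      using \<open>incseq U\<close> by (auto simp: incseq_def le_fun_def intro!: nn_integral_mono)
  qed (use seq in simp)
  moreover have "(\<integral>\<^sup>+p. (SUP i. U i p) \<partial>intensity lam) = (SUP i. \<integral>\<^sup>+p. U i p \<partial>intensity lam)"
    by (rule nn_integral_monotone_convergence_SUP[OF \<open>incseq U\<close> seq(1)])
  moreover have "(\<lambda>w. \<integral>\<^sup>+p. U i p \<partial>mu w) \<in> borel_measurable M" for i using seq by blast
  then have "(\<lambda>w. SUP i. \<integral>\<^sup>+p. U i p \<partial>mu w) \<in> borel_measurable M" by measurable
  ultimately show ?case using seq by (simp add: SUP_apply[abs_def] image_comp cong: measurable_cong nn_integral_cong)
qed

lemma tail_finite:
  assumes "0 < e"
  shows "emeasure lam {z. e < \<bar>z\<bar>} < \<infinity>"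
proof -
  have "emeasure lam {z. e < \<bar>z\<bar>} \<le> emeasure lam {z \<in> space lam. 1 \<le> ennreal (1 / e) * ennreal \<bar>z\<bar>}"
    using assms by (intro emeasure_mono) (auto simp: space_lam ennreal_mult[symmetric] field_simps)
  also have "\<dots> \<le> ennreal (1 / e) * (\<integral>\<^sup>+z. ennreal \<bar>z\<bar> * indicator (space lam) z \<partial>lam)"
    by (rule nn_integral_Markov_inequality) auto
  also have "\<dots> < \<infinity>" using first_moment by (simp add: space_lam ennreal_mult_less_top)
  finally show ?thesis .
qed

lemma sigma_finite_lam: "sigma_finite_measure lam"
proof
  let ?A = "insert {0} (range (\<lambda>n. {z. 1 / real (Suc n) < \<bar>z\<bar>}))"
  have "z \<in> \<Union>?A" for z :: real
  proof (cases "z = 0")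
    case False
    then obtain n where "1 / real (Suc n) < \<bar>z\<bar>" using nat_approx_posE[of "\<bar>z\<bar>"] by (metis zero_less_abs_iff)
    then show ?thesis by blast
  qed simp
  moreover have "emeasure lam {0} \<noteq> \<infinity>" using levy by (simp add: levy_measure_def)
  moreover have "emeasure lam {z. 1 / real (Suc n) < \<bar>z\<bar>} \<noteq> \<infinity>" for n
    using tail_finite[of "1 / real (Suc n)"] by simp
  ultimately show "\<exists>A. countable A \<and> A \<subseteq> sets lam \<and> \<Union>A = space lam \<and> (\<forall>a\<in>A. emeasure lam a \<noteq> \<infinity>)"
    by (intro exI[of _ ?A]) (auto simp: sets_lam space_lam)
qed

lemma sigma_finite_xz: "sigma_finite_measure (restrict_space lborel {0..1::real} \<Otimes>\<^sub>M lam)"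
  by (intro sigma_finite_pair_measure sigma_finite_measure_restrict_space lborel.sigma_finite_measure_axioms sigma_finite_lam) simp

lemma nn_integral_intensity:
  assumes S: "S \<in> sets borel" "S \<subseteq> {0<..}" and X: "X \<in> sets borel" "X \<subseteq> {0..1}" and g: "g \<in> borel_measurable borel"
  shows "(\<integral>\<^sup>+p. indicator S (fst p) * indicator X (fst (snd p)) * g (snd (snd p)) \<partial>intensity lam) =
    emeasure lborel S * emeasure lborel X * (\<integral>\<^sup>+z. g z \<partial>lam)"
proof -
  interpret lam: sigma_finite_measure lam by (rule sigma_finite_lam)
  interpret xz: sigma_finite_measure "restrict_space lborel {0..1::real} \<Otimes>\<^sub>M lam" by (rule sigma_finite_xz)
  have [measurable]: "g \<in> borel_measurable lam" using g by (simp cong: measurable_cong_sets add: sets_lam)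
  have id: "(\<lambda>x::real. x) \<in> borel_measurable (restrict_space lborel A)" for A
    by (rule measurable_restrict_space1) simp
  have iX[measurable]: "(\<lambda>x. indicator X x :: ennreal) \<in> borel_measurable (restrict_space lborel {0..1})"
    by (rule measurable_compose[OF id borel_measurable_indicator[OF X(1)]])
  have iS[measurable]: "(\<lambda>x. indicator S x :: ennreal) \<in> borel_measurable (restrict_space lborel {0<..})"
    by (rule measurable_compose[OF id borel_measurable_indicator[OF S(1)]])
  have intX: "(\<integral>\<^sup>+x. indicator X x \<partial>restrict_space lborel {0..1}) = emeasure lborel X"
    using X by (subst nn_integral_indicator) (auto simp: emeasure_restrict_space sets_restrict_space_iff)
  have intS: "(\<integral>\<^sup>+x. indicator S x \<partial>restrict_space lborel {0<..}) = emeasure lborel S"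
    using S by (subst nn_integral_indicator) (auto simp: emeasure_restrict_space sets_restrict_space_iff)
  let ?T = "restrict_space lborel {0<..} :: real measure" and ?X = "restrict_space lborel {0..1} :: real measure"
  have gm: "(\<lambda>q. indicator S t * indicator X (fst q) * g (snd q)) \<in> borel_measurable (?X \<Otimes>\<^sub>M lam)" for t
    by (intro borel_measurable_times_ennreal borel_measurable_const measurable_compose[OF measurable_fst iX]
        measurable_compose[OF measurable_snd \<open>g \<in> borel_measurable lam\<close>])
  have fm: "(\<lambda>p. indicator S (fst p) * indicator X (fst (snd p)) * g (snd (snd p))) \<in> borel_measurable (?T \<Otimes>\<^sub>M (?X \<Otimes>\<^sub>M lam))"
    by (intro borel_measurable_times_ennreal measurable_compose[OF measurable_fst iS]
        measurable_compose[OF measurable_snd measurable_compose[OF measurable_fst iX]]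
        measurable_compose[OF measurable_snd measurable_compose[OF measurable_snd \<open>g \<in> borel_measurable lam\<close>]])
  have "(\<integral>\<^sup>+p. indicator S (fst p) * indicator X (fst (snd p)) * g (snd (snd p)) \<partial>intensity lam) =
      (\<integral>\<^sup>+t. \<integral>\<^sup>+q. indicator S t * indicator X (fst q) * g (snd q) \<partial>(?X \<Otimes>\<^sub>M lam) \<partial>?T)"
    unfolding intensity_def using xz.nn_integral_fst[OF fm] by simp
  also have "\<dots> = (\<integral>\<^sup>+t. \<integral>\<^sup>+x. \<integral>\<^sup>+z. indicator S t * indicator X x * g z \<partial>lam \<partial>?X \<partial>?T)"
    using lam.nn_integral_fst[OF gm] by simp
  also have "\<dots> = emeasure lborel S * emeasure lborel X * (\<integral>\<^sup>+z. g z \<partial>lam)"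
    by (simp add: nn_integral_cmult nn_integral_multc intX intS mult.assoc)
  finally show ?thesis .
qed

lemma emeasure_intensity:
  assumes S: "S \<in> sets borel" "S \<subseteq> {0<..}" and X: "X \<in> sets borel" "X \<subseteq> {0..1}" and Z: "Z \<in> sets borel"
  shows "S \<times> X \<times> Z \<in> sets (intensity lam)"
    and "emeasure (intensity lam) (S \<times> X \<times> Z) = emeasure lborel S * emeasure lborel X * emeasure lam Z"
proof -
  show *: "S \<times> X \<times> Z \<in> sets (intensity lam)"
    unfolding intensity_def using assms by (intro pair_measureI) (auto simp: sets_restrict_space_iff sets_lam)
  have "emeasure (intensity lam) (S \<times> X \<times> Z) = (\<integral>\<^sup>+p. indicator (S \<times> X \<times> Z) p \<partial>intensity lam)"
    using * by simp
  also have "\<dots> = (\<integral>\<^sup>+p. indicator S (fst p) * indicator X (fst (snd p)) * indicator Z (snd (snd p)) \<partial>intensity lam)"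
    by (intro nn_integral_cong) (auto simp: indicator_def)
  also have "\<dots> = emeasure lborel S * emeasure lborel X * emeasure lam Z"
    using Z by (subst nn_integral_intensity[OF S X]) (auto simp: sets_lam)
  finally show "emeasure (intensity lam) (S \<times> X \<times> Z) = emeasure lborel S * emeasure lborel X * emeasure lam Z" .
qed

lemma jump_mass_measurable:
  assumes "S \<in> sets borel" "X \<in> sets borel" "Z \<in> sets borel"
  shows "(\<lambda>w. jump_mass (mu w) S X Z) \<in> borel_measurable M"
  unfolding jump_mass_def by (intro campbell[THEN conjunct1] jump_density_measurable[OF sets_lam] assms refl)

lemma mean_jump_mass:
  assumes S: "S \<in> sets borel" "S \<subseteq> {0<..}" and X: "X \<in> sets borel" "X \<subseteq> {0..1}" and Z: "Z \<in> sets borel"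
  shows "(\<integral>\<^sup>+w. jump_mass (mu w) S X Z \<partial>M) = emeasure lborel S * emeasure lborel X * (\<integral>\<^sup>+z. indicator Z z * ennreal \<bar>z\<bar> \<partial>lam)"
proof -
  have "(\<integral>\<^sup>+w. jump_mass (mu w) S X Z \<partial>M) = jump_mass (intensity lam) S X Z"
    unfolding jump_mass_def by (intro campbell[THEN conjunct2] jump_density_measurable[OF sets_lam] assms refl)
  also have "\<dots> = emeasure lborel S * emeasure lborel X * (\<integral>\<^sup>+z. indicator Z z * ennreal \<bar>z\<bar> \<partial>lam)"
    unfolding jump_mass_def using nn_integral_intensity[OF S X, of "\<lambda>z. indicator Z z * ennreal \<bar>z\<bar>"] Z
    by (simp add: mult.assoc)
  finally show ?thesis .
qed

text \<open>For a Poisson variable with mean c, exp (- c) \<ge> 1 - c bounds the probability of at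
  least one point by c, and that of at least two points by 1 - (1 - c)(1 + c) =
  \<open>c\<^sup>2\<close>. The quadratic order is what makes a union bound over about 1 / \<delta>
  windows of length of order \<delta> small.\<close>

lemma prob_jump:
  assumes A: "A \<in> sets (intensity lam)" "emeasure (intensity lam) A \<le> ennreal a" "0 \<le> a"
  shows "prob {w \<in> space M. emeasure (mu w) A \<noteq> 0} \<le> a"
    and "prob {w \<in> space M. \<not> emeasure (mu w) A \<le> 1} \<le> a\<^sup>2"
proof -
  have [measurable]: "(\<lambda>w. emeasure (mu w) A) \<in> borel_measurable M" by (rule emeasure_mu_measurable[OF A(1)])
  define c where "c = measure (intensity lam) A"
  have fin: "emeasure (intensity lam) A < \<infinity>" using A(2) by (auto simp: top_unique less_top[symmetric])
  have c: "0 \<le> c" "c \<le> a" using A(2,3) fin by (auto simp: c_def emeasure_eq_ennreal_measure less_top)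
  have p0: "prob {w \<in> space M. emeasure (mu w) A = 0} = exp (- c)"
    using poisson[OF A(1) fin, of 0] by (simp add: c_def)
  have p1: "prob {w \<in> space M. emeasure (mu w) A = 1} = exp (- c) * c"
    using poisson[OF A(1) fin, of 1] by (simp add: c_def)
  have ge: "1 - c \<le> exp (- c)" using exp_ge_add_one_self[of "- c"] by simp
  show "prob {w \<in> space M. emeasure (mu w) A \<noteq> 0} \<le> a"
    using prob_neg[of "\<lambda>w. emeasure (mu w) A = 0"] p0 ge c by simp
  have "prob {w \<in> space M. emeasure (mu w) A = 0 \<or> emeasure (mu w) A = 1} =
      prob ({w \<in> space M. emeasure (mu w) A = 0} \<union> {w \<in> space M. emeasure (mu w) A = 1})"
    by (rule arg_cong[of _ _ prob]) auto
  also have "\<dots> = exp (- c) * (1 + c)"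
    by (subst finite_measure_Union) (auto simp: p0 p1 algebra_simps)
  finally have p01: "prob {w \<in> space M. emeasure (mu w) A = 0 \<or> emeasure (mu w) A = 1} = exp (- c) * (1 + c)" .
  have "(1 - c) * (1 + c) \<le> exp (- c) * (1 + c)" using ge c by (intro mult_right_mono) auto
  then have le: "1 - exp (- c) * (1 + c) \<le> c\<^sup>2" by (simp add: algebra_simps power2_eq_square)
  have "prob {w \<in> space M. \<not> emeasure (mu w) A \<le> 1} \<le>
      prob {w \<in> space M. \<not> (emeasure (mu w) A = 0 \<or> emeasure (mu w) A = 1)}"
    by (intro finite_measure_mono) auto
  also have "\<dots> = 1 - exp (- c) * (1 + c)"
    using prob_neg[of "\<lambda>w. emeasure (mu w) A = 0 \<or> emeasure (mu w) A = 1"] p01 by simp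
  also have "\<dots> \<le> a\<^sup>2" using le c by (smt (verit) power_mono)
  finally show "prob {w \<in> space M. \<not> emeasure (mu w) A \<le> 1} \<le> a\<^sup>2" .
qed

section \<open>Domination of the noise by the jump mass\<close>

definition moment :: real where "moment = enn2real (\<integral>\<^sup>+z. ennreal \<bar>z\<bar> \<partial>lam)"

lemma moment: "(\<integral>\<^sup>+z. ennreal \<bar>z\<bar> \<partial>lam) = ennreal moment" "0 \<le> moment"
  using first_moment by (simp_all add: moment_def less_top)

text \<open>For a function that is not integrable, the left side is 0 by the convention for the
  integral.\<close>

lemma norm_integral_le:
  fixes f :: "'b \<Rightarrow> real"
  shows "ennreal \<bar>integral\<^sup>L N f\<bar> \<le> (\<integral>\<^sup>+x. ennreal \<bar>f x\<bar> \<partial>N)"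
  using integral_norm_bound_ennreal[of N f] by (cases "integrable N f") (auto simp: not_integrable_integral_eq)

text \<open>Only upper bounds for the noise are needed. The compensated integral is the mean-square limit of
  integrals that are all bounded by the same random variable, hence bounded by it itself.\<close>

lemma noise_bound:
  assumes S: "S \<in> sets borel" "S \<subseteq> {0..}" "emeasure lborel S < \<infinity>" and X: "X \<in> sets borel" "X \<subseteq> {0..1}"
  shows "AE w in M. ennreal \<bar>L (S \<times> X) w\<bar> \<le>
    ennreal ((\<bar>b\<bar> + moment) * measure lborel S * measure lborel X) + jump_mass (mu w) S X UNIV"
proof -
  let ?B = "S \<times> X"
  have X1: "emeasure lborel X \<le> 1" using emeasure_mono[OF X(2), of lborel] by simp
  have eS: "emeasure lborel S = ennreal (measure lborel S)" and eX: "emeasure lborel X = ennreal (measure lborel X)"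
    using S X1 by (auto intro!: emeasure_eq_ennreal_measure simp: top_unique less_top[symmetric])
  have Bs: "?B \<in> sets borel" using S X by (simp add: borel_prod[symmetric])
  have Be: "emeasure lborel ?B = emeasure lborel S * emeasure lborel X"
    using S X by (simp add: lborel_prod[symmetric] lborel.emeasure_pair_measure_Times)
  then have Bm: "measure lborel ?B = measure lborel S * measure lborel X"
    by (simp add: measure_def enn2real_mult)
  have Bf: "emeasure lborel ?B < \<infinity>" using Be eS eX by (simp add: ennreal_mult_less_top)
  let ?f = "\<lambda>(t, x, z). z * indicator ?B (t, x) * indicator {z. \<bar>z\<bar> \<le> 1} z :: real"
  have "L ?B \<in> borel_measurable M \<and> (\<exists>I. is_compensated_integral M lam mu ?f I \<and>
      (AE w in M. L ?B w = b * measure lborel ?B + I w +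
                (LINT (t, x, z)|mu w. z * indicator ?B (t, x) * indicator {z. \<bar>z\<bar> > 1} z)))"
    by (rule noise[unfolded is_levy_noise_def, rule_format, OF Bs _ Bf]) (use S(2) X(2) in auto)
  then obtain I where I: "is_compensated_integral M lam mu ?f I"
    and LI: "AE w in M. L ?B w = b * measure lborel ?B + I w +
                (LINT (t, x, z)|mu w. z * indicator ?B (t, x) * indicator {z. \<bar>z\<bar> > 1} z)" by blast
  let ?U = "{z::real. \<bar>z\<bar> \<le> 1}" and ?V = "{z::real. \<bar>z\<bar> > 1}"
  \<comment> \<open>A bound for all truncated compensated integrals at once: the jump mass of the
    small jumps plus a bound for the compensator.\<close>
  define H where "H w = jump_mass (mu w) S X ?U + ennreal (moment * measure lborel S * measure lborel X)" for w
  define J where "J e w = (LINT p:{(t, x, z). \<bar>z\<bar> > e}|mu w. ?f p) -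
     (LINT p:{(t, x, z). \<bar>z\<bar> > e}|intensity lam. ?f p)" for e w
  have absf: "(\<integral>\<^sup>+p. ennreal \<bar>indicator {(t, x, z). \<bar>z\<bar> > e} p *\<^sub>R ?f p\<bar> \<partial>N) \<le> jump_mass N S X ?U" for e N
    unfolding jump_mass_def by (intro nn_integral_mono) (auto simp: indicator_def)
  have J_le: "ennreal \<bar>LINT p:{(t, x, z). \<bar>z\<bar> > e}|N. ?f p\<bar> \<le> jump_mass N S X ?U" for e N
    unfolding set_lebesgue_integral_def by (rule order_trans[OF norm_integral_le absf])
  have mass_int: "jump_mass (intensity lam) S X ?U \<le> ennreal (moment * measure lborel S * measure lborel X)"
  proof -
    have "jump_mass (intensity lam) S X ?U \<le> (\<integral>\<^sup>+p. indicator (S \<inter> {0<..}) (fst p) * indicator X (fst (snd p)) * ennreal \<bar>snd (snd p)\<bar> \<partial>intensity lam)"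
      unfolding jump_mass_def
      by (intro nn_integral_mono) (auto simp: indicator_def intensity_def space_pair_measure space_restrict_space)
    also have "\<dots> = emeasure lborel (S \<inter> {0<..}) * emeasure lborel X * (\<integral>\<^sup>+z. ennreal \<bar>z\<bar> \<partial>lam)"
      using S X by (intro nn_integral_intensity) auto
    also have "\<dots> \<le> emeasure lborel S * emeasure lborel X * (\<integral>\<^sup>+z. ennreal \<bar>z\<bar> \<partial>lam)"
      using S by (intro mult_right_mono emeasure_mono) auto
    also have "\<dots> = ennreal (moment * measure lborel S * measure lborel X)"
      unfolding moment(1) eS eX using moment(2) by (simp add: ennreal_mult[symmetric] mult_ac)
    finally show ?thesis .
  qed
  have JH: "ennreal \<bar>J e w\<bar> \<le> H w" for e w
  proof -
    have "ennreal \<bar>J e w\<bar> \<le> ennreal (\<bar>LINT p:{(t, x, z). \<bar>z\<bar> > e}|mu w. ?f p\<bar> + \<bar>LINT p:{(t, x, z). \<bar>z\<bar> > e}|intensity lam. ?f p\<bar>)"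
      unfolding J_def by (intro ennreal_leI) linarith
    also have "\<dots> \<le> jump_mass (mu w) S X ?U + jump_mass (intensity lam) S X ?U"
      by (subst ennreal_plus) (simp_all only: abs_ge_zero add_mono J_le)
    also have "\<dots> \<le> H w" unfolding H_def using mass_int by (intro add_left_mono)
    finally show ?thesis .
  qed
  have Im[measurable]: "I \<in> borel_measurable M"
    and lim: "((\<lambda>e. \<integral>\<^sup>+w. ennreal ((I w - J e w)\<^sup>2) \<partial>M) \<longlongrightarrow> 0) (at_right 0)"
    using I by (simp_all add: is_compensated_integral_def J_def)
  have [measurable]: "(\<lambda>w. jump_mass (mu w) S X ?U) \<in> borel_measurable M"
    using S X by (intro jump_mass_measurable) auto
  have Hm[measurable]: "H \<in> borel_measurable M" unfolding H_def[abs_def] by measurable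
  \<comment> \<open>Subtraction in \<open>ennreal\<close> is truncated, so \<open>g\<close> is the
    amount by which the absolute value of \<open>I\<close> exceeds \<open>H\<close>. It is at most
    the distance from \<open>I\<close> to any truncated integral, hence its mean square is
    0.\<close>
  define g where "g w = ennreal \<bar>I w\<bar> - H w" for w
  have gm[measurable]: "g \<in> borel_measurable M" unfolding g_def[abs_def] by measurable
  have gle: "(g w)\<^sup>2 \<le> ennreal ((I w - J e w)\<^sup>2)" for e w
  proof -
    have "ennreal \<bar>I w\<bar> \<le> ennreal (\<bar>J e w\<bar> + \<bar>I w - J e w\<bar>)" by (intro ennreal_leI) linarith
    also have "\<dots> \<le> H w + ennreal \<bar>I w - J e w\<bar>" using JH[of e w] by (simp add: add_right_mono)
    finally have "g w \<le> ennreal \<bar>I w - J e w\<bar>" unfolding g_def by (simp add: ennreal_minus_le_iff)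
    then have "(g w)\<^sup>2 \<le> (ennreal \<bar>I w - J e w\<bar>)\<^sup>2" by (intro power_mono) auto
    then show ?thesis by (simp add: ennreal_power)
  qed
  have "(\<integral>\<^sup>+w. (g w)\<^sup>2 \<partial>M) \<le> 0"
    by (rule tendsto_lowerbound[OF lim]) (auto intro!: always_eventually nn_integral_mono gle)
  then have "(\<integral>\<^sup>+w. (g w)\<^sup>2 \<partial>M) = 0" by simp
  then have "AE w in M. (g w)\<^sup>2 = 0" by (subst (asm) nn_integral_0_iff_AE) auto
  then have IH: "AE w in M. ennreal \<bar>I w\<bar> \<le> H w"
    by eventually_elim (simp add: g_def diff_eq_0_iff_ennreal)
  have large: "ennreal \<bar>LINT (t, x, z)|mu w. z * indicator ?B (t, x) * indicator ?V z\<bar> \<le> jump_mass (mu w) S X ?V" for w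
    by (rule order_trans[OF norm_integral_le]) (auto simp: jump_mass_def indicator_def intro!: nn_integral_mono)
  show ?thesis
    using LI IH AE_space
  proof eventually_elim
    case (elim w)
    have split: "jump_mass (mu w) S X ?U + jump_mass (mu w) S X ?V = jump_mass (mu w) S X UNIV"
    proof -
      show ?thesis
        unfolding jump_mass_def
      proof (subst nn_integral_add[symmetric])
        show "(\<lambda>p. indicator S (fst p) * indicator X (fst (snd p)) * indicator ?U (snd (snd p)) * ennreal \<bar>snd (snd p)\<bar>) \<in> borel_measurable (mu w)"
          "(\<lambda>p. indicator S (fst p) * indicator X (fst (snd p)) * indicator ?V (snd (snd p)) * ennreal \<bar>snd (snd p)\<bar>) \<in> borel_measurable (mu w)"
          by (intro jump_density_measurable[OF sets_lam sets_mu[OF elim(3)] S(1) X(1)]; simp)+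
      qed (auto intro!: nn_integral_cong simp: indicator_def)
    qed
    have "ennreal \<bar>L ?B w\<bar> \<le> ennreal (\<bar>b\<bar> * measure lborel ?B + \<bar>I w\<bar> + \<bar>LINT (t, x, z)|mu w. z * indicator ?B (t, x) * indicator ?V z\<bar>)"
    proof (rule ennreal_leI)
      have "\<bar>b * measure lborel ?B\<bar> = \<bar>b\<bar> * measure lborel ?B" by (simp add: abs_mult)
      then show "\<bar>L ?B w\<bar> \<le> \<bar>b\<bar> * measure lborel ?B + \<bar>I w\<bar> + \<bar>LINT (t, x, z)|mu w. z * indicator ?B (t, x) * indicator ?V z\<bar>"
        using elim(1) by linarith
    qed
    also have "\<dots> = ennreal (\<bar>b\<bar> * measure lborel ?B) + ennreal \<bar>I w\<bar> + ennreal \<bar>LINT (t, x, z)|mu w. z * indicator ?B (t, x) * indicator ?V z\<bar>"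
      by (simp add: ennreal_plus)
    also have "\<dots> \<le> ennreal (\<bar>b\<bar> * measure lborel ?B) + H w + jump_mass (mu w) S X ?V"
      by (intro add_mono order_refl elim(2) large)
    also have "\<dots> = (ennreal (\<bar>b\<bar> * measure lborel ?B) + ennreal (moment * measure lborel S * measure lborel X)) + jump_mass (mu w) S X UNIV"
      unfolding H_def split[symmetric] by (simp add: ac_simps)
    also have "ennreal (\<bar>b\<bar> * measure lborel ?B) + ennreal (moment * measure lborel S * measure lborel X) =
        ennreal ((\<bar>b\<bar> + moment) * measure lborel S * measure lborel X)"
      using moment(2) by (subst ennreal_plus[symmetric]) (auto simp: Bm algebra_simps)
    finally show ?case .
  qed
qed

end

text \<open>Here \<delta> separates the jumps larger than \<open>e\<close> from each other and from
  time 0. The intersection with \<open>{0<..}\<close> keeps the windows inside the space of the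
  random measure.\<close>

definition regular_jumps :: "(real \<times> real \<times> real) measure \<Rightarrow> real \<Rightarrow> real \<Rightarrow> real \<Rightarrow> real \<Rightarrow> bool" where
  "regular_jumps N T \<delta> \<eta> e \<longleftrightarrow>
     jump_mass N {0<..T} {0..1} {z. \<bar>z\<bar> \<le> e} \<le> ennreal \<eta> \<and>
     emeasure N ({0<..\<delta>} \<times> {0..1} \<times> {z. e < \<bar>z\<bar>}) = 0 \<and>
     (\<forall>x\<in>{0..T}. emeasure N (({x..x + \<delta>} \<inter> {0<..}) \<times> {0..1} \<times> {z. e < \<bar>z\<bar>}) \<le> 1)"

lemma sum_indicator_intervals:
  assumes "0 \<le> h" "i \<le> l"
  shows "(\<Sum>q\<in>{i..<l}. indicator {real q * h..<real (Suc q) * h} t) = (indicator {real i * h..<real l * h} t :: ennreal)"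
  using assms(2)
proof (induction rule: dec_induct)
  case (step l)
  have "real i * h \<le> real l * h" "real l * h \<le> real (Suc l) * h"
    using assms(1) step(1) by (auto intro!: mult_right_mono)
  then have "(indicator {real i * h..<real l * h} t :: ennreal) + indicator {real l * h..<real (Suc l) * h} t =
      indicator {real i * h..<real (Suc l) * h} t"
    by (auto simp: indicator_def)
  then show ?case using step by simp
qed simp

section \<open>Noise mass of grid cells and separation of large jumps\<close>

context finite_variation_noise
begin

lemma space_intensity: "space (intensity lam) = {0<..} \<times> {0..1} \<times> UNIV"
  by (simp add: intensity_def space_pair_measure space_restrict_space space_lam)

text \<open>The comparison of indicators is asked for at positive times, where the random measure
  lives: the first time cell contains 0, whereas the sets it is compared with do not.\<close>

lemma jump_mass_sum_le:
  assumes N: "sets N = sets (intensity lam)"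
    and SX: "\<And>q. q \<in> Q \<Longrightarrow> S q \<in> sets borel" "\<And>q. q \<in> Q \<Longrightarrow> X q \<in> sets borel" and Z: "Z \<in> sets borel"
    and le: "\<And>t x. 0 < t \<Longrightarrow> (\<Sum>q\<in>Q. indicator (S q) t * indicator (X q) x) \<le> (indicator S' t * indicator X' x :: ennreal)"
  shows "(\<Sum>q\<in>Q. jump_mass N (S q) (X q) Z) \<le> jump_mass N S' X' Z"
proof -
  let ?g = "\<lambda>p. indicator Z (snd (snd p)) * ennreal \<bar>snd (snd p)\<bar> :: ennreal"
  let ?f = "\<lambda>q p. indicator (S q) (fst p) * indicator (X q) (fst (snd p)) * indicator Z (snd (snd p)) *
      ennreal \<bar>snd (snd p)\<bar> :: ennreal"
  have f: "?f q \<in> borel_measurable N" if "q \<in> Q" for q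
    by (rule jump_density_measurable[OF sets_lam N SX(1)[OF that] SX(2)[OF that] Z])
  have "(\<Sum>q\<in>Q. jump_mass N (S q) (X q) Z) = (\<integral>\<^sup>+p. (\<Sum>q\<in>Q. ?f q p) \<partial>N)"
    unfolding jump_mass_def by (rule nn_integral_sum[of Q ?f N, OF f, symmetric])
  also have "\<dots> \<le> jump_mass N S' X' Z"
    unfolding jump_mass_def
  proof (rule nn_integral_mono)
    fix p assume "p \<in> space N"
    then have "p \<in> {0<..} \<times> {0..1} \<times> UNIV"
      unfolding sets_eq_imp_space_eq[OF N] space_intensity .
    then have "0 < fst p" by auto
    have "(\<Sum>q\<in>Q. ?f q p) = (\<Sum>q\<in>Q. indicator (S q) (fst p) * indicator (X q) (fst (snd p))) * ?g p"
      by (simp only: sum_distrib_right mult.assoc)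
    also have "\<dots> \<le> indicator S' (fst p) * indicator X' (fst (snd p)) * ?g p"
      by (rule mult_right_mono[OF le[OF \<open>0 < fst p\<close>]]) simp
    finally show "(\<Sum>q\<in>Q. ?f q p) \<le> indicator S' (fst p) * indicator X' (fst (snd p)) * indicator Z (snd (snd p)) *
        ennreal \<bar>snd (snd p)\<bar>" by (simp only: mult.assoc)
  qed
  finally show ?thesis .
qed

text \<open>Collects the almost sure noise bounds for one pair (n, \<tau>), whose cells are
  countable; the exceptional null set depends on the pair.\<close>

definition cells_bounded :: "'w \<Rightarrow> nat \<Rightarrow> real \<Rightarrow> bool" where
  "cells_bounded w n \<tau> \<longleftrightarrow> (\<forall>i. (\<Sum>j\<in>{0..<int n}. ennreal \<bar>L ({real i * \<tau>..<real (Suc i) * \<tau>} \<times>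
      {grid_point n j..<grid_point n (j + 1)}) w\<bar>) \<le>
    ennreal ((\<bar>b\<bar> + moment) * \<tau>) + jump_mass (mu w) {real i * \<tau>..<real (Suc i) * \<tau>} {0..1} UNIV)"

text \<open>A time slab is split into \<open>n\<close> cells of width 1 / n, so the drift terms add
  up to a bound free of \<open>n\<close>, and disjointness lets the jump masses add up to that of
  the slab.\<close>

lemma cell_noise_bound:
  assumes \<tau>: "0 < \<tau>" and n: "0 < n"
  shows "AE w in M. cells_bounded w n \<tau>"
proof -
  let ?S = "\<lambda>i. {real i * \<tau>..<real (Suc i) * \<tau>}" and ?X = "\<lambda>j. {grid_point n j..<grid_point n (j + 1)}"
  have mS: "measure lborel (?S i) = \<tau>" "emeasure lborel (?S i) < \<infinity>" for i
    using \<tau> by (auto simp: algebra_simps)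
  have mX: "measure lborel (?X j) = 1 / n" for j
    using n by (simp add: grid_point_def divide_right_mono diff_divide_distrib[symmetric])
  have sub: "?S i \<subseteq> {0..}" "j \<in> {0..<int n} \<Longrightarrow> ?X j \<subseteq> {0..1}" for i j
  proof -
    show "?S i \<subseteq> {0..}" using \<tau> by (auto intro: order_trans[rotated])
    assume j: "j \<in> {0..<int n}"
    have "0 \<le> grid_point n j" using j by (simp add: grid_point_def)
    moreover have "real_of_int (j + 1) \<le> real n" using j by simp
    then have "grid_point n (j + 1) \<le> 1" using n by (simp add: grid_point_def)
    ultimately show "?X j \<subseteq> {0..1}" by auto
  qed
  have "AE w in M. \<forall>i. \<forall>j\<in>{0..<int n}. ennreal \<bar>L (?S i \<times> ?X j) w\<bar> \<le>
    ennreal ((\<bar>b\<bar> + moment) * measure lborel (?S i) * measure lborel (?X j)) + jump_mass (mu w) (?S i) (?X j) UNIV"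
    unfolding AE_all_countable
    by (intro allI AE_finite_allI noise_bound sub mS) auto
  then show ?thesis
    using AE_space
  proof eventually_elim
    case (elim w)
    show ?case
      unfolding cells_bounded_def
    proof
      fix i
      have "(\<Sum>j\<in>{0..<int n}. ennreal \<bar>L (?S i \<times> ?X j) w\<bar>) \<le>
          (\<Sum>j\<in>{0..<int n}. ennreal ((\<bar>b\<bar> + moment) * \<tau> * (1 / n)) + jump_mass (mu w) (?S i) (?X j) UNIV)"
        using elim(1) by (intro sum_mono) (simp only: mS mX)
      also have "\<dots> = (\<Sum>j\<in>{0..<int n}. ennreal ((\<bar>b\<bar> + moment) * \<tau> * (1 / n))) +
          (\<Sum>j\<in>{0..<int n}. jump_mass (mu w) (?S i) (?X j) UNIV)" by (rule sum.distrib)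
      also have "(\<Sum>j\<in>{0..<int n}. ennreal ((\<bar>b\<bar> + moment) * \<tau> * (1 / n))) = ennreal ((\<bar>b\<bar> + moment) * \<tau>)"
        using n moment(2) \<tau> by (simp add: ennreal_of_nat_eq_real_of_nat ennreal_mult[symmetric])
      also have "(\<Sum>j\<in>{0..<int n}. jump_mass (mu w) (?S i) (?X j) UNIV) \<le> jump_mass (mu w) (?S i) {0..1} UNIV"
      proof (rule jump_mass_sum_le[OF sets_mu[OF elim(2)]])
        fix t x :: real
        have "(\<Sum>j\<in>{0..<int n}. indicator (?X j) x :: ennreal) = (\<Sum>j\<in>{0..<n}. indicator {real j * (1 / n)..<real (Suc j) * (1 / n)} x)"
          using sum.atLeast_int_lessThan_int_shift[of "\<lambda>j. indicator (?X j) x :: ennreal" 0 n]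
          by (simp add: grid_point_def o_def add.commute)
        also have "\<dots> = indicator {real 0 * (1 / n)..<real n * (1 / n)} x" by (rule sum_indicator_intervals) auto
        also have "\<dots> \<le> indicator {0..1} x" using n by (auto simp: indicator_def)
        finally show "(\<Sum>j\<in>{0..<int n}. indicator (?S i) t * indicator (?X j) x) \<le> (indicator (?S i) t * indicator {0..1} x :: ennreal)"
          unfolding sum_distrib_left[symmetric] by (rule mult_left_mono) auto
      qed auto
      finally show "(\<Sum>j\<in>{0..<int n}. ennreal \<bar>L (?S i \<times> ?X j) w\<bar>) \<le>
          ennreal ((\<bar>b\<bar> + moment) * \<tau>) + jump_mass (mu w) (?S i) {0..1} UNIV" by (simp add: add_left_mono)
    qed
  qed
qed

lemma markov:
  assumes [measurable]: "X \<in> borel_measurable M" and m: "(\<integral>\<^sup>+w. X w \<partial>M) \<le> ennreal m" "0 \<le> m" and a: "0 < a"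
  shows "prob {w \<in> space M. \<not> X w \<le> ennreal a} \<le> m / a"
proof -
  have "emeasure M {w \<in> space M. \<not> X w \<le> ennreal a} \<le> emeasure M {w \<in> space M. 1 \<le> ennreal (1 / a) * X w}"
  proof (rule emeasure_mono)
    show "{w \<in> space M. \<not> X w \<le> ennreal a} \<subseteq> {w \<in> space M. 1 \<le> ennreal (1 / a) * X w}"
    proof safe
      fix w assume "\<not> X w \<le> ennreal a"
      then have "ennreal (1 / a) * ennreal a \<le> ennreal (1 / a) * X w" by (intro mult_left_mono) auto
      then show "1 \<le> ennreal (1 / a) * X w" using a by (simp add: ennreal_mult[symmetric])
    qed
  qed measurable
  also have "\<dots> \<le> ennreal (1 / a) * (\<integral>\<^sup>+w. X w * indicator (space M) w \<partial>M)"
    by (rule nn_integral_Markov_inequality) auto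
  also have "(\<integral>\<^sup>+w. X w * indicator (space M) w \<partial>M) = (\<integral>\<^sup>+w. X w \<partial>M)" by (intro nn_integral_cong) auto
  also have "ennreal (1 / a) * (\<integral>\<^sup>+w. X w \<partial>M) \<le> ennreal (1 / a) * ennreal m" using m by (intro mult_left_mono) auto
  also have "\<dots> = ennreal (m / a)" using a m by (simp add: ennreal_mult[symmetric])
  finally show ?thesis using a m by (simp add: emeasure_eq_measure)
qed

lemma total_mass_tight:
  assumes T: "0 < T" and \<epsilon>: "0 < \<epsilon>"
  shows "\<exists>A>0. prob {w \<in> space M. \<not> jump_mass (mu w) {0<..T} {0..1} UNIV \<le> ennreal A} \<le> \<epsilon>"
proof -
  \<comment> \<open>The added 1 keeps \<open>A\<close> positive even if the first moment
    vanishes.\<close>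
  define A where "A = (T * moment + 1) / \<epsilon>"
  have A: "0 < A" using T \<epsilon> moment(2) by (simp add: A_def add_nonneg_pos)
  have "prob {w \<in> space M. \<not> jump_mass (mu w) {0<..T} {0..1} UNIV \<le> ennreal A} \<le> (T * moment) / A"
  proof (rule markov)
    have "(\<integral>\<^sup>+w. jump_mass (mu w) {0<..T} {0..1} UNIV \<partial>M) = ennreal (T * moment)"
      using T moment by (subst mean_jump_mass) (auto simp: ennreal_mult)
    then show "(\<integral>\<^sup>+w. jump_mass (mu w) {0<..T} {0..1} UNIV \<partial>M) \<le> ennreal (T * moment)" by simp
  qed (use T A moment in \<open>auto intro!: jump_mass_measurable\<close>)
  also have "\<dots> \<le> \<epsilon>"
  proof -
    have "T * moment \<le> \<epsilon> * A" using \<epsilon> by (simp add: A_def)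
    then show ?thesis using A by (simp add: divide_le_eq)
  qed
  finally show ?thesis using A by blast
qed

text \<open>Dominated convergence with the first moment as bound: the integrand tends to 0
  everywhere, including at the origin.\<close>

lemma small_jumps:
  assumes "0 < \<epsilon>"
  shows "\<exists>e>0. (\<integral>\<^sup>+z. indicator {z. \<bar>z\<bar> \<le> e} z * ennreal \<bar>z\<bar> \<partial>lam) \<le> ennreal \<epsilon>"
proof -
  let ?f = "\<lambda>n z. indicator {z. \<bar>z\<bar> \<le> 1 / real (Suc n)} z * ennreal \<bar>z\<bar>"
  have "(\<lambda>n. \<integral>\<^sup>+z. ?f n z \<partial>lam) \<longlonglongrightarrow> (\<integral>\<^sup>+z. 0 \<partial>lam)"
  proof (rule nn_integral_dominated_convergence[where w = "\<lambda>z. ennreal \<bar>z\<bar>"])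
    show "AE z in lam. ?f n z \<le> ennreal \<bar>z\<bar>" for n by (auto simp: indicator_def)
    show "AE z in lam. (\<lambda>n. ?f n z) \<longlonglongrightarrow> 0"
    proof (rule AE_I2)
      fix z :: real
      show "(\<lambda>n. ?f n z) \<longlonglongrightarrow> 0"
      proof (cases "z = 0")
        case False
        obtain N where N: "1 / real (Suc N) < \<bar>z\<bar>" using False nat_approx_posE[of "\<bar>z\<bar>"] by (metis zero_less_abs_iff)
        have "?f n z = 0" if "n \<ge> N" for n
        proof -
          have "1 / real (Suc n) \<le> 1 / real (Suc N)" using that by (intro divide_left_mono) auto
          then show ?thesis using N by (simp add: indicator_def)
        qed
        then show ?thesis by (intro tendsto_eventually) (auto simp: eventually_sequentially)
      qed (simp add: indicator_def)
    qed
    show "(\<integral>\<^sup>+z. ennreal \<bar>z\<bar> \<partial>lam) < \<infinity>" by (rule first_moment)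
    show "?f n \<in> borel_measurable lam" for n by measurable
  qed auto
  then have "(\<lambda>n. \<integral>\<^sup>+z. ?f n z \<partial>lam) \<longlonglongrightarrow> 0" by simp
  then have "eventually (\<lambda>n. (\<integral>\<^sup>+z. ?f n z \<partial>lam) < ennreal \<epsilon>) sequentially"
    using assms by (intro order_tendstoD(2)) auto
  then obtain n where "(\<integral>\<^sup>+z. ?f n z \<partial>lam) < ennreal \<epsilon>" by (auto simp: eventually_sequentially)
  then show ?thesis by (intro exI[of _ "1 / real (Suc n)"]) (auto intro: less_imp_le)
qed

text \<open>An interval of length \<delta> is contained in one of the windows of length 2\<delta>
  that start at multiples of \<delta>. There are at most T / \<delta> + 1 such windows, each holding
  two large jumps with probability of order \<open>\<delta>\<^sup>2\<close>, so the union bound is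
  of order \<delta>.\<close>

lemma regular_jumps_likely:
  assumes T: "0 < T" and \<eta>: "0 < \<eta>" and \<epsilon>: "0 < \<epsilon>" and \<delta>0: "0 < \<delta>0"
  shows "\<exists>\<delta> e. 0 < \<delta> \<and> \<delta> \<le> \<delta>0 \<and> 0 < e \<and>
    (\<exists>B\<in>sets M. prob B \<le> \<epsilon> \<and> (\<forall>w\<in>space M - B. regular_jumps (mu w) T \<delta> \<eta> e))"
proof -
  \<comment> \<open>With this bound Markov's inequality yields \<epsilon> / 4 for the small jumps.
    The threshold \<open>e\<close> is fixed before \<delta>, because the rate \<Lambda> of the large
    jumps depends on it.\<close>
  obtain e where e: "0 < e" "(\<integral>\<^sup>+z. indicator {z. \<bar>z\<bar> \<le> e} z * ennreal \<bar>z\<bar> \<partial>lam) \<le> ennreal (\<eta> * \<epsilon> / (4 * T))"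
    using small_jumps[of "\<eta> * \<epsilon> / (4 * T)"] T \<eta> \<epsilon> by auto
  let ?Z = "{z::real. e < \<bar>z\<bar>}"
  define \<Lambda> where "\<Lambda> = measure lam ?Z"
  have \<Lambda>: "emeasure lam ?Z = ennreal \<Lambda>" "0 \<le> \<Lambda>"
    using tail_finite[OF e(1)] by (simp_all add: \<Lambda>_def emeasure_eq_ennreal_measure less_top)
  \<comment> \<open>The coefficient of \<delta> in the union bound, \<Lambda> for the initial window
    and the first summand for the others; the 1 ensures positivity.\<close>
  define R where "R = 4 * \<Lambda>\<^sup>2 * (T + 1) + \<Lambda> + 1"
  have R: "1 \<le> R" using T \<Lambda> by (simp add: R_def)
  define \<delta> where "\<delta> = min (min \<delta>0 1) (\<epsilon> / (4 * R))"
  have \<delta>: "0 < \<delta>" "\<delta> \<le> \<delta>0" "\<delta> \<le> 1" "\<delta> \<le> \<epsilon> / (4 * R)" using \<delta>0 \<epsilon> R by (auto simp: \<delta>_def)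
  have \<delta>R: "\<delta> * R \<le> \<epsilon> / 4" using \<delta>(4) R by (simp add: field_simps)
  define K where "K = nat \<lfloor>T / \<delta>\<rfloor>"
  have K: "real K \<le> T / \<delta>" using T \<delta> by (simp add: K_def)
  let ?A = "\<lambda>S. S \<times> {0..1::real} \<times> ?Z"
  have A: "?A S \<in> sets (intensity lam)" "emeasure (intensity lam) (?A S) = emeasure lborel S * ennreal \<Lambda>"
    if "S \<in> sets borel" "S \<subseteq> {0<..}" for S
    using emeasure_intensity[OF that, of "{0..1}" ?Z] by (auto simp: \<Lambda>)
  define W where "W k = {real k * \<delta>..real k * \<delta> + 2 * \<delta>} \<inter> {0<..}" for k :: nat
  have W: "W k \<in> sets borel" "W k \<subseteq> {0<..}" for k by (auto simp: W_def)
  have eW: "emeasure lborel (W k) \<le> ennreal (2 * \<delta>)" for k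
  proof -
    have "emeasure lborel (W k) \<le> emeasure lborel {real k * \<delta>..real k * \<delta> + 2 * \<delta>}"
      by (rule emeasure_mono) (auto simp: W_def)
    then show ?thesis using \<delta> by simp
  qed
  define B1 where "B1 = {w \<in> space M. \<not> jump_mass (mu w) {0<..T} {0..1} {z. \<bar>z\<bar> \<le> e} \<le> ennreal \<eta>}"
  define B2 where "B2 = {w \<in> space M. emeasure (mu w) (?A {0<..\<delta>}) \<noteq> 0}"
  define B3 where "B3 k = {w \<in> space M. \<not> emeasure (mu w) (?A (W k)) \<le> 1}" for k
  have [measurable]: "(\<lambda>w. jump_mass (mu w) {0<..T} {0..1} {z. \<bar>z\<bar> \<le> e}) \<in> borel_measurable M"
    by (intro jump_mass_measurable) auto
  have [measurable]: "(\<lambda>w. emeasure (mu w) (?A {0<..\<delta>})) \<in> borel_measurable M"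
    by (intro emeasure_mu_measurable A) auto
  have [measurable]: "(\<lambda>w. emeasure (mu w) (?A (W k))) \<in> borel_measurable M" for k
    by (intro emeasure_mu_measurable A W)
  have [measurable]: "B1 \<in> sets M" "B2 \<in> sets M" "B3 k \<in> sets M" for k
    unfolding B1_def B2_def B3_def by measurable
  have "prob B1 \<le> (\<eta> * \<epsilon> / 4) / \<eta>"
    unfolding B1_def
  proof (rule markov)
    have "(\<integral>\<^sup>+w. jump_mass (mu w) {0<..T} {0..1} {z. \<bar>z\<bar> \<le> e} \<partial>M) =
        ennreal T * (\<integral>\<^sup>+z. indicator {z. \<bar>z\<bar> \<le> e} z * ennreal \<bar>z\<bar> \<partial>lam)"
      using T by (subst mean_jump_mass) auto
    also have "\<dots> \<le> ennreal T * ennreal (\<eta> * \<epsilon> / (4 * T))" using e by (intro mult_left_mono) auto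
    also have "\<dots> = ennreal (\<eta> * \<epsilon> / 4)" using T \<eta> \<epsilon> by (simp add: ennreal_mult[symmetric])
    finally show "(\<integral>\<^sup>+w. jump_mass (mu w) {0<..T} {0..1} {z. \<bar>z\<bar> \<le> e} \<partial>M) \<le> ennreal (\<eta> * \<epsilon> / 4)" .
  qed (use \<eta> \<epsilon> in auto)
  then have p1: "prob B1 \<le> \<epsilon> / 4" using \<eta> by simp
  have p2: "prob B2 \<le> \<delta> * \<Lambda>"
    unfolding B2_def
  proof (rule prob_jump(1))
    have "{0<..\<delta>} \<subseteq> {0<..}" by auto
    then show "?A {0<..\<delta>} \<in> sets (intensity lam)" "emeasure (intensity lam) (?A {0<..\<delta>}) \<le> ennreal (\<delta> * \<Lambda>)"
      using A[of "{0<..\<delta>}"] \<delta>(1) \<Lambda>(2) by (simp_all add: ennreal_mult)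
  qed (use \<delta> \<Lambda> in auto)
  have p3: "prob (B3 k) \<le> (2 * \<delta> * \<Lambda>)\<^sup>2" for k
    unfolding B3_def
  proof (rule prob_jump(2))
    have "emeasure (intensity lam) (?A (W k)) \<le> ennreal (2 * \<delta>) * ennreal \<Lambda>"
      unfolding A(2)[OF W] by (intro mult_right_mono eW) auto
    then show "emeasure (intensity lam) (?A (W k)) \<le> ennreal (2 * \<delta> * \<Lambda>)" using \<delta> \<Lambda> by (simp add: ennreal_mult)
  qed (use \<delta> \<Lambda> A W in auto)
  define B where "B = B1 \<union> B2 \<union> (\<Union>k\<le>K. B3 k)"
  have [measurable]: "B \<in> sets M" unfolding B_def by measurable
  have "prob B \<le> prob (B1 \<union> B2) + prob (\<Union>k\<le>K. B3 k)" unfolding B_def by (intro measure_Un_le) measurable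
  also have "prob (B1 \<union> B2) \<le> prob B1 + prob B2" by (intro measure_Un_le) measurable
  also have "prob (\<Union>k\<le>K. B3 k) \<le> (\<Sum>k\<le>K. prob (B3 k))" by (intro finite_measure_subadditive_finite) auto
  also have "\<dots> \<le> (\<Sum>k\<le>K. (2 * \<delta> * \<Lambda>)\<^sup>2)" by (intro sum_mono p3)
  also have "\<dots> = (real K + 1) * (2 * \<delta> * \<Lambda>)\<^sup>2" by (simp add: add.commute)
  also have "\<dots> \<le> (T / \<delta> + 1) * (2 * \<delta> * \<Lambda>)\<^sup>2" using K by (intro mult_right_mono) auto
  also have "\<dots> = 4 * \<delta> * \<Lambda>\<^sup>2 * (T + \<delta>)" using \<delta>(1) by (simp add: field_simps power2_eq_square)
  also have "\<dots> \<le> 4 * \<delta> * \<Lambda>\<^sup>2 * (T + 1)" using \<delta> by (intro mult_left_mono) auto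
  finally have "prob B \<le> \<epsilon> / 4 + \<delta> * \<Lambda> + 4 * \<delta> * \<Lambda>\<^sup>2 * (T + 1)" using p1 p2 by linarith
  also have "\<dots> = \<epsilon> / 4 + \<delta> * R - \<delta>" by (simp add: R_def algebra_simps)
  also have "\<dots> \<le> \<epsilon>" using \<delta>R \<delta>(1) \<epsilon> by linarith
  finally have pB: "prob B \<le> \<epsilon>" .
  have "regular_jumps (mu w) T \<delta> \<eta> e" if w: "w \<in> space M - B" for w
    unfolding regular_jumps_def
  proof (intro conjI ballI)
    show "jump_mass (mu w) {0<..T} {0..1} {z. \<bar>z\<bar> \<le> e} \<le> ennreal \<eta>" using w by (auto simp: B_def B1_def)
    show "emeasure (mu w) ({0<..\<delta>} \<times> {0..1} \<times> {z. e < \<bar>z\<bar>}) = 0" using w by (auto simp: B_def B2_def)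
    fix x assume x: "x \<in> {0..T}"
    define k where "k = nat \<lfloor>x / \<delta>\<rfloor>"
    have "real k \<le> x / \<delta>" "x / \<delta> < real k + 1" using x \<delta> by (auto simp: k_def)
    then have k: "real k * \<delta> \<le> x" "x < real k * \<delta> + \<delta>" using \<delta> by (simp_all add: field_simps)
    have "k \<le> K" unfolding k_def K_def using x \<delta> by (intro nat_mono floor_mono divide_right_mono) auto
    then have "emeasure (mu w) (?A (W k)) \<le> 1" using w by (auto simp: B_def B3_def)
    moreover have "emeasure (mu w) (?A ({x..x + \<delta>} \<inter> {0<..})) \<le> emeasure (mu w) (?A (W k))"
      using k A(1)[OF W] sets_mu[of w] w by (intro emeasure_mono) (auto simp: W_def)
    ultimately show "emeasure (mu w) (({x..x + \<delta>} \<inter> {0<..}) \<times> {0..1} \<times> {z. e < \<bar>z\<bar>}) \<le> 1" by simp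
  qed
  with \<delta>(1,2) e(1) pB show ?thesis by (intro exI[of _ \<delta>] exI[of _ e] conjI bexI[of _ B]) auto
qed

end

section \<open>Fourier analysis of the scheme\<close>

definition cell :: "nat \<Rightarrow> real \<Rightarrow> nat \<Rightarrow> int \<Rightarrow> (real \<times> real) set" where
  "cell n \<tau> i j = {of_nat i * \<tau>..<of_nat (Suc i) * \<tau>} \<times> {grid_point n j..<grid_point n (j + 1)}"

text \<open>The n-th root of unity by which the k-th mode is seen on the grid. It depends on
  \<open>k\<close> only modulo \<open>n\<close>, so high modes are aliased.\<close>

definition fourier_root :: "nat \<Rightarrow> int \<Rightarrow> complex" where
  "fourier_root n k = exp (- (2 * of_real pi * \<i> * of_int k / of_nat n))"

lemma norm_exp_fourier: "cmod (exp (- (2 * of_real pi * \<i> * of_int k * of_real y))) = 1"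
  by (simp add: norm_exp_eq_Re)

lemma fourier_root_power: "0 < n \<Longrightarrow> fourier_root n k ^ j = exp (- (2 * of_real pi * \<i> * of_int k * of_real (real j / real n)))"
  unfolding fourier_root_def exp_of_nat_mult[symmetric] by (rule arg_cong[of _ _ exp]) (simp add: field_simps)

lemma fourier_root_power_n: "0 < n \<Longrightarrow> fourier_root n k ^ n = 1"
proof -
  assume n: "0 < n"
  have "exp (2 * of_real pi * \<i> * of_int k :: complex) = 1"
    using exp_integer_2pi[of "of_int k"] by (simp add: mult_ac)
  then show ?thesis using n unfolding fourier_root_power[OF n] by (simp add: exp_minus)
qed

lemma norm_fourier_root: "cmod (fourier_root n k) = 1"
  unfolding fourier_root_def by (simp add: norm_exp_eq_Re)

text \<open>For \<open>z\<close> on the unit circle this is the Fourier symbol (eigenvalue) of minus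
  the discrete Laplacian.\<close>

definition symbol :: "nat \<Rightarrow> complex \<Rightarrow> real" where
  "symbol n z = (real n)\<^sup>2 * (2 - 2 * Re z)"

lemma symbol_nonneg: "cmod z = 1 \<Longrightarrow> 0 \<le> symbol n z"
  using complex_Re_le_cmod[of z] by (simp add: symbol_def)

lemma symbol_le: "cmod z = 1 \<Longrightarrow> symbol n z \<le> 4 * (real n)\<^sup>2"
  using abs_Re_le_cmod[of z] mult_left_mono[of "2 - 2 * Re z" 4 "(real n)\<^sup>2"]
  by (simp add: symbol_def abs_le_iff mult.commute)

text \<open>The discrete eigenvalue never exceeds the continuous one, by the double angle formula
  and \<bar>sin x\<bar> \<le> \<bar>x\<bar>. The bound is free of \<open>n\<close>, so a fixed mode
  moves slowly uniformly in the grid.\<close>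

lemma symbol_fourier_root: "0 < n \<Longrightarrow> symbol n (fourier_root n k) \<le> 4 * pi\<^sup>2 * (real_of_int k)\<^sup>2"
proof -
  assume n: "0 < n"
  define x where "x = pi * real_of_int k / real n"
  have "fourier_root n k = exp (\<i> * of_real (- 2 * x))"
    unfolding fourier_root_def by (rule arg_cong[of _ _ exp]) (simp add: x_def field_simps)
  then have "Re (fourier_root n k) = cos (2 * x)" by (simp add: exp_eq_polar cis.code Re_exp)
  also have "\<dots> = 1 - 2 * (sin x)\<^sup>2" by (rule cos_double_sin)
  finally have Re: "Re (fourier_root n k) = 1 - 2 * (sin x)\<^sup>2" .
  have "symbol n (fourier_root n k) = 4 * (real n)\<^sup>2 * (sin x)\<^sup>2"
    unfolding symbol_def Re by (simp add: algebra_simps)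
  also have "\<dots> \<le> 4 * (real n)\<^sup>2 * x\<^sup>2"
    using abs_sin_x_le_abs_x[of x] by (intro mult_left_mono) (auto simp: abs_le_square_iff)
  also have "\<dots> = 4 * pi\<^sup>2 * (real_of_int k)\<^sup>2" using n by (simp add: x_def power_mult_distrib power_divide)
  finally show ?thesis .
qed

lemma fourier_root_orthogonal:
  assumes n: "0 < n" and l: "l < n" and j: "j < n"
  shows "(\<Sum>k<n. fourier_root n (int k) ^ l * cnj (fourier_root n (int k)) ^ j) = (if l = j then of_nat n else 0)"
proof -
  define x where "x = exp (- (2 * of_real pi * \<i> * of_real ((real l - real j) / real n)))"
  have term_eq: "fourier_root n (int k) ^ l * cnj (fourier_root n (int k)) ^ j = x ^ k" for k
  proof -
    have "cnj (fourier_root n (int k)) ^ j = cnj (fourier_root n (int k) ^ j)" by simp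
    also have "\<dots> = exp (2 * of_real pi * \<i> * of_int (int k) * of_real (real j / real n))"
      unfolding fourier_root_power[OF n] by (simp add: exp_cnj)
    finally show ?thesis
      unfolding fourier_root_power[OF n] x_def exp_of_nat_mult[symmetric]
      by (simp only: exp_add[symmetric])
        (rule arg_cong[of _ _ exp], simp add: algebra_simps diff_divide_distrib)
  qed
  have "(\<Sum>k<n. fourier_root n (int k) ^ l * cnj (fourier_root n (int k)) ^ j) = (\<Sum>k<n. x ^ k)"
    by (simp only: term_eq)
  also have "\<dots> = (if l = j then of_nat n else 0)"
  proof (cases "l = j")
    case True
    then have "x = 1" by (simp add: x_def)
    with True show ?thesis by simp
  next
    case False
    have xn: "x ^ n = 1"
    proof -
      have "x ^ n = exp (2 * of_real pi * \<i> * of_int (int j - int l))"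
        unfolding x_def exp_of_nat_mult[symmetric]
        by (rule arg_cong[of _ _ exp]) (use n in \<open>simp add: field_simps\<close>)
      then show ?thesis using exp_integer_2pi[of "of_int (int j - int l)"] by (simp add: mult_ac)
    qed
    \<comment> \<open>Otherwise \<open>n\<close> would divide the nonzero difference of two indices
      below \<open>n\<close>.\<close>
    have "x \<noteq> 1"
    proof
      assume "x = 1"
      then obtain m :: int where "- (2 * pi * ((real l - real j) / real n)) = of_int (2 * m) * pi"
        unfolding x_def exp_eq_1 by auto
      then have "pi * (2 * ((real j - real l) / real n)) = pi * (2 * of_int m)"
        by (simp add: algebra_simps diff_divide_distrib)
      then have "(real j - real l) / real n = of_int m" using pi_neq_zero by (simp only: mult_cancel_left) simp
      then have "real j - real l = of_int m * real n" using n by (simp add: field_simps)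
      then have "real_of_int (int j - int l) = real_of_int (m * int n)" by simp
      then have eq: "int j - int l = m * int n" by (simp only: of_int_eq_iff)
      then have "m \<noteq> 0" using False by auto
      then have "1 \<le> \<bar>m\<bar>" by linarith
      then have "int n \<le> \<bar>m * int n\<bar>" using mult_right_mono[of 1 "\<bar>m\<bar>" "int n"] by (simp add: abs_mult)
      then show False using eq l j by linarith
    qed
    then have "(\<Sum>k<n. x ^ k) = 0" using xn by (simp add: geometric_sum)
    with False show ?thesis by simp
  qed
  finally show ?thesis .
qed

lemma sum_lessThan_shift_cyclic:
  fixes f :: "nat \<Rightarrow> complex"
  assumes "f n = f 0"
  shows "(\<Sum>j<n. f (Suc j)) = (\<Sum>j<n. f j)"
  using sum.lessThan_Suc_shift[of f n] sum.lessThan_Suc[of f n] assms by simp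

text \<open>The mean of the k-th exponential over one grid cell: the factor between the Fourier
  coefficient of a piecewise constant function and its discrete transform.\<close>

definition cell_average :: "nat \<Rightarrow> int \<Rightarrow> complex" where
  "cell_average n k = of_nat n *
     (LINT y|lborel. indicator {0..<1 / real n} y *\<^sub>R exp (- (2 * of_real pi * \<i> * of_int k * of_real y)))"

lemma integrable_fourier:
  "integrable lborel (\<lambda>y. indicator {a..<b} y *\<^sub>R exp (- (2 * of_real pi * \<i> * of_int k * of_real y)) :: complex)"
proof (rule Bochner_Integration.integrable_bound[of lborel "indicator {a..<b} :: real \<Rightarrow> real"])
  show "integrable lborel (indicator {a..<b} :: real \<Rightarrow> real)" by (cases "a \<le> b") auto
qed (auto simp: norm_exp_fourier)

lemma norm_cell_average: "0 < n \<Longrightarrow> cmod (cell_average n k) \<le> 1"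
proof -
  assume n: "0 < n"
  let ?f = "\<lambda>y. indicator {0..<1 / real n} y *\<^sub>R exp (- (2 * of_real pi * \<i> * of_int k * of_real y)) :: complex"
  have "cmod (LINT y|lborel. ?f y) \<le> (LINT y|lborel. cmod (?f y))" by (rule integral_norm_bound)
  also have "\<dots> = (LINT y|lborel. indicator {0..<1 / real n} y)" by (simp add: norm_exp_fourier)
  also have "\<dots> = 1 / real n" by simp
  finally show ?thesis using n unfolding cell_average_def norm_mult by (simp add: field_simps)
qed

lemma cell_average_shift:
  assumes n: "0 < n"
  shows "(LINT y|lborel. indicator {real j / n..<real (Suc j) / n} y *\<^sub>R exp (- (2 * of_real pi * \<i> * of_int k * of_real y)))
    = fourier_root n k ^ j * cell_average n k / of_nat n"
proof -
  let ?e = "\<lambda>y. exp (- (2 * of_real pi * \<i> * of_int k * of_real y)) :: complex"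
  have "(LINT y|lborel. indicator {real j / n..<real (Suc j) / n} y *\<^sub>R ?e y) =
      \<bar>1\<bar> *\<^sub>R (LINT y|lborel. indicator {real j / n..<real (Suc j) / n} (real j / n + 1 * y) *\<^sub>R ?e (real j / n + 1 * y))"
    by (rule lborel_integral_real_affine) simp
  also have "\<dots> = (LINT y|lborel. fourier_root n k ^ j * (indicator {0..<1 / real n} y *\<^sub>R ?e y))"
  proof -
    have "indicator {real j / n..<real (Suc j) / n} (real j / n + 1 * y) *\<^sub>R ?e (real j / n + 1 * y) =
        fourier_root n k ^ j * (indicator {0..<1 / real n} y *\<^sub>R ?e y)" for y
    proof -
      have "real (Suc j) / n = real j / n + 1 / n" by (simp add: add_divide_distrib)
      then have "indicator {real j / n..<real (Suc j) / n} (real j / n + 1 * y) = (indicator {0..<1 / real n} y :: real)"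
        by (auto simp: indicator_def)
      moreover have "?e (real j / n + 1 * y) = fourier_root n k ^ j * ?e y"
        unfolding fourier_root_power[OF n] exp_add[symmetric] by (rule arg_cong[of _ _ exp]) (simp add: algebra_simps)
      ultimately show ?thesis by simp
    qed
    then show ?thesis by simp
  qed
  also have "\<dots> = fourier_root n k ^ j * (LINT y|lborel. indicator {0..<1 / real n} y *\<^sub>R ?e y)"
    by (rule integral_mult_right_zero)
  finally show ?thesis using n by (simp add: cell_average_def)
qed

section \<open>The scheme along one noise realization, in Fourier space\<close>

locale scheme_path =
  fixes \<theta> :: real and \<sigma> u0 :: "real \<Rightarrow> real" and n :: nat and \<tau> :: real
    and N :: "(real \<times> real) set \<Rightarrow> real" and u :: "real \<Rightarrow> real \<Rightarrow> real" and \<rho> \<epsilon> :: real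
  assumes scheme: "fully_discrete_scheme \<theta> \<sigma> u0 n \<tau> N u"
    and adm: "(n, \<tau>) \<in> admissible \<theta> \<rho> \<epsilon>" and \<theta>: "0 \<le> \<theta>" "\<theta> \<le> 1"
begin

lemma n: "0 < n" and \<tau>: "0 < \<tau>"
  using adm by (auto simp: admissible_def)

definition X :: "nat \<Rightarrow> int \<Rightarrow> real" where "X i j = u (of_nat i * \<tau>) (grid_point n j)"

definition V :: "nat \<Rightarrow> real" where "V i = (\<Sum>j\<in>{0..<int n}. \<bar>N (cell n \<tau> i j)\<bar>)"

definition coef :: "nat \<Rightarrow> complex \<Rightarrow> complex" where
  "coef i z = (\<Sum>j<n. of_real (X i (int j)) * z ^ j) / of_nat n"

text \<open>There is no division by \<open>n\<close>, in contrast to \<open>coef\<close>: it cancels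
  against the factor \<open>n\<close> of the noise term.\<close>

definition force :: "nat \<Rightarrow> complex \<Rightarrow> complex" where
  "force i z = (\<Sum>j<n. of_real (\<sigma> (X i (int j)) * N (cell n \<tau> i (int j))) * z ^ j)"

lemma X_0: "j \<in> {0..<int n} \<Longrightarrow> X 0 j = u0 (grid_point n j)"
  using scheme by (simp add: fully_discrete_scheme_def X_def)

lemma X_wrap: "X i (int n) = X i 0" "X i (- 1) = X i (int n - 1)"
  using scheme n by (auto simp: fully_discrete_scheme_def X_def grid_point_def)

definition lapl :: "nat \<Rightarrow> int \<Rightarrow> real" where
  "lapl i j = (real n)\<^sup>2 * (X i (j + 1) - 2 * X i j + X i (j - 1))"

lemma X_Suc:
  "j \<in> {0..<int n} \<Longrightarrow> X (Suc i) j = X i j + (1 - \<theta>) * \<tau> * lapl i j + \<theta> * \<tau> * lapl (Suc i) j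
      + real n * (\<sigma> (X i j) * N (cell n \<tau> i j))"
  using scheme unfolding fully_discrete_scheme_def X_def lapl_def discrete_laplacian_def cell_def
  by (simp add: mult.assoc)

text \<open>Periodicity of the grid values and \<open>z ^ n = 1\<close> permit cyclic shifts of the
  sum, and for \<bar>z\<bar> = 1 the two neighbours contribute the conjugate of \<open>z\<close> and
  \<open>z\<close> as factors.\<close>

lemma lapl_coef:
  assumes z: "z ^ n = 1" "cmod z = 1"
  shows "(\<Sum>j<n. of_real (lapl i (int j)) * z ^ j) = - of_real (symbol n z) * (of_nat n * coef i z)"
proof -
  define S where "S = (\<Sum>j<n. of_real (X i (int j)) * z ^ j)"
  define S1 where "S1 = (\<Sum>j<n. of_real (X i (int j + 1)) * z ^ j)"
  define S2 where "S2 = (\<Sum>j<n. of_real (X i (int j - 1)) * z ^ j)"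
  have zc: "z * cnj z = 1" using complex_norm_square[of z] z(2) by simp
  have "z * S1 = (\<Sum>j<n. of_real (X i (int (Suc j))) * z ^ Suc j)"
    unfolding S1_def sum_distrib_left by (rule sum.cong) (auto simp: mult_ac add.commute)
  also have "\<dots> = S"
    unfolding S_def
    by (rule sum_lessThan_shift_cyclic[of "\<lambda>j. of_real (X i (int j)) * z ^ j"]) (use z X_wrap in simp)
  finally have "cnj z * (z * S1) = cnj z * S" by simp
  moreover have "cnj z * (z * S1) = (z * cnj z) * S1" by (simp only: ac_simps)
  ultimately have S1: "S1 = cnj z * S" using zc by simp
  have "z * S = (\<Sum>j<n. of_real (X i (int (Suc j) - 1)) * z ^ Suc j)"
    unfolding S_def sum_distrib_left by (rule sum.cong) (auto simp: mult_ac)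
  also have "\<dots> = S2"
    unfolding S2_def
    by (rule sum_lessThan_shift_cyclic[of "\<lambda>j. of_real (X i (int j - 1)) * z ^ j"]) (use z X_wrap in simp)
  finally have S2: "S2 = z * S" by simp
  have "(\<Sum>j<n. of_real (lapl i (int j)) * z ^ j) = (of_nat n)\<^sup>2 * (S1 - 2 * S + S2)"
    unfolding S_def S1_def S2_def lapl_def
    by (simp add: sum_distrib_left sum.distrib sum_subtractf algebra_simps)
  also have "\<dots> = (of_nat n)\<^sup>2 * (z + cnj z - 2) * S" unfolding S1 S2 by (simp add: algebra_simps)
  also have "z + cnj z = of_real (2 * Re z)" by (rule complex_add_cnj)
  also have "(of_nat n)\<^sup>2 * (of_real (2 * Re z) - 2) * S = - of_real (symbol n z) * S"
    by (simp add: symbol_def algebra_simps)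
  finally show ?thesis using n by (simp add: coef_def S_def)
qed

lemma coef_Suc:
  assumes z: "z ^ n = 1" "cmod z = 1"
  shows "of_real (1 + \<theta> * \<tau> * symbol n z) * coef (Suc i) z =
    of_real (1 - (1 - \<theta>) * \<tau> * symbol n z) * coef i z + force i z"
proof -
  let ?S = "\<lambda>f. (\<Sum>j<n. of_real (f (int j)) * z ^ j) :: complex"
  have "?S (X (Suc i)) = (\<Sum>j<n. of_real (X i (int j) + (1 - \<theta>) * \<tau> * lapl i (int j) + \<theta> * \<tau> * lapl (Suc i) (int j)
      + real n * (\<sigma> (X i (int j)) * N (cell n \<tau> i (int j)))) * z ^ j)"
    by (rule sum.cong[OF refl]) (subst X_Suc, auto)
  also have "\<dots> = ?S (X i) + of_real ((1 - \<theta>) * \<tau>) * ?S (lapl i) + of_real (\<theta> * \<tau>) * ?S (lapl (Suc i)) + of_nat n * force i z"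
    unfolding force_def by (simp add: sum_distrib_left sum.distrib sum_subtractf algebra_simps)
  finally have "of_nat n * coef (Suc i) z = of_nat n * coef i z
      - of_real ((1 - \<theta>) * \<tau>) * (of_real (symbol n z) * (of_nat n * coef i z))
      - of_real (\<theta> * \<tau>) * (of_real (symbol n z) * (of_nat n * coef (Suc i) z)) + of_nat n * force i z"
    unfolding lapl_coef[OF z] using n by (simp add: coef_def)
  then have "of_nat n * (of_real (1 + \<theta> * \<tau> * symbol n z) * coef (Suc i) z) =
      of_nat n * (of_real (1 - (1 - \<theta>) * \<tau> * symbol n z) * coef i z + force i z)"
    by (simp add: algebra_simps)
  then show ?thesis using n by simp
qed

text \<open>With x = \<tau> \<open>symbol n z\<close> the claim reduces to (1 - 2\<theta>) x \<le>
  2. Since x is at most \<open>4 * n\<^sup>2 * \<tau>\<close>, this is exactly what the bound 1 / (2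
  - 4\<theta>) delivers for \<theta> < 1/2; for larger \<theta> the left side is not
  positive.\<close>

lemma amplification:
  assumes z: "cmod z = 1"
  shows "\<bar>1 - (1 - \<theta>) * \<tau> * symbol n z\<bar> \<le> 1 + \<theta> * \<tau> * symbol n z"
proof -
  define x where "x = \<tau> * symbol n z"
  have x: "0 \<le> x" "x \<le> 4 * ((real n)\<^sup>2 * \<tau>)"
    using symbol_nonneg[OF z, of n] symbol_le[OF z, of n] \<tau> by (simp_all add: x_def mult_left_mono)
  have "(1 - 2 * \<theta>) * x \<le> 2"
  proof (cases "\<theta> < 1/2")
    case True
    then have s: "(real n)\<^sup>2 * \<tau> \<le> \<rho>" "\<rho> < 1 / (2 - 4 * \<theta>)"
      using adm by (auto simp: admissible_def step_size_condition_def)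
    then have "x \<le> 4 * (1 / (2 - 4 * \<theta>))" using x by linarith
    then have "(1 - 2 * \<theta>) * x \<le> (1 - 2 * \<theta>) * (4 * (1 / (2 - 4 * \<theta>)))" using True by (intro mult_left_mono) auto
    also have "\<dots> = 2" using True by (simp add: field_simps)
    finally show ?thesis .
  next
    case False
    then have "(1 - 2 * \<theta>) * x \<le> 0" using x by (intro mult_nonpos_nonneg) auto
    then show ?thesis by simp
  qed
  moreover have "0 \<le> \<theta> * x" using \<theta> x by simp
  ultimately have "\<bar>1 - (1 - \<theta>) * x\<bar> \<le> 1 + \<theta> * x" using x by (simp add: algebra_simps abs_le_iff)
  then show ?thesis by (simp add: x_def mult.assoc)
qed

lemma implicit_ge_1: "cmod z = 1 \<Longrightarrow> 1 \<le> 1 + \<theta> * \<tau> * symbol n z"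
  using symbol_nonneg[of z n] \<theta> \<tau> by simp

lemma force_le:
  assumes z: "cmod z = 1" and S: "\<And>x. \<bar>\<sigma> x\<bar> \<le> S"
  shows "cmod (force i z) \<le> S * V i"
proof -
  have "cmod (force i z) \<le> (\<Sum>j<n. \<bar>\<sigma> (X i (int j))\<bar> * \<bar>N (cell n \<tau> i (int j))\<bar>)"
    unfolding force_def by (rule order_trans[OF norm_sum]) (simp add: norm_mult norm_power z abs_mult)
  also have "\<dots> \<le> (\<Sum>j<n. S * \<bar>N (cell n \<tau> i (int j))\<bar>)" by (intro sum_mono mult_right_mono S) auto
  also have "\<dots> = S * V i"
    using sum.atLeast_int_lessThan_int_shift[of "\<lambda>j. \<bar>N (cell n \<tau> i j)\<bar>" 0 n]
    by (simp add: V_def sum_distrib_left o_def lessThan_atLeast0)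
  finally show ?thesis .
qed

text \<open>The implicit factor is at least 1, so the noise term may be enlarged by it; after
  cancelling it, each step adds at most the noise mass of one slab.\<close>

lemma coef_bound:
  assumes z: "z ^ n = 1" "cmod z = 1" and S: "\<And>x. \<bar>\<sigma> x\<bar> \<le> S" and U: "\<And>x. x \<in> {0..1} \<Longrightarrow> \<bar>u0 x\<bar> \<le> U"
  shows "cmod (coef i z) \<le> U + S * (\<Sum>q<i. V q)"
proof (induction i)
  case 0
  have "cmod (coef 0 z) \<le> (\<Sum>j<n. \<bar>X 0 (int j)\<bar>) / n"
    unfolding coef_def norm_divide
    by (simp add: divide_right_mono order_trans[OF norm_sum] norm_mult norm_power z)
  also have "\<dots> \<le> (\<Sum>j<n. U) / n"
  proof (intro divide_right_mono sum_mono)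
    fix j assume "j \<in> {..<n}"
    then show "\<bar>X 0 (int j)\<bar> \<le> U" using U[of "grid_point n (int j)"] X_0[of "int j"] by (simp add: grid_point_def)
  qed simp
  also have "\<dots> = U" using n by simp
  finally show ?case by simp
next
  case (Suc i)
  let ?q = "1 + \<theta> * \<tau> * symbol n z"
  have q: "1 \<le> ?q" by (rule implicit_ge_1[OF z(2)])
  have "?q * cmod (coef (Suc i) z) = cmod (of_real ?q * coef (Suc i) z)" using q by (simp only: norm_mult norm_of_real)
  also have "\<dots> \<le> \<bar>1 - (1 - \<theta>) * \<tau> * symbol n z\<bar> * cmod (coef i z) + cmod (force i z)"
    unfolding coef_Suc[OF z] by (rule order_trans[OF norm_triangle_ineq]) (simp only: norm_mult norm_of_real order_refl)
  also have "\<dots> \<le> ?q * cmod (coef i z) + ?q * (S * V i)"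
  proof (intro add_mono mult_right_mono amplification[OF z(2)])
    have "0 \<le> S * V i" using order_trans[OF norm_ge_zero force_le[OF z(2) S]] .
    then show "cmod (force i z) \<le> ?q * (S * V i)"
      using force_le[OF z(2) S, of i] mult_right_mono[OF q, of "S * V i"] by linarith
  qed simp
  finally have "cmod (coef (Suc i) z) \<le> cmod (coef i z) + S * V i"
    using q by (simp add: distrib_left[symmetric])
  with Suc show ?case by (simp add: algebra_simps)
qed

text \<open>Subtracting the implicit factor times the old coefficient leaves
  \<open>- \<tau> * symbol n z\<close> times that coefficient, whatever \<theta> is, and dividing by
  a factor at least 1 only helps.\<close>

lemma coef_step:
  assumes z: "z ^ n = 1" "cmod z = 1" and S: "\<And>x. \<bar>\<sigma> x\<bar> \<le> S"
  shows "cmod (coef (Suc i) z - coef i z) \<le> \<tau> * symbol n z * cmod (coef i z) + S * V i"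
proof -
  let ?q = "1 + \<theta> * \<tau> * symbol n z"
  have q: "1 \<le> ?q" by (rule implicit_ge_1[OF z(2)])
  have s: "0 \<le> \<tau> * symbol n z" using \<tau> symbol_nonneg[OF z(2), of n] by simp
  have eq: "of_real ?q * (coef (Suc i) z - coef i z) = force i z - of_real (\<tau> * symbol n z) * coef i z"
    using coef_Suc[OF z, of i] by (simp add: algebra_simps)
  have "cmod (coef (Suc i) z - coef i z) \<le> ?q * cmod (coef (Suc i) z - coef i z)"
    using mult_right_mono[OF q, of "cmod (coef (Suc i) z - coef i z)"] by simp
  also have "\<dots> = cmod (of_real ?q * (coef (Suc i) z - coef i z))" using q by (simp only: norm_mult norm_of_real)
  also have "\<dots> \<le> cmod (force i z) + \<bar>\<tau> * symbol n z\<bar> * cmod (coef i z)"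
    unfolding eq by (rule order_trans[OF norm_triangle_ineq4]) (simp only: norm_mult norm_of_real order_refl)
  finally show ?thesis using force_le[OF z(2) S, of i] s by simp
qed

lemma coef_increment:
  assumes z: "z ^ n = 1" "cmod z = 1" and S: "\<And>x. \<bar>\<sigma> x\<bar> \<le> S" and il: "i \<le> l"
    and A: "\<And>q. q < l \<Longrightarrow> cmod (coef q z) \<le> A"
  shows "cmod (coef l z - coef i z) \<le> (real l - real i) * \<tau> * symbol n z * A + S * (\<Sum>q\<in>{i..<l}. V q)"
  using il A
proof (induction rule: dec_induct)
  case (step l)
  have "cmod (coef (Suc l) z - coef i z) \<le> cmod (coef (Suc l) z - coef l z) + cmod (coef l z - coef i z)"
    using norm_triangle_ineq[of "coef (Suc l) z - coef l z" "coef l z - coef i z"] by simp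
  also have "cmod (coef (Suc l) z - coef l z) \<le> \<tau> * symbol n z * A + S * V l"
  proof -
    have "\<tau> * symbol n z * cmod (coef l z) \<le> \<tau> * symbol n z * A"
      using \<tau> symbol_nonneg[OF z(2), of n] step.prems[of l] by (intro mult_left_mono) auto
    then show ?thesis using coef_step[OF z S, of l] by linarith
  qed
  also have "cmod (coef l z - coef i z) \<le> (real l - real i) * \<tau> * symbol n z * A + S * (\<Sum>q\<in>{i..<l}. V q)"
    using step by auto
  finally show ?case using step(1) by (simp add: algebra_simps)
qed simp

text \<open>Discrete Fourier inversion. It recovers grid values from the modes, which turns the
  implicit time step into an explicit formula.\<close>

lemma inversion:
  assumes j: "j < n"
  shows "of_real (X i (int j)) = (\<Sum>k<n. coef i (fourier_root n (int k)) * cnj (fourier_root n (int k)) ^ j)"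
proof -
  let ?z = "\<lambda>k. fourier_root n (int k)"
  have "of_nat n * (\<Sum>k<n. coef i (?z k) * cnj (?z k) ^ j) =
      (\<Sum>k<n. \<Sum>l<n. of_real (X i (int l)) * (?z k ^ l * cnj (?z k) ^ j))"
    unfolding sum_distrib_left coef_def using n by (simp add: sum_distrib_right mult.assoc)
  also have "\<dots> = (\<Sum>l<n. \<Sum>k<n. of_real (X i (int l)) * (?z k ^ l * cnj (?z k) ^ j))" by (rule sum.swap)
  also have "\<dots> = (\<Sum>l<n. of_real (X i (int l)) * (\<Sum>k<n. ?z k ^ l * cnj (?z k) ^ j))"
    by (simp only: sum_distrib_left)
  also have "\<dots> = (\<Sum>l<n. of_real (X i (int l)) * (if l = j then of_nat n else 0))"
    using fourier_root_orthogonal[OF n _ j] by (intro sum.cong refl) simp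
  also have "\<dots> = of_real (X i (int j)) * of_nat n" using j by (simp add: if_distrib[of "\<lambda>x. _ * x"] cong: if_cong)
  finally show ?thesis using n by simp
qed

lemma fourier_coeff_scheme:
  assumes t: "t \<in> {of_nat i * \<tau>..<of_nat (Suc i) * \<tau>}"
  shows "fourier_coeff (\<lambda>x. of_real (u t x)) k = cell_average n k * coef i (fourier_root n k)"
proof -
  let ?e = "\<lambda>y. exp (- (2 * of_real pi * \<i> * of_int k * of_real y)) :: complex"
  let ?I = "\<lambda>j. {real j / n..<real (Suc j) / n}"
  have ut: "u t y = u (of_nat i * \<tau>) (kappa n y)" if "y \<in> {0..1}" for y
    using scheme t that unfolding fully_discrete_scheme_def by blast
  \<comment> \<open>The half-open cells miss the right end point y = 1, where the path takes the
    boundary value; a single point does not change the integral.\<close>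
  have pw: "indicator {0..1} y *\<^sub>R (of_real (u t y) * ?e y) = (\<Sum>j<n. of_real (X i (int j)) * (indicator (?I j) y *\<^sub>R ?e y))"
    if y: "y \<noteq> 1" for y :: real
  proof (cases "0 \<le> y \<and> y < 1")
    case False
    have "indicator (?I j) y = (0::real)" if "j < n" for j
    proof -
      have "real (Suc j) / n \<le> 1" "0 \<le> real j / n" using that n by (simp_all add: divide_le_eq)
      then have "\<not> (real j / n \<le> y \<and> y < real (Suc j) / n)" using False by linarith
      then show ?thesis by (simp add: indicator_def)
    qed
    moreover have "y \<notin> {0..1}" using False y by auto
    ultimately show ?thesis by simp
  next
    case True
    define j0 where "j0 = nat \<lfloor>real n * y\<rfloor>"
    have fl: "\<lfloor>real n * y\<rfloor> = int j0" using True by (simp add: j0_def)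
    have ny: "real j0 \<le> real n * y" "real n * y < real j0 + 1" using fl by linarith+
    have "real n * y < real n" using True n by simp
    then have j0: "j0 < n" using ny by linarith
    have "y \<in> ?I j \<longleftrightarrow> j = j0" for j
    proof -
      have "y \<in> ?I j \<longleftrightarrow> real j \<le> real n * y \<and> real n * y < real j + 1" using n by (simp add: field_simps)
      then show ?thesis using ny by linarith
    qed
    then have "(\<Sum>j<n. of_real (X i (int j)) * (indicator (?I j) y *\<^sub>R ?e y)) =
        (\<Sum>j<n. if j = j0 then of_real (X i (int j)) * ?e y else 0)"
      by (intro sum.cong refl) (simp add: indicator_def)
    also have "\<dots> = of_real (X i (int j0)) * ?e y" using j0 by simp
    also have "X i (int j0) = u t y" using ut[of y] True by (simp add: X_def kappa_def grid_point_def fl)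
    finally show ?thesis using True by simp
  qed
  have "fourier_coeff (\<lambda>x. of_real (u t x)) k = (LINT y|lborel. indicator {0..1} y *\<^sub>R (of_real (u t y) * ?e y))"
    by (simp add: fourier_coeff_def set_lebesgue_integral_def)
  also have "\<dots> = (LINT y|lborel. (\<Sum>j<n. of_real (X i (int j)) * (indicator (?I j) y *\<^sub>R ?e y)))"
  proof (rule integral_discrete_difference[of "{1}"])
    fix y :: real assume "y \<notin> {1}"
    then show "indicator {0..1} y *\<^sub>R (of_real (u t y) * ?e y) = (\<Sum>j<n. of_real (X i (int j)) * (indicator (?I j) y *\<^sub>R ?e y))"
      by (intro pw) simp
  qed simp_all
  also have "\<dots> = (\<Sum>j<n. of_real (X i (int j)) * (LINT y|lborel. indicator (?I j) y *\<^sub>R ?e y))"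
    by (subst Bochner_Integration.integral_sum)
      (simp_all only: integrable_mult_right[OF integrable_fourier] integral_mult_right_zero)
  also have "\<dots> = (\<Sum>j<n. of_real (X i (int j)) * (fourier_root n k ^ j * cell_average n k / of_nat n))"
    using cell_average_shift[OF n] by simp
  also have "\<dots> = cell_average n k * coef i (fourier_root n k)"
    unfolding coef_def by (simp add: sum_distrib_left sum_divide_distrib mult_ac)
  finally show ?thesis .
qed

end

section \<open>Compact boxes in negative Sobolev spaces\<close>

text \<open>The weight is at most \<bar>k\<bar> to the power 2r, and r < - 1/2 makes this exponent
  smaller than -1. The integers are split into the positive ones, the negative ones and 0.\<close>

lemma sobolev_weight_summable:
  assumes r: "r < - 1/2"
  shows "sobolev_weight r summable_on UNIV"
proof -
  have le: "sobolev_weight r k \<le> \<bar>real_of_int k\<bar> powr (2 * r)" if "k \<noteq> 0" for k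
  proof -
    have "1 \<le> pi\<^sup>2" using pi_gt3 by (intro one_le_power) linarith
    then have "1 * (real_of_int k)\<^sup>2 \<le> (4 * pi\<^sup>2) * (real_of_int k)\<^sup>2" by (intro mult_right_mono) auto
    then have "(real_of_int k)\<^sup>2 \<le> 1 + 4 * pi\<^sup>2 * (real_of_int k)\<^sup>2" by linarith
    then have "(1 + 4 * pi\<^sup>2 * (real_of_int k)\<^sup>2) powr r \<le> ((real_of_int k)\<^sup>2) powr r"
      using that r by (intro powr_mono2') auto
    also have "((real_of_int k)\<^sup>2) powr r = (\<bar>real_of_int k\<bar> powr 2) powr r" using that by simp
    also have "\<dots> = \<bar>real_of_int k\<bar> powr (2 * r)" by (rule powr_powr)
    finally show ?thesis by (simp add: sobolev_weight_def)
  qed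
  have sm: "(\<lambda>n. real (Suc n) powr (2 * r)) summable_on UNIV"
  proof (rule norm_summable_imp_summable_on)
    have "summable (\<lambda>n. real n powr (2 * r))" using r by (simp add: summable_real_powr_iff)
    then show "summable (\<lambda>n. norm (real (Suc n) powr (2 * r)))" using summable_Suc_iff[of "\<lambda>n. real n powr (2 * r)"] by simp
  qed
  have "(\<lambda>n. sobolev_weight r (int (Suc n))) summable_on UNIV"
    by (rule summable_on_comparison_test[OF sm]) (use le[of "int (Suc _)"] sobolev_weight_pos in \<open>auto intro: less_imp_le\<close>)
  then have "sobolev_weight r summable_on range (\<lambda>n. int (Suc n))"
    by (subst summable_on_reindex) (auto simp: inj_on_def o_def)
  moreover have neg: "sobolev_weight r (- int (Suc n)) \<le> real (Suc n) powr (2 * r)" for n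
  proof -
    have "- int (Suc n) \<noteq> 0" by simp
    from le[OF this] show ?thesis by (simp only: of_int_minus abs_minus_cancel of_int_of_nat_eq abs_of_nat)
  qed
  have "(\<lambda>n. sobolev_weight r (- int (Suc n))) summable_on UNIV"
    by (rule summable_on_comparison_test[OF sm]) (use neg sobolev_weight_pos in \<open>auto intro: less_imp_le simp del: of_nat_Suc\<close>)
  then have "sobolev_weight r summable_on range (\<lambda>n. - int (Suc n))"
    by (subst summable_on_reindex) (auto simp: inj_on_def o_def)
  ultimately have "sobolev_weight r summable_on (range (\<lambda>n. int (Suc n)) \<union> range (\<lambda>n. - int (Suc n)))"
    by (rule summable_on_Un_disjoint) auto
  moreover have "sobolev_weight r summable_on {0}" by simp
  ultimately have "sobolev_weight r summable_on ((range (\<lambda>n. int (Suc n)) \<union> range (\<lambda>n. - int (Suc n))) \<union> {0})"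
    by (rule summable_on_Un_disjoint) auto
  moreover have "(range (\<lambda>n. int (Suc n)) \<union> range (\<lambda>n. - int (Suc n))) \<union> {0} = UNIV"
  proof -
    have "k \<in> (range (\<lambda>n. int (Suc n)) \<union> range (\<lambda>n. - int (Suc n))) \<union> {0}" for k :: int
    proof (cases k rule: int_cases2)
      case (nonneg n) then show ?thesis by (cases n) auto
    next
      case (nonpos n) then show ?thesis by (cases n) auto
    qed
    then show ?thesis by blast
  qed
  ultimately show ?thesis by simp
qed

definition total_weight :: "real \<Rightarrow> real" where
  "total_weight r = (\<Sum>\<^sub>\<infinity>k. sobolev_weight r k)"

lemma sum_sobolev_weight_le: "r < - 1/2 \<Longrightarrow> finite A \<Longrightarrow> (\<Sum>k\<in>A. sobolev_weight r k) \<le> total_weight r"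
  unfolding total_weight_def
  by (rule finite_sum_le_infsum[OF sobolev_weight_summable]) (auto intro: less_imp_le sobolev_weight_pos)

lemma sobolev_norm_le:
  assumes "0 \<le> B" "\<And>A. finite A \<Longrightarrow> (\<Sum>k\<in>A. sobolev_weight r k * (cmod (c k))\<^sup>2) \<le> B\<^sup>2"
  shows "c \<in> sobolev_carrier r" "sobolev_norm r c \<le> B"
proof -
  have "L2_set (\<lambda>k. sqrt (sobolev_weight r k) * cmod (c k)) A \<le> B" if "finite A" for A
    using assms(1) assms(2)[OF that] sobolev_weight_pos[of r]
    by (simp add: L2_set_def power_mult_distrib less_imp_le real_le_lsqrt sum_nonneg)
  from sobolev_bounded[of r c B, OF this]
  show "c \<in> sobolev_carrier r" "sobolev_norm r c \<le> B" by auto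
qed

lemma sobolev_norm_le_sup:
  assumes r: "r < - 1/2" and c: "\<And>k. cmod (c k) \<le> a"
  shows "c \<in> sobolev_carrier r" "sobolev_norm r c \<le> a * sqrt (total_weight r)"
proof -
  have a: "0 \<le> a" using order_trans[OF norm_ge_zero c[of 0]] .
  have W: "0 \<le> total_weight r" using sum_sobolev_weight_le[OF r, of "{}"] by simp
  have "(\<Sum>k\<in>A. sobolev_weight r k * (cmod (c k))\<^sup>2) \<le> (a * sqrt (total_weight r))\<^sup>2" if "finite A" for A
  proof -
    have "(\<Sum>k\<in>A. sobolev_weight r k * (cmod (c k))\<^sup>2) \<le> (\<Sum>k\<in>A. sobolev_weight r k * a\<^sup>2)"
      using c sobolev_weight_pos[of r] by (intro sum_mono mult_left_mono power_mono) (auto intro: less_imp_le)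
    also have "\<dots> = (\<Sum>k\<in>A. sobolev_weight r k) * a\<^sup>2" by (simp add: sum_distrib_right)
    also have "\<dots> \<le> total_weight r * a\<^sup>2" using sum_sobolev_weight_le[OF r that] by (intro mult_right_mono) auto
    finally show ?thesis using W by (simp add: power_mult_distrib mult.commute)
  qed
  with sobolev_norm_le[of "a * sqrt (total_weight r)" r c] a W
  show "c \<in> sobolev_carrier r" "sobolev_norm r c \<le> a * sqrt (total_weight r)" by auto
qed

definition box :: "real \<Rightarrow> (int \<Rightarrow> complex) set" where
  "box A = {c. \<forall>k. cmod (c k) \<le> A}"

text \<open>A finite set \<open>H\<close> of modes carries all but \<gamma> of the total weight. On
  it the modes are close by assumption; off it two elements of the box differ by at most 2A per mode
  and the remaining weight is small.\<close>

lemma box_dist_small: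
  assumes r: "r < - 1/2" and e: "0 < e" and A: "0 \<le> A"
  shows "\<exists>H \<zeta>. finite H \<and> 0 < \<zeta> \<and>
    (\<forall>c\<in>box A. \<forall>d\<in>box A. (\<forall>k\<in>H. cmod (c k - d k) \<le> \<zeta>) \<longrightarrow> sobolev_dist r c d \<le> e)"
proof -
  let ?W = "total_weight r"
  \<comment> \<open>Dominates the square of 2A and stays positive for A = 0. With it, \<gamma> makes
    the tail contribute at most half of the squared bound.\<close>
  define D where "D = 4 * A\<^sup>2 + 1"
  have D: "0 < D" "4 * A\<^sup>2 \<le> D" by (auto simp: D_def add_nonneg_pos)
  define \<gamma> where "\<gamma> = e\<^sup>2 / (2 * D)"
  have \<gamma>: "0 < \<gamma>" using e D by (simp add: \<gamma>_def)
  have W: "0 \<le> ?W" using sum_sobolev_weight_le[OF r, of "{}"] by simp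
  have "((\<lambda>F. \<Sum>k\<in>F. sobolev_weight r k) \<longlongrightarrow> ?W) (finite_subsets_at_top UNIV)"
    using has_sum_infsum[OF sobolev_weight_summable[OF r]] unfolding total_weight_def has_sum_def .
  then have "eventually (\<lambda>F. dist (\<Sum>k\<in>F. sobolev_weight r k) ?W < \<gamma>) (finite_subsets_at_top UNIV)"
    using \<gamma> by (rule tendstoD)
  then obtain H where H: "finite H" "dist (\<Sum>k\<in>H. sobolev_weight r k) ?W < \<gamma>"
    unfolding eventually_finite_subsets_at_top by (metis subset_UNIV order_refl)
  \<comment> \<open>Makes the modes in \<open>H\<close> contribute the other half; adding 1 to the
    total weight avoids dividing by 0.\<close>
  define \<zeta> where "\<zeta> = e / sqrt (2 * (?W + 1))"
  have \<zeta>: "0 < \<zeta>" using e W by (simp add: \<zeta>_def)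
  have \<zeta>2: "\<zeta>\<^sup>2 * ?W \<le> e\<^sup>2 / 2"
  proof -
    have "\<zeta>\<^sup>2 * ?W = e\<^sup>2 / 2 * (?W / (?W + 1))" using W by (simp add: \<zeta>_def power_divide)
    also have "\<dots> \<le> e\<^sup>2 / 2 * 1" using W by (intro mult_left_mono) auto
    finally show ?thesis by simp
  qed
  have "sobolev_dist r c d \<le> e" if cd: "c \<in> box A" "d \<in> box A" and close: "\<forall>k\<in>H. cmod (c k - d k) \<le> \<zeta>" for c d
    unfolding sobolev_dist_def
  proof (rule sobolev_norm_le(2))
    fix B :: "int set" assume B: "finite B"
    let ?t = "\<lambda>k. sobolev_weight r k * (cmod (c k - d k))\<^sup>2"
    have "(\<Sum>k\<in>B \<inter> H. ?t k) \<le> (\<Sum>k\<in>B \<inter> H. sobolev_weight r k * \<zeta>\<^sup>2)"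
      using close sobolev_weight_pos[of r] by (intro sum_mono mult_left_mono power_mono) (auto intro: less_imp_le)
    also have "\<dots> = (\<Sum>k\<in>B \<inter> H. sobolev_weight r k) * \<zeta>\<^sup>2" by (simp add: sum_distrib_right)
    also have "\<dots> \<le> ?W * \<zeta>\<^sup>2" using sum_sobolev_weight_le[OF r] B by (intro mult_right_mono) auto
    finally have 1: "(\<Sum>k\<in>B \<inter> H. ?t k) \<le> e\<^sup>2 / 2" using \<zeta>2 by (simp add: mult.commute)
    have "(\<Sum>k\<in>B - H. sobolev_weight r k) + (\<Sum>k\<in>H. sobolev_weight r k) = (\<Sum>k\<in>(B - H) \<union> H. sobolev_weight r k)"
      using B H by (intro sum.union_disjoint[symmetric]) auto
    also have "\<dots> \<le> ?W" using sum_sobolev_weight_le[OF r] B H by auto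
    finally have tail: "(\<Sum>k\<in>B - H. sobolev_weight r k) \<le> \<gamma>" using H(2) by (simp add: dist_real_def)
    have "(\<Sum>k\<in>B - H. ?t k) \<le> (\<Sum>k\<in>B - H. sobolev_weight r k * (2 * A)\<^sup>2)"
    proof (intro sum_mono mult_left_mono power_mono)
      fix k show "cmod (c k - d k) \<le> 2 * A"
        using norm_triangle_ineq4[of "c k" "d k"] cd by (smt (verit) box_def mem_Collect_eq)
    qed (use sobolev_weight_pos in \<open>auto intro: less_imp_le\<close>)
    also have "\<dots> = (\<Sum>k\<in>B - H. sobolev_weight r k) * (2 * A)\<^sup>2" by (simp add: sum_distrib_right)
    also have "\<dots> \<le> \<gamma> * (2 * A)\<^sup>2" using tail by (intro mult_right_mono) auto
    also have "\<dots> = e\<^sup>2 / 2 * (4 * A\<^sup>2 / D)" by (simp add: \<gamma>_def power_mult_distrib)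
    also have "\<dots> \<le> e\<^sup>2 / 2 * 1" using D by (intro mult_left_mono) (auto simp: divide_le_eq)
    finally have 2: "(\<Sum>k\<in>B - H. ?t k) \<le> e\<^sup>2 / 2" by simp
    have "(\<Sum>k\<in>B. ?t k) = (\<Sum>k\<in>B \<inter> H. ?t k) + (\<Sum>k\<in>B - H. ?t k)" by (rule sum.Int_Diff[OF B])
    with 1 2 show "(\<Sum>k\<in>B. ?t k) \<le> e\<^sup>2" by simp
  qed (use e in simp)
  with H(1) \<zeta> show ?thesis by blast
qed

lemma box_subset_carrier: "r < - 1/2 \<Longrightarrow> box A \<subseteq> sobolev_carrier r"
  unfolding box_def by (rule subsetI, rule sobolev_norm_le_sup(1)[where a = A]) simp_all

text \<open>Boundedness of each coordinate allows a diagonal extraction with convergence mode by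
  mode, and \<open>box_dist_small\<close> upgrades this to convergence in norm.\<close>

lemma compactin_box:
  assumes r: "r < - 1/2" and A: "0 \<le> A"
  shows "compactin (mtopology_of (sobolev r)) (box A)"
proof -
  interpret Metric_space "sobolev_carrier r" "sobolev_dist r" by (rule Metric_space_sobolev)
  have "compactin mtopology (box A)"
    unfolding compactin_sequentially
  proof (intro conjI allI impI box_subset_carrier r)
    fix f :: "nat \<Rightarrow> int \<Rightarrow> complex" assume f: "range f \<subseteq> box A"
    then have fA: "cmod (f j k) \<le> A" for j k by (auto simp: box_def)
    have "\<exists>\<rho> l. strict_mono \<rho> \<and> (\<forall>n. l n \<in> cball 0 A \<and>
        limitin Met_TC.mtopology (\<lambda>j. f (\<rho> j) (int_decode n)) (l n) sequentially)"
      by (rule Met_TC.diagonal_limits[of "\<lambda>_. cball 0 A" "\<lambda>j n. f j (int_decode n)"]) (auto simp: fA)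
    then obtain \<rho> l where \<rho>: "strict_mono \<rho>" and l: "\<And>n. cmod (l n) \<le> A"
      "\<And>n. (\<lambda>j. f (\<rho> j) (int_decode n)) \<longlonglongrightarrow> l n" by auto
    define c where "c k = l (int_encode k)" for k
    have c: "c \<in> box A" using l(1) by (simp add: box_def c_def)
    have lim: "(\<lambda>j. f (\<rho> j) k) \<longlonglongrightarrow> c k" for k using l(2)[of "int_encode k"] by (simp add: c_def)
    have "limitin mtopology (f \<circ> \<rho>) c sequentially"
      unfolding limitin_metric
    proof (intro conjI allI impI)
      show "c \<in> sobolev_carrier r" using c box_subset_carrier[OF r] by blast
      fix e :: real assume e: "0 < e"
      from box_dist_small[OF r half_gt_zero[OF e] A] obtain H \<zeta> where H: "finite H" "0 < \<zeta>"
        "\<forall>c\<in>box A. \<forall>d\<in>box A. (\<forall>k\<in>H. cmod (c k - d k) \<le> \<zeta>) \<longrightarrow> sobolev_dist r c d \<le> e / 2"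
        by (elim exE conjE)
      note small = H(3)[rule_format]
      have "eventually (\<lambda>j. \<forall>k\<in>H. dist (f (\<rho> j) k) (c k) < \<zeta>) sequentially"
        using H tendstoD[OF lim] by (intro eventually_ball_finite) auto
      then show "\<forall>\<^sub>F j in sequentially. (f \<circ> \<rho>) j \<in> sobolev_carrier r \<and> sobolev_dist r ((f \<circ> \<rho>) j) c < e"
      proof eventually_elim
        case (elim j)
        have fb: "f (\<rho> j) \<in> box A" using f by auto
        have "sobolev_dist r (f (\<rho> j)) c \<le> e / 2"
          using elim by (intro small fb c) (auto simp: dist_norm less_imp_le)
        then show ?case using fb box_subset_carrier[OF r] e by auto
      qed
    qed
    with c \<rho> show "\<exists>l \<rho>. l \<in> box A \<and> strict_mono \<rho> \<and> limitin mtopology (f \<circ> \<rho>) l sequentially"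
      by (intro exI[of _ c] exI[of _ \<rho>]) auto
  qed
  then show ?thesis by (simp add: mtopology_of_def)
qed

section \<open>Jump times of the discrete paths\<close>

text \<open>List \<open>J\<close> in increasing order and continue past its largest element in steps
  of \<delta>. The bound on \<open>s i\<close> does not depend on \<open>J\<close>, as needed for
  one compact class containing all paths.\<close>

lemma finite_separated_sequence:
  assumes J: "finite J" and \<delta>: "0 < \<delta>" and T: "0 \<le> T"
    and bounds: "\<And>x. x \<in> J \<Longrightarrow> \<delta> \<le> x \<and> x \<le> T"
    and gap: "\<And>x y. x \<in> J \<Longrightarrow> y \<in> J \<Longrightarrow> x < y \<Longrightarrow> x + \<delta> \<le> y"
  shows "\<exists>s. separated \<delta> s \<and> J \<subseteq> range s \<and> (\<forall>i. s i \<le> T + (real i + 1) * \<delta>)"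
proof -
  define succ where "succ x = (if \<exists>y\<in>J. x < y then Min {y \<in> J. x < y} else x + \<delta>)" for x
  have succ_in: "succ x \<in> J \<and> x < succ x" if "\<exists>y\<in>J. x < y" for x
  proof -
    have "Min {y \<in> J. x < y} \<in> {y \<in> J. x < y}" using that J by (intro Min_in) auto
    then show ?thesis using that by (auto simp: succ_def)
  qed
  have succ_le: "succ x \<le> y" if "y \<in> J" "x < y" for x y
    using that J by (auto simp: succ_def)
  define s where "s i = (succ ^^ Suc i) 0" for i
  have s_Suc: "s (Suc i) = succ (s i)" for i by (simp add: s_def)
  have s_0: "s 0 = succ 0" by (simp add: s_def)
  have inv: "s i \<in> J \<or> (\<forall>y\<in>J. y \<le> s i)" for i
  proof (cases i)
    case 0
    show ?thesis
    proof (cases "\<exists>y\<in>J. 0 < y")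
      case False
      then show ?thesis using \<delta> 0 s_0 by (fastforce simp: succ_def not_less)
    qed (use succ_in 0 s_0 in auto)
  next
    case (Suc i')
    show ?thesis
    proof (cases "\<exists>y\<in>J. s i' < y")
      case False
      then show ?thesis using \<delta> Suc s_Suc by (fastforce simp: succ_def not_less)
    qed (use succ_in Suc s_Suc in auto)
  qed
  have sep: "separated \<delta> s"
    unfolding separated_def
  proof (intro conjI allI)
    show "\<delta> \<le> s 0" using bounds succ_in[of 0] s_0 by (cases "\<exists>y\<in>J. 0 < y") (auto simp: succ_def)
    fix i
    show "s i + \<delta> \<le> s (Suc i)"
    proof (cases "\<exists>y\<in>J. s i < y")
      case True
      then have "s i \<in> J" using inv[of i] by auto
      with True show ?thesis using gap[of "s i" "succ (s i)"] succ_in[OF True] s_Suc by auto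
    qed (simp add: s_Suc succ_def)
  qed
  have "y \<in> range s" if y: "y \<in> J" for y
  proof -
    obtain i0 :: nat where "y / \<delta> < real i0" using reals_Archimedean2 by blast
    then have "y < (real i0 + 1) * \<delta>" using \<delta> by (simp add: field_simps)
    then have ex: "\<exists>i. y \<le> s i" using separated_lower[OF sep, of i0] by (intro exI[of _ i0]) linarith
    define i where "i = (LEAST i. y \<le> s i)"
    have i: "y \<le> s i" unfolding i_def by (rule LeastI_ex[OF ex])
    have "s i \<le> y"
    proof (cases i)
      case 0
      then show ?thesis using succ_le[OF y, of 0] bounds[OF y] \<delta> s_0 by simp
    next
      case (Suc i')
      then have "\<not> y \<le> s i'" using not_less_Least[of i' "\<lambda>i. y \<le> s i"] by (simp add: i_def)
      then show ?thesis using succ_le[OF y, of "s i'"] Suc s_Suc by simp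
    qed
    with i show ?thesis by (intro range_eqI[of _ _ i]) simp
  qed
  moreover have "s i \<le> T + (real i + 1) * \<delta>" for i
  proof (induction i)
    case 0
    show ?case using succ_in[of 0] bounds[of "succ 0"] s_0 \<delta> T by (cases "\<exists>y\<in>J. 0 < y") (auto simp: succ_def)
  next
    case (Suc i)
    show ?case
    proof (cases "\<exists>y\<in>J. s i < y")
      case True
      then have "s (Suc i) \<le> T" using succ_in[OF True] bounds s_Suc by auto
      then show ?thesis using \<delta> by (smt (verit) mult_nonneg_nonneg of_nat_0_le_iff)
    next
      case False
      then have "s (Suc i) = s i + \<delta>" using s_Suc by (simp add: succ_def)
      with Suc show ?thesis by (simp add: algebra_simps)
    qed
  qed
  ultimately show ?thesis using sep by blast
qed

definition grid_index :: "real \<Rightarrow> real \<Rightarrow> nat" where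
  "grid_index \<tau> t = nat \<lfloor>t / \<tau>\<rfloor>"

lemma grid_index_bounds:
  assumes "0 < \<tau>" "0 \<le> t"
  shows "real (grid_index \<tau> t) * \<tau> \<le> t" "t < real (Suc (grid_index \<tau> t)) * \<tau>"
proof -
  have "real (grid_index \<tau> t) \<le> t / \<tau>" "t / \<tau> < real (grid_index \<tau> t) + 1"
    using assms by (auto simp: grid_index_def)
  then show "real (grid_index \<tau> t) * \<tau> \<le> t" "t < real (Suc (grid_index \<tau> t)) * \<tau>"
    using assms by (simp_all add: field_simps)
qed

lemma grid_index_mono: "0 < \<tau> \<Longrightarrow> x \<le> y \<Longrightarrow> grid_index \<tau> x \<le> grid_index \<tau> y"
  unfolding grid_index_def by (intro nat_mono floor_mono divide_right_mono) auto

text \<open>Used by contraposition: a change of grid index between \<open>x\<close> and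
  \<open>y\<close> exhibits a grid time in between, so if no such time is a jump time, all cells
  crossed are harmless.\<close>

lemma no_grid_time_between:
  assumes \<tau>: "0 < \<tau>" and xy: "0 \<le> x" "x \<le> y"
    and q: "q \<in> {grid_index \<tau> (min x T)..<grid_index \<tau> (min y T)}" and T: "0 < T"
  shows "real (Suc q) * \<tau> \<le> T" "real (Suc q) * \<tau> \<le> y" "\<not> real (Suc q) * \<tau> \<le> x"
proof -
  have mono: "real a * \<tau> \<le> real b * \<tau>" if "a \<le> b" for a b using that \<tau> by (simp add: mult_right_mono)
  have "real (Suc q) * \<tau> \<le> min y T"
    using mono[of "Suc q" "grid_index \<tau> (min y T)"] q grid_index_bounds(1)[OF \<tau>, of "min y T"] xy T by auto
  moreover have "min x T < real (Suc q) * \<tau>"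
    using mono[of "Suc (grid_index \<tau> (min x T))" "Suc q"] q grid_index_bounds(2)[OF \<tau>, of "min x T"] xy T by auto
  ultimately show "real (Suc q) * \<tau> \<le> T" "real (Suc q) * \<tau> \<le> y" "\<not> real (Suc q) * \<tau> \<le> x" by auto
qed

lemma finite_grid_times: "0 < \<tau> \<Longrightarrow> finite {real (Suc q) * \<tau> | q. P q \<and> real (Suc q) * \<tau> \<le> T}"
proof -
  assume \<tau>: "0 < \<tau>"
  obtain Q :: nat where Q: "T / \<tau> < real Q" using reals_Archimedean2 by blast
  have "q < Q" if "real (Suc q) * \<tau> \<le> T" for q
  proof -
    have "real (Suc q) \<le> T / \<tau>" using that \<tau> by (simp add: field_simps)
    then show ?thesis using Q by linarith
  qed
  then have "{real (Suc q) * \<tau> | q. P q \<and> real (Suc q) * \<tau> \<le> T} \<subseteq> (\<lambda>q. real (Suc q) * \<tau>) ` {..<Q}" by auto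
  then show ?thesis by (rule finite_subset) simp
qed

lemma step_path_modulus:
  assumes T: "0 < T" and \<tau>: "0 < \<tau>" and g: "\<And>i. real i * \<tau> \<le> T \<Longrightarrow> g i \<in> mspace m"
  shows "jump_modulus m T (\<lambda>t\<in>{0..T}. g (grid_index \<tau> t)) (\<lambda>i. real (Suc i) * \<tau>) \<tau> 0"
  unfolding jump_modulus_def
proof (intro conjI allI impI)
  interpret Metric_space "mspace m" "mdist m" by (rule Metric_space_mspace_mdist)
  show "separated \<tau> (\<lambda>i. real (Suc i) * \<tau>)" by (simp add: separated_def algebra_simps)
  fix x y :: real assume xy: "0 \<le> x" "0 \<le> y" and side: "\<forall>i. (real (Suc i) * \<tau> \<le> x) = (real (Suc i) * \<tau> \<le> y)"
  have le: "grid_index \<tau> (min b T) \<le> grid_index \<tau> (min a T)"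
    if ab: "0 \<le> a" "a \<le> b" "\<And>i. (real (Suc i) * \<tau> \<le> a) = (real (Suc i) * \<tau> \<le> b)" for a b
  proof (rule ccontr)
    assume "\<not> ?thesis"
    then have "grid_index \<tau> (min a T) \<in> {grid_index \<tau> (min a T)..<grid_index \<tau> (min b T)}" by simp
    from no_grid_time_between(2,3)[OF \<tau> ab(1,2) this T] ab(3) show False by blast
  qed
  have "grid_index \<tau> (min x T) = grid_index \<tau> (min y T)"
  proof (cases "x \<le> y")
    case True
    then show ?thesis using le[of x y] xy side grid_index_mono[OF \<tau>, of "min x T" "min y T"] by (intro antisym) auto
  next
    case False
    then show ?thesis using le[of y x] xy side grid_index_mono[OF \<tau>, of "min y T" "min x T"] by (intro antisym) auto
  qed
  moreover have "g (grid_index \<tau> (min y T)) \<in> mspace m"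
    using grid_index_bounds(1)[OF \<tau>, of "min y T"] xy T by (intro g) auto
  ultimately show "mdist m ((\<lambda>t\<in>{0..T}. g (grid_index \<tau> t)) (min x T)) ((\<lambda>t\<in>{0..T}. g (grid_index \<tau> t)) (min y T)) \<le> 0"
    using xy T by simp
qed

text \<open>With all grid times as jump times, a step path has modulus 0 at every level, so
  membership follows from \<open>modulus_class_subset\<close>.\<close>

lemma step_path_carrier:
  assumes T: "0 < T" and \<tau>: "0 < \<tau>" and P: "compactin (mtopology_of m) P"
    and g: "\<And>i. real i * \<tau> \<le> T \<Longrightarrow> g i \<in> P"
  shows "(\<lambda>t\<in>{0..T}. g (grid_index \<tau> t)) \<in> skorohod_carrier m T"
proof -
  have PM: "P \<subseteq> mspace m" using compactin_subset_topspace[OF P] by simp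
  have "(\<lambda>t\<in>{0..T}. g (grid_index \<tau> t)) \<in> modulus_class m T P (\<lambda>_. \<tau>) (\<lambda>_. 0) (\<lambda>_ i. real (Suc i) * \<tau>)"
    unfolding modulus_class_def
  proof (intro CollectI conjI allI)
    show "(\<lambda>t\<in>{0..T}. g (grid_index \<tau> t)) \<in> {0..T} \<rightarrow>\<^sub>E P"
    proof (intro restrict_PiE_iff[THEN iffD2] ballI g)
      fix t assume "t \<in> {0..T}"
      then show "real (grid_index \<tau> t) * \<tau> \<le> T" using grid_index_bounds(1)[OF \<tau>, of t] by auto
    qed
    show "\<exists>s. (\<forall>i. s i \<le> real (Suc i) * \<tau>) \<and> jump_modulus m T (\<lambda>t\<in>{0..T}. g (grid_index \<tau> t)) s \<tau> 0"
      using step_path_modulus[OF T \<tau>, of g m] g PM by (intro exI[of _ "\<lambda>i. real (Suc i) * \<tau>"]) auto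
  qed
  moreover have "modulus_class m T P (\<lambda>_. \<tau>) (\<lambda>_. 0) (\<lambda>_ i. real (Suc i) * \<tau>) \<subseteq> skorohod_carrier m T"
    by (rule modulus_class_subset[OF T P]) (use \<tau> in auto)
  ultimately show ?thesis by blast
qed

context scheme_path
begin

lemma sobolev_path_eq:
  "sobolev_path T u = (\<lambda>t\<in>{0..T}. \<lambda>k. cell_average n k * coef (grid_index \<tau> t) (fourier_root n k))"
proof
  fix t
  show "sobolev_path T u t = (\<lambda>t\<in>{0..T}. \<lambda>k. cell_average n k * coef (grid_index \<tau> t) (fourier_root n k)) t"
  proof (cases "t \<in> {0..T}")
    case True
    then have "t \<in> {of_nat (grid_index \<tau> t) * \<tau>..<of_nat (Suc (grid_index \<tau> t)) * \<tau>}"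
      using grid_index_bounds[OF \<tau>] by auto
    from fourier_coeff_scheme[OF this] True show ?thesis by (simp add: sobolev_path_def fun_eq_iff)
  next
    case False
    then show ?thesis by (simp only: sobolev_path_def restrict_def if_False)
  qed
qed

lemma path_in_box:
  assumes S: "\<And>x. \<bar>\<sigma> x\<bar> \<le> S" and U: "\<And>x. x \<in> {0..1} \<Longrightarrow> \<bar>u0 x\<bar> \<le> U"
    and mass: "(\<Sum>q<i. V q) \<le> A"
  shows "(\<lambda>k. cell_average n k * coef i (fourier_root n k)) \<in> box (U + S * A)"
proof -
  have S0: "0 \<le> S" using order_trans[OF abs_ge_zero S] .
  have "cmod (cell_average n k * coef i (fourier_root n k)) \<le> U + S * A" for k
  proof -
    have "cmod (cell_average n k * coef i (fourier_root n k)) \<le> 1 * cmod (coef i (fourier_root n k))"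
      unfolding norm_mult using norm_cell_average[OF n] by (intro mult_right_mono) auto
    also have "\<dots> \<le> U + S * (\<Sum>q<i. V q)"
      using coef_bound[OF fourier_root_power_n[OF n] norm_fourier_root S U] by simp
    also have "\<dots> \<le> U + S * A" using mass S0 by (intro add_left_mono mult_left_mono) auto
    finally show ?thesis .
  qed
  then show ?thesis by (simp add: box_def)
qed

text \<open>If the time step is large, every grid time counts as a jump time. If it is small, the jump times
  are the ends of the time cells with a large jump of the noise.\<close>

lemma path_modulus:
  assumes T: "0 < T" and r: "r < - 1/2" and S: "\<And>x. \<bar>\<sigma> x\<bar> \<le> S" and U: "\<And>x. x \<in> {0..1} \<Longrightarrow> \<bar>u0 x\<bar> \<le> U"
    and mass: "\<And>l. real l * \<tau> \<le> T \<Longrightarrow> (\<Sum>q<l. V q) \<le> A"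
    and c: "0 \<le> c" and \<delta>: "0 < \<delta>" and e: "0 \<le> e"
    and small: "\<And>i l. i \<le> l \<Longrightarrow> real l * \<tau> \<le> T \<Longrightarrow> (\<And>q. q \<in> {i..<l} \<Longrightarrow> \<not> big q) \<Longrightarrow>
      (\<Sum>q\<in>{i..<l}. V q) \<le> c * ((real l - real i) * \<tau>) + \<eta>"
    and first: "\<And>q. big q \<Longrightarrow> real (Suc q) * \<tau> \<le> T \<Longrightarrow> 2 * \<delta> < real (Suc q) * \<tau>"
    and isolated: "\<And>q q'. big q \<Longrightarrow> big q' \<Longrightarrow> q < q' \<Longrightarrow> real (Suc q') * \<tau> \<le> T \<Longrightarrow>
      2 * \<delta> < real (Suc q') * \<tau> - real q * \<tau>"
    and \<zeta>: "\<And>c d. c \<in> box (U + S * A) \<Longrightarrow> d \<in> box (U + S * A) \<Longrightarrow>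
      (\<And>k. k \<in> H \<Longrightarrow> cmod (c k - d k) \<le> \<zeta>) \<Longrightarrow> sobolev_dist r c d \<le> e"
    and K: "\<And>k. k \<in> H \<Longrightarrow> (real_of_int k)\<^sup>2 \<le> K"
    and \<delta>\<zeta>: "2 * \<delta> * (4 * pi\<^sup>2 * K) * (U + S * A) + S * (c * (2 * \<delta>) + \<eta>) \<le> \<zeta>"
  shows "\<exists>s. (\<forall>i. s i \<le> T + (real i + 1) * \<delta>) \<and> jump_modulus (sobolev r) T (sobolev_path T u) s \<delta> e"
proof -
  interpret Metric_space "mspace (sobolev r)" "mdist (sobolev r)" by (rule Metric_space_mspace_mdist)
  define all where "all \<longleftrightarrow> \<delta> \<le> \<tau>"
  define J where "J = {real (Suc q) * \<tau> | q. (all \<or> big q) \<and> real (Suc q) * \<tau> \<le> T}"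
  let ?g = "\<lambda>i k. cell_average n k * coef i (fourier_root n k)"
  have g_box: "?g i \<in> box (U + S * A)" if "real i * \<tau> \<le> T" for i
    using path_in_box[OF S U] mass that by blast
  have mono: "real a * \<tau> \<le> real b * \<tau>" if "a \<le> b" for a b using that \<tau> by (simp add: mult_right_mono)
  have "\<exists>s. separated \<delta> s \<and> J \<subseteq> range s \<and> (\<forall>i. s i \<le> T + (real i + 1) * \<delta>)"
  proof (rule finite_separated_sequence)
    show "finite J" unfolding J_def by (rule finite_grid_times[OF \<tau>])
    show "\<delta> \<le> x \<and> x \<le> T" if "x \<in> J" for x
    proof -
      obtain q where q: "x = real (Suc q) * \<tau>" "all \<or> big q" "real (Suc q) * \<tau> \<le> T" using \<open>x \<in> J\<close> by (auto simp: J_def)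
      have "\<tau> \<le> real (Suc q) * \<tau>" using mono[of 1 "Suc q"] by simp
      with q first[of q] \<delta> show ?thesis unfolding all_def by linarith
    qed
    show "x + \<delta> \<le> y" if "x \<in> J" "y \<in> J" "x < y" for x y
    proof -
      obtain q where q: "x = real (Suc q) * \<tau>" "all \<or> big q" using \<open>x \<in> J\<close> by (auto simp: J_def)
      obtain q' where q': "y = real (Suc q') * \<tau>" "all \<or> big q'" "real (Suc q') * \<tau> \<le> T" using \<open>y \<in> J\<close> by (auto simp: J_def)
      have qq: "q < q'" using that(3) q(1) q'(1) mono[of "Suc q'" "Suc q"] by (cases "q < q'") auto
      show ?thesis
      proof (cases all)
        case True
        have "real (Suc q) * \<tau> + \<tau> \<le> real (Suc q') * \<tau>" using mono[of "Suc (Suc q)" "Suc q'"] qq by (simp add: algebra_simps)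
        with True q q' show ?thesis unfolding all_def by linarith
      next
        case False
        \<comment> \<open>The hypothesis measures from the start of the earlier cell. Passing to its
          end loses one step \<tau> < \<delta>, which explains the factor 2.\<close>
        then have "2 * \<delta> < real (Suc q') * \<tau> - real q * \<tau>" using isolated[of q q'] q q' qq by blast
        moreover have "real (Suc q) * \<tau> = real q * \<tau> + \<tau>" by (simp add: algebra_simps)
        ultimately show ?thesis using False q q' unfolding all_def by linarith
      qed
    qed
  qed (use \<delta> T in auto)
  then obtain s where s: "separated \<delta> s" "J \<subseteq> range s" "\<And>i. s i \<le> T + (real i + 1) * \<delta>" by blast
  have main: "sobolev_dist r (?g (grid_index \<tau> (min x T))) (?g (grid_index \<tau> (min y T))) \<le> e"
    if xy: "0 \<le> x" "x \<le> y" "y - x < \<delta>" and side: "\<And>i. s i \<le> x \<longleftrightarrow> s i \<le> y" for x y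
  proof -
    define i where "i = grid_index \<tau> (min x T)"
    define l where "l = grid_index \<tau> (min y T)"
    have il: "i \<le> l" unfolding i_def l_def by (rule grid_index_mono[OF \<tau>]) (use xy in auto)
    have iT: "real i * \<tau> \<le> T" "real l * \<tau> \<le> T"
      using grid_index_bounds(1)[OF \<tau>, of "min x T"] grid_index_bounds(1)[OF \<tau>, of "min y T"] xy T by (auto simp: i_def l_def)
    have none: "\<not> (all \<or> big q)" if "q \<in> {i..<l}" for q
    proof
      assume *: "all \<or> big q"
      note between = no_grid_time_between[OF \<tau> xy(1,2) that[unfolded i_def l_def] T]
      have "real (Suc q) * \<tau> \<in> J" using * between(1) by (auto simp: J_def)
      then obtain i' where "s i' = real (Suc q) * \<tau>" using s(2) by force
      with side[of i'] between(2,3) show False by simp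
    qed
    have "sobolev_dist r (?g l) (?g i) \<le> e"
    proof (rule \<zeta>[OF g_box[OF iT(2)] g_box[OF iT(1)]])
      fix k assume k: "k \<in> H"
      let ?z = "fourier_root n k"
      have S0: "0 \<le> S" using order_trans[OF abs_ge_zero S] .
      have "0 \<le> cmod (?g i 0)" "cmod (?g i 0) \<le> U + S * A" using g_box[OF iT(1)] by (auto simp: box_def)
      then have A0: "0 \<le> U + S * A" by linarith
      have K0: "0 \<le> K" using order_trans[OF zero_le_power2 K[OF k]] .
      \<comment> \<open>An empty range of cells shows that \<eta> is nonnegative.\<close>
      from small[of l l] have \<eta>: "0 \<le> \<eta>" using iT by simp
      have Z: "0 \<le> 2 * \<delta> * (4 * pi\<^sup>2 * K) * (U + S * A)" "0 \<le> S * (c * (2 * \<delta>) + \<eta>)"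
        using \<delta> K0 A0 S0 c \<eta> by auto
      show "cmod (?g l k - ?g i k) \<le> \<zeta>"
      proof (cases "i = l")
        case True
        then have "cmod (?g l k - ?g i k) = 0" by simp
        with Z \<delta>\<zeta> show ?thesis by linarith
      next
        case False
        then have not_all: "\<not> all" using none[of i] il by auto
        \<comment> \<open>Rounding to the grid enlarges a time distance below \<delta> by at most
          one step, and here \<tau> < \<delta>.\<close>
        have gap: "(real l - real i) * \<tau> \<le> 2 * \<delta>"
        proof -
          have "real l * \<tau> \<le> min y T" "min x T < real (Suc i) * \<tau>"
            using grid_index_bounds[OF \<tau>, of "min y T"] grid_index_bounds[OF \<tau>, of "min x T"] xy T by (auto simp: i_def l_def)
          moreover have "min y T - min x T \<le> y - x" using xy by linarith
          moreover have "real (Suc i) * \<tau> = real i * \<tau> + \<tau>" by (simp add: algebra_simps)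
          ultimately have "real l * \<tau> - real i * \<tau> \<le> 2 * \<delta>" using xy(3) not_all unfolding all_def by linarith
          then show ?thesis by (simp add: algebra_simps)
        qed
        have sym: "symbol n ?z \<le> 4 * pi\<^sup>2 * K"
          by (rule order_trans[OF symbol_fourier_root[OF n] mult_left_mono[OF K[OF k]]]) simp
        have sym0: "0 \<le> symbol n ?z" by (rule symbol_nonneg[OF norm_fourier_root])
        have bound: "cmod (coef q ?z) \<le> U + S * A" if "q < l" for q
        proof -
          have "cmod (coef q ?z) \<le> U + S * (\<Sum>q<q. V q)"
            by (rule coef_bound[OF fourier_root_power_n[OF n] norm_fourier_root S U])
          also have "\<dots> \<le> U + S * A"
            using mass[of q] mono[of q l] that iT S0 by (intro add_left_mono mult_left_mono) auto
          finally show ?thesis .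
        qed
        have "cmod (?g l k - ?g i k) = cmod (cell_average n k) * cmod (coef l ?z - coef i ?z)"
          by (simp add: norm_mult[symmetric] right_diff_distrib)
        also have "\<dots> \<le> 1 * cmod (coef l ?z - coef i ?z)"
          using norm_cell_average[OF n] by (intro mult_right_mono) auto
        also have "\<dots> \<le> (real l - real i) * \<tau> * symbol n ?z * (U + S * A) + S * (\<Sum>q\<in>{i..<l}. V q)"
          using coef_increment[OF fourier_root_power_n[OF n] norm_fourier_root S il bound] by simp
        also have "\<dots> \<le> 2 * \<delta> * (4 * pi\<^sup>2 * K) * (U + S * A) + S * (c * (2 * \<delta>) + \<eta>)"
        proof (intro add_mono mult_right_mono mult_left_mono)
          show "(real l - real i) * \<tau> * symbol n ?z \<le> 2 * \<delta> * (4 * pi\<^sup>2 * K)"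
            by (rule mult_mono[OF gap sym]) (use \<delta> sym0 in auto)
          have "(\<Sum>q\<in>{i..<l}. V q) \<le> c * ((real l - real i) * \<tau>) + \<eta>"
            using none by (intro small il iT) auto
          also have "\<dots> \<le> c * (2 * \<delta>) + \<eta>" using gap c by (intro add_right_mono mult_left_mono)
          finally show "(\<Sum>q\<in>{i..<l}. V q) \<le> c * (2 * \<delta>) + \<eta>" .
        qed (use A0 S0 in auto)
        finally show ?thesis using \<delta>\<zeta> by linarith
      qed
    qed
    then show ?thesis
      using Metric_space.commute[OF Metric_space_sobolev[of r], of "?g i" "?g l"] by (simp add: i_def l_def)
  qed
  have "jump_modulus (sobolev r) T (sobolev_path T u) s \<delta> e"
    unfolding jump_modulus_def
  proof (intro conjI allI impI s(1))
    fix x y :: real assume xy: "0 \<le> x" "0 \<le> y" "\<bar>x - y\<bar> < \<delta>" and side: "\<forall>i. (s i \<le> x) = (s i \<le> y)"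
    have "sobolev_dist r (?g (grid_index \<tau> (min x T))) (?g (grid_index \<tau> (min y T))) \<le> e"
    proof (cases "x \<le> y")
      case True
      then show ?thesis using xy side by (intro main) auto
    next
      case False
      then have "sobolev_dist r (?g (grid_index \<tau> (min y T))) (?g (grid_index \<tau> (min x T))) \<le> e"
        using xy side by (intro main) auto
      then show ?thesis
        using Metric_space.commute[OF Metric_space_sobolev[of r], of "?g (grid_index \<tau> (min y T))"] by simp
    qed
    then show "mdist (sobolev r) (sobolev_path T u (min x T)) (sobolev_path T u (min y T)) \<le> e"
      using xy T by (simp add: sobolev_path_eq)
  qed
  with s(3) show ?thesis by blast
qed

end

section \<open>Measurability of the discrete paths\<close>

text \<open>The next time level is given only implicitly. In Fourier space the implicit factor is a
  number at least 1, so one may divide by it and invert the transform; the resulting explicit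
  formula is measurable by induction on time.\<close>

lemma scheme_measurable:
  assumes path: "\<And>w. w \<in> space M \<Longrightarrow> scheme_path \<theta> \<sigma> u0 n \<tau> (\<lambda>B. L B w) (u w) \<rho> \<epsilon>"
    and L: "\<And>i j. j \<in> {0..<int n} \<Longrightarrow> L (cell n \<tau> i j) \<in> borel_measurable M"
    and \<sigma>: "\<sigma> \<in> borel_measurable borel" and j: "j < n"
  shows "(\<lambda>w. u w (real i * \<tau>) (grid_point n (int j))) \<in> borel_measurable M"
proof -
  define X where "X w i j = u w (real i * \<tau>) (grid_point n j)" for w i j
  define coef where "coef w i z = (\<Sum>j<n. of_real (X w i (int j)) * z ^ j) / of_nat n" for w i and z :: complex
  define force where "force w i z = (\<Sum>j<n. of_real (\<sigma> (X w i (int j)) * L (cell n \<tau> i (int j)) w) * z ^ j)" for w i and z :: complex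
  have "(\<lambda>w. X w i (int j)) \<in> borel_measurable M" if "j < n" for j
    using that
  proof (induction i arbitrary: j)
    case 0
    have "X w 0 (int j) = u0 (grid_point n (int j))" if "w \<in> space M" for w
    proof -
      interpret S: scheme_path \<theta> \<sigma> u0 n \<tau> "\<lambda>B. L B w" "u w" \<rho> \<epsilon> by (rule path[OF that])
      show ?thesis using S.X_0[of "int j"] 0 by (simp add: X_def S.X_def)
    qed
    then show ?case by (simp cong: measurable_cong)
  next
    case (Suc i)
    have [measurable]: "(\<lambda>w. X w i (int j)) \<in> borel_measurable M" if "j < n" for j by (rule Suc.IH[OF that])
    have [measurable]: "(\<lambda>w. L (cell n \<tau> i (int j)) w) \<in> borel_measurable M" if "j < n" for j using L that by simp
    note [measurable] = \<sigma>
    have c[measurable]: "(\<lambda>w. coef w i z) \<in> borel_measurable M" for z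
      unfolding coef_def by (intro borel_measurable_divide borel_measurable_sum) auto
    have f[measurable]: "(\<lambda>w. force w i z) \<in> borel_measurable M" for z
      unfolding force_def by (intro borel_measurable_sum) auto
    let ?z = "\<lambda>k. fourier_root n (int k)"
    let ?Y = "\<lambda>w. Re (\<Sum>k<n. (of_real (1 - (1 - \<theta>) * \<tau> * symbol n (?z k)) * coef w i (?z k) + force w i (?z k)) /
        of_real (1 + \<theta> * \<tau> * symbol n (?z k)) * cnj (?z k) ^ j)"
    have "X w (Suc i) (int j) = ?Y w" if w: "w \<in> space M" for w
    proof -
      interpret S: scheme_path \<theta> \<sigma> u0 n \<tau> "\<lambda>B. L B w" "u w" \<rho> \<epsilon> by (rule path[OF w])
      have X_eq: "S.X = X w" by (simp add: fun_eq_iff S.X_def X_def)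
      have coef_eq: "S.coef = coef w" by (simp add: fun_eq_iff S.coef_def coef_def X_eq)
      have force_eq: "S.force = force w" by (simp add: fun_eq_iff S.force_def force_def X_eq)
      have step: "coef w (Suc i) (?z k) = (of_real (1 - (1 - \<theta>) * \<tau> * symbol n (?z k)) * coef w i (?z k) + force w i (?z k)) /
          of_real (1 + \<theta> * \<tau> * symbol n (?z k))" for k
      proof -
        have "1 + \<theta> * \<tau> * symbol n (?z k) \<noteq> 0"
          using S.implicit_ge_1[OF norm_fourier_root[of n "int k"]] by linarith
        then have nz: "of_real (1 + \<theta> * \<tau> * symbol n (?z k)) \<noteq> (0::complex)" by (simp only: of_real_eq_0_iff not_False_eq_True)
        have eq: "of_real (1 + \<theta> * \<tau> * symbol n (?z k)) * coef w (Suc i) (?z k) =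
            of_real (1 - (1 - \<theta>) * \<tau> * symbol n (?z k)) * coef w i (?z k) + force w i (?z k)"
          using S.coef_Suc[OF fourier_root_power_n[OF S.n, of "int k"] norm_fourier_root, of i]
          unfolding coef_eq force_eq .
        show ?thesis unfolding nonzero_eq_divide_eq[OF nz] eq[symmetric] by (rule mult.commute)
      qed
      have "complex_of_real (X w (Suc i) (int j)) = (\<Sum>k<n. coef w (Suc i) (?z k) * cnj (?z k) ^ j)"
        using S.inversion[OF Suc.prems, of "Suc i"] unfolding X_eq coef_eq .
      then have "Re (complex_of_real (X w (Suc i) (int j))) = ?Y w" unfolding step by (rule arg_cong)
      then show ?thesis by (simp only: Re_complex_of_real)
    qed
    moreover have "?Y \<in> borel_measurable M" by measurable
    ultimately show ?case by (subst measurable_cong[of M _ ?Y]) auto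
  qed
  from this[OF j] show ?thesis by (simp add: X_def)
qed

text \<open>The path depends continuously on the values of the scheme at the grid points.\<close>

definition step_map :: "nat \<Rightarrow> real \<Rightarrow> real \<Rightarrow> (nat \<times> nat \<Rightarrow> real) \<Rightarrow> real \<Rightarrow> int \<Rightarrow> complex" where
  "step_map n \<tau> T x = (\<lambda>t\<in>{0..T}. \<lambda>k. cell_average n k *
     ((\<Sum>j<n. of_real (x (grid_index \<tau> t, j)) * fourier_root n k ^ j) / of_nat n))"

lemma step_coefficient_le:
  assumes n: "0 < n"
  shows "cmod (cell_average n k * ((\<Sum>j<n. of_real (a j) * fourier_root n k ^ j) / of_nat n)) \<le> (\<Sum>j<n. \<bar>a j\<bar>) / n"
proof -
  have "cmod (\<Sum>j<n. of_real (a j) * fourier_root n k ^ j) \<le> (\<Sum>j<n. \<bar>a j\<bar>)"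
    by (rule order_trans[OF norm_sum]) (simp add: norm_mult norm_power norm_fourier_root)
  then have "cmod ((\<Sum>j<n. of_real (a j) * fourier_root n k ^ j) / of_nat n) \<le> (\<Sum>j<n. \<bar>a j\<bar>) / n"
    by (simp add: norm_divide divide_right_mono)
  then show ?thesis
    unfolding norm_mult using mult_mono[OF norm_cell_average[OF n, of k]] by fastforce
qed

lemma step_map_carrier:
  assumes T: "0 < T" and \<tau>: "0 < \<tau>" and n: "0 < n" and r: "r < - 1/2"
  shows "step_map n \<tau> T x \<in> skorohod_carrier (sobolev r) T"
proof -
  define A where "A = (\<Sum>i\<le>grid_index \<tau> T. (\<Sum>j<n. \<bar>x (i, j)\<bar>) / n)"
  have A0: "0 \<le> A" unfolding A_def by (intro sum_nonneg divide_nonneg_nonneg) auto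
  have "(\<lambda>k. cell_average n k * ((\<Sum>j<n. of_real (x (i, j)) * fourier_root n k ^ j) / of_nat n)) \<in> box A"
    if i: "real i * \<tau> \<le> T" for i
  proof -
    have "real i \<le> T / \<tau>" using i \<tau> by (simp add: field_simps)
    then have "i \<le> grid_index \<tau> T" unfolding grid_index_def by (simp add: le_nat_floor)
    then have "(\<Sum>j<n. \<bar>x (i, j)\<bar>) / n \<le> A"
      unfolding A_def by (intro member_le_sum[of i _ "\<lambda>i. (\<Sum>j<n. \<bar>x (i, j)\<bar>) / n"]) (auto intro!: divide_nonneg_nonneg sum_nonneg)
    then show ?thesis using step_coefficient_le[OF n, of _ "\<lambda>j. x (i, j)"] by (auto simp: box_def intro: order_trans)
  qed
  from step_path_carrier[OF T \<tau> compactin_box[OF r A0] this] show ?thesis by (simp add: step_map_def)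
qed

lemma step_map_dist_le:
  assumes T: "0 < T" and \<tau>: "0 < \<tau>" and n: "0 < n" and r: "r < - 1/2" and \<zeta>: "0 \<le> \<zeta>"
    and close: "\<And>i j. i \<le> grid_index \<tau> T \<Longrightarrow> j < n \<Longrightarrow> \<bar>x (i, j) - y (i, j)\<bar> \<le> \<zeta>"
  shows "skorohod_dist (sobolev r) T (step_map n \<tau> T x) (step_map n \<tau> T y) \<le> \<zeta> * sqrt (total_weight r)"
proof (intro skorohod_dist_le step_map_carrier T \<tau> n r)
  have W: "0 \<le> total_weight r" using sum_sobolev_weight_le[OF r, of "{}"] by simp
  have "sobolev_dist r (step_map n \<tau> T x t) (step_map n \<tau> T y t) \<le> \<zeta> * sqrt (total_weight r)" if t: "t \<in> {0..T}" for t
    unfolding sobolev_dist_def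
  proof (rule sobolev_norm_le_sup(2)[OF r])
    fix k
    have i: "grid_index \<tau> t \<le> grid_index \<tau> T" using t by (intro grid_index_mono[OF \<tau>]) auto
    have "step_map n \<tau> T x t k - step_map n \<tau> T y t k =
        cell_average n k * ((\<Sum>j<n. of_real (x (grid_index \<tau> t, j) - y (grid_index \<tau> t, j)) * fourier_root n k ^ j) / of_nat n)"
      using t by (simp add: step_map_def left_diff_distrib sum_subtractf diff_divide_distrib right_diff_distrib)
    also have "cmod \<dots> \<le> (\<Sum>j<n. \<bar>x (grid_index \<tau> t, j) - y (grid_index \<tau> t, j)\<bar>) / n"
      by (rule step_coefficient_le[OF n])
    also have "\<dots> \<le> (\<Sum>j<n. \<zeta>) / n" using close[OF i] by (intro divide_right_mono sum_mono) auto
    also have "\<dots> = \<zeta>" using n by simp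
    finally show "cmod (step_map n \<tau> T x t k - step_map n \<tau> T y t k) \<le> \<zeta>" .
  qed
  then show "skorohod_close (sobolev r) T (step_map n \<tau> T x) (step_map n \<tau> T y) (\<zeta> * sqrt (total_weight r))"
    unfolding skorohod_close_def using time_change_id T \<zeta> W by (intro exI[of _ "\<lambda>t. t"]) auto
qed

text \<open>The path depends on finitely many grid values, and continuously so for the product
  topology, by \<open>step_map_dist_le\<close>. Preimages of open sets are therefore open, and the
  index set is countable, so coordinatewise measurability of \<open>Z\<close> suffices.\<close>

lemma step_map_measurable:
  assumes T: "0 < T" and \<tau>: "0 < \<tau>" and n: "0 < n" and r: "r < - 1/2"
    and Z: "\<And>p. (\<lambda>w. Z w p) \<in> borel_measurable M"
  shows "(\<lambda>w. step_map n \<tau> T (Z w)) \<in> M \<rightarrow>\<^sub>M borel_of (skorohod_topology (sobolev r) T)"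
proof -
  let ?X = "skorohod_topology (sobolev r) T"
  interpret Sk: Metric_space "skorohod_carrier (sobolev r) T" "skorohod_dist (sobolev r) T" by (rule Metric_space_skorohod[OF T])
  have topo: "?X = Sk.mtopology"
    by (simp add: skorohod_topology_def mtopology_of_def Sk.mspace_metric Sk.mdist_metric)
  have W: "0 \<le> total_weight r" using sum_sobolev_weight_le[OF r, of "{}"] by simp
  have [measurable]: "Z \<in> borel_measurable M" by (rule measurable_coordinatewise_then_product) (rule Z)
  have "open (step_map n \<tau> T -` U)" if U: "openin ?X U" for U
  proof (subst open_subopen, intro ballI)
    fix x assume "x \<in> step_map n \<tau> T -` U"
    then have "step_map n \<tau> T x \<in> U" by simp
    then obtain e where e: "0 < e" "Sk.mball (step_map n \<tau> T x) e \<subseteq> U"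
      using U unfolding topo Sk.openin_mtopology by blast
    define \<zeta> where "\<zeta> = e / (2 * (sqrt (total_weight r) + 1))"
    have \<zeta>: "0 < \<zeta>" using e W by (simp add: \<zeta>_def add_nonneg_pos)
    have \<zeta>e: "\<zeta> * sqrt (total_weight r) < e"
    proof -
      have "\<zeta> * sqrt (total_weight r) \<le> \<zeta> * (sqrt (total_weight r) + 1)" using \<zeta> by (intro mult_left_mono) auto
      also have "\<dots> = e / 2"
      proof -
        have "0 < sqrt (total_weight r) + 1" using W by (simp add: add_nonneg_pos)
        then show ?thesis by (simp add: \<zeta>_def field_simps)
      qed
      finally show ?thesis using e by simp
    qed
    define I where "I = {..grid_index \<tau> T} \<times> {..<n}"
    define O' where "O' = (\<Inter>p\<in>I. (\<lambda>y. y p) -` ball (x p) \<zeta>)"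
    have "open O'"
      unfolding O'_def by (intro open_INT ballI open_vimage open_ball continuous_on_product_coordinates) (simp add: I_def)
    moreover have "x \<in> O'" using \<zeta> by (simp add: O'_def)
    moreover have "O' \<subseteq> step_map n \<tau> T -` U"
    proof
      fix y assume y: "y \<in> O'"
      have "skorohod_dist (sobolev r) T (step_map n \<tau> T x) (step_map n \<tau> T y) \<le> \<zeta> * sqrt (total_weight r)"
      proof (rule step_map_dist_le[OF T \<tau> n r])
        fix i j assume "i \<le> grid_index \<tau> T" "j < n"
        then have "y (i, j) \<in> ball (x (i, j)) \<zeta>" using y by (auto simp: O'_def I_def)
        then show "\<bar>x (i, j) - y (i, j)\<bar> \<le> \<zeta>" by (simp add: dist_real_def)
      qed (use \<zeta> in simp)
      with \<zeta>e have "step_map n \<tau> T y \<in> Sk.mball (step_map n \<tau> T x) e"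
        using step_map_carrier[OF T \<tau> n r] by (simp add: Sk.in_mball)
      with e(2) show "y \<in> step_map n \<tau> T -` U" by blast
    qed
    ultimately show "\<exists>T'. open T' \<and> x \<in> T' \<and> T' \<subseteq> step_map n \<tau> T -` U" by blast
  qed
  note opn = this
  show ?thesis
    unfolding borel_of_def
  proof (rule measurable_measure_of)
    show "{U. openin ?X U} \<subseteq> Pow (topspace ?X)" using openin_subset by fastforce
    show "(\<lambda>w. step_map n \<tau> T (Z w)) \<in> space M \<rightarrow> topspace ?X"
      using step_map_carrier[OF T \<tau> n r] T by simp
    fix U assume "U \<in> {U. openin ?X U}"
    then have "step_map n \<tau> T -` U \<in> sets borel" using opn by auto
    then have "Z -` (step_map n \<tau> T -` U) \<inter> space M \<in> sets M" by measurable
    then show "(\<lambda>w. step_map n \<tau> T (Z w)) -` U \<inter> space M \<in> sets M" by (simp add: vimage_def)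
  qed
qed

section \<open>Tightness of the discrete paths\<close>

context finite_variation_noise
begin

definition time_cell :: "real \<Rightarrow> nat \<Rightarrow> real set" where
  "time_cell \<tau> q = {real q * \<tau>..<real (Suc q) * \<tau>}"

text \<open>Cutting at positive times keeps the first cell inside the space of the random
  measure.\<close>

definition big_jump :: "'w \<Rightarrow> real \<Rightarrow> real \<Rightarrow> nat \<Rightarrow> bool" where
  "big_jump w \<tau> e q \<longleftrightarrow> emeasure (mu w) ((time_cell \<tau> q \<inter> {0<..}) \<times> {0..1} \<times> {z. e < \<bar>z\<bar>}) \<noteq> 0"

lemma sets_big: "S \<in> sets borel \<Longrightarrow> w \<in> space M \<Longrightarrow> (S \<inter> {0<..}) \<times> {0..1} \<times> {z. e < \<bar>z\<bar>} \<in> sets (mu w)"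
  unfolding sets_mu by (rule emeasure_intensity(1)) auto

lemma time_cell_sum_le:
  assumes w: "w \<in> space M" and \<tau>: "0 < \<tau>" and il: "i \<le> l" and lT: "real l * \<tau> \<le> T" and Z: "Z \<in> sets borel"
  shows "(\<Sum>q\<in>{i..<l}. jump_mass (mu w) (time_cell \<tau> q) {0..1} Z) \<le> jump_mass (mu w) {0<..T} {0..1} Z"
proof (rule jump_mass_sum_le[OF sets_mu[OF w]])
  fix t x :: real assume t: "0 < t"
  have "(\<Sum>q\<in>{i..<l}. indicator (time_cell \<tau> q) t :: ennreal) = indicator {real i * \<tau>..<real l * \<tau>} t"
    unfolding time_cell_def by (rule sum_indicator_intervals) (use \<tau> il in auto)
  also have "\<dots> \<le> indicator {0<..T} t" using t lT by (auto simp: indicator_def)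
  finally show "(\<Sum>q\<in>{i..<l}. indicator (time_cell \<tau> q) t * indicator {0..1} x) \<le> (indicator {0<..T} t * indicator {0..1} x :: ennreal)"
    unfolding sum_distrib_right[symmetric] by (rule mult_right_mono) simp
qed (auto simp: time_cell_def Z)

lemma no_big_jump:
  assumes w: "w \<in> space M" and no: "\<not> big_jump w \<tau> e q"
  shows "jump_mass (mu w) (time_cell \<tau> q) {0..1} UNIV \<le> jump_mass (mu w) (time_cell \<tau> q) {0..1} {z. \<bar>z\<bar> \<le> e}"
  unfolding jump_mass_def
proof (rule nn_integral_mono_AE)
  let ?A = "(time_cell \<tau> q \<inter> {0<..}) \<times> {0..1} \<times> {z. e < \<bar>z\<bar>}"
  have "?A \<in> null_sets (mu w)" using no sets_big[OF _ w] by (simp add: null_sets_def big_jump_def time_cell_def)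
  then have "AE p in mu w. p \<notin> ?A" by (rule AE_not_in)
  then show "AE p in mu w. indicator (time_cell \<tau> q) (fst p) * indicator {0..1} (fst (snd p)) * indicator UNIV (snd (snd p)) * ennreal \<bar>snd (snd p)\<bar>
      \<le> indicator (time_cell \<tau> q) (fst p) * indicator {0..1} (fst (snd p)) * indicator {z. \<bar>z\<bar> \<le> e} (snd (snd p)) * ennreal \<bar>snd (snd p)\<bar>"
    using AE_space
  proof eventually_elim
    case (elim p)
    then have "p \<in> {0<..} \<times> {0..1} \<times> UNIV" unfolding sets_eq_imp_space_eq[OF sets_mu[OF w]] space_intensity by simp
    with elim(1) show ?case by (cases p) (auto simp: indicator_def)
  qed
qed

text \<open>The random measure takes values in the natural numbers and infinity, so a nonzero count
  is at least 1.\<close>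

lemma big_jump_ge_1:
  assumes "w \<in> space M" "big_jump w \<tau> e q"
  shows "1 \<le> emeasure (mu w) ((time_cell \<tau> q \<inter> {0<..}) \<times> {0..1} \<times> {z. e < \<bar>z\<bar>})"
proof -
  let ?A = "(time_cell \<tau> q \<inter> {0<..}) \<times> {0..1} \<times> {z. e < \<bar>z\<bar>}"
  have "?A \<in> sets (intensity lam)" using sets_big[OF _ assms(1)] sets_mu[OF assms(1)] by (simp add: time_cell_def)
  then have "emeasure (mu w) ?A \<in> insert \<infinity> (range of_nat)"
    by (rule prm[unfolded poisson_random_measure_def, THEN conjunct1, rule_format, OF assms(1), THEN conjunct2, rule_format])
  then consider "emeasure (mu w) ?A = \<infinity>" | k where "emeasure (mu w) ?A = of_nat k" by auto
  then show ?thesis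
  proof cases
    case (2 k)
    with assms(2) have "1 \<le> k" by (cases k) (auto simp: big_jump_def)
    then show ?thesis using 2 by simp
  qed simp
qed

lemma big_jump_first:
  assumes w: "w \<in> space M" and reg: "regular_jumps (mu w) T \<delta> \<eta> e" and big: "big_jump w \<tau> e q"
  shows "\<delta> < real (Suc q) * \<tau>"
proof (rule ccontr)
  assume "\<not> ?thesis"
  then have "(time_cell \<tau> q \<inter> {0<..}) \<subseteq> {0<..\<delta>}" by (auto simp: time_cell_def)
  then have "emeasure (mu w) ((time_cell \<tau> q \<inter> {0<..}) \<times> {0..1} \<times> {z. e < \<bar>z\<bar>}) \<le> emeasure (mu w) ({0<..\<delta>} \<times> {0..1} \<times> {z. e < \<bar>z\<bar>})"
  proof (intro emeasure_mono)
    have "{0<..\<delta>} \<inter> {0<..} = {0<..\<delta>}" by auto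
    then show "{0<..\<delta>} \<times> {0..1} \<times> {z. e < \<bar>z\<bar>} \<in> sets (mu w)" using sets_big[OF _ w, of "{0<..\<delta>}" e] by simp
  qed auto
  then show False using reg big by (simp add: regular_jumps_def big_jump_def)
qed

text \<open>Otherwise a single window of length \<delta> would contain both cells, which are
  disjoint, and hence at least two large jumps.\<close>

lemma big_jump_isolated:
  assumes w: "w \<in> space M" and reg: "regular_jumps (mu w) T \<delta> \<eta> e" and big: "big_jump w \<tau> e q" "big_jump w \<tau> e q'"
    and qq: "q < q'" and \<tau>: "0 < \<tau>" and T: "real (Suc q') * \<tau> \<le> T"
  shows "\<delta> < real (Suc q') * \<tau> - real q * \<tau>"
proof (rule ccontr)
  assume near: "\<not> ?thesis"
  let ?A = "\<lambda>q. (time_cell \<tau> q \<inter> {0<..}) \<times> {0..1} \<times> {z. e < \<bar>z\<bar>}" and ?x = "real q * \<tau>"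
  let ?W = "({?x..?x + \<delta>} \<inter> {0<..}) \<times> {0..1} \<times> {z. e < \<bar>z\<bar>}"
  have mono: "real a * \<tau> \<le> real b * \<tau>" if "a \<le> b" for a b using that \<tau> by (simp add: mult_right_mono)
  have m: "?x \<le> real (Suc q) * \<tau>" "real (Suc q) * \<tau> \<le> real q' * \<tau>" "real q' * \<tau> \<le> real (Suc q') * \<tau>"
    using qq by (intro mono; simp)+
  have "0 \<le> ?x" "?x \<le> T" using m T \<tau> by (simp, linarith)
  then have x: "?x \<in> {0..T}" by simp
  have s: "?A q \<in> sets (mu w)" "?A q' \<in> sets (mu w)" "?W \<in> sets (mu w)"
    using sets_big[OF _ w] by (auto simp: time_cell_def)
  have "?A q \<inter> ?A q' = {}" using m by (auto simp: time_cell_def)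
  then have "emeasure (mu w) (?A q) + emeasure (mu w) (?A q') = emeasure (mu w) (?A q \<union> ?A q')"
    by (intro plus_emeasure s)
  also have "\<dots> \<le> emeasure (mu w) ?W"
    using m near s by (intro emeasure_mono) (auto simp: time_cell_def)
  also have "\<dots> \<le> 1" using reg x by (simp add: regular_jumps_def)
  finally have "emeasure (mu w) (?A q) + emeasure (mu w) (?A q') \<le> 1" .
  moreover have "1 + 1 \<le> emeasure (mu w) (?A q) + emeasure (mu w) (?A q')"
    by (intro add_mono big_jump_ge_1 w big)
  ultimately have "(1 + 1 :: ennreal) \<le> 1" by (rule order_trans[rotated])
  then show False by (simp add: one_add_one)
qed

text \<open>Serves two purposes: \<open>Z = UNIV\<close> bounds the total noise mass up to
  \<open>T\<close>, and the set of small jumps as \<open>Z\<close> bounds the mass over a range of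
  slabs without large jumps.\<close>

lemma scheme_mass_le:
  assumes w: "w \<in> space M" and sp: "scheme_path \<theta> \<sigma> u0 n \<tau> (\<lambda>B. L B w) v \<rho> \<epsilon>"
    and cells: "cells_bounded w n \<tau>"
    and il: "i \<le> l" and lT: "real l * \<tau> \<le> T" and Z: "Z \<in> sets borel" and A: "0 \<le> A"
    and mass: "jump_mass (mu w) {0<..T} {0..1} Z \<le> ennreal A"
    and only: "\<And>q. q \<in> {i..<l} \<Longrightarrow> jump_mass (mu w) (time_cell \<tau> q) {0..1} UNIV \<le> jump_mass (mu w) (time_cell \<tau> q) {0..1} Z"
  shows "(\<Sum>q\<in>{i..<l}. scheme_path.V n \<tau> (\<lambda>B. L B w) q) \<le> (\<bar>b\<bar> + moment) * ((real l - real i) * \<tau>) + A"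
proof -
  interpret scheme_path \<theta> \<sigma> u0 n \<tau> "\<lambda>B. L B w" v \<rho> \<epsilon> by (rule sp)
  let ?c = "\<bar>b\<bar> + moment"
  have c: "0 \<le> ?c" using moment(2) by simp
  have V0: "0 \<le> V q" for q by (simp add: V_def sum_nonneg)
  have "ennreal (\<Sum>q\<in>{i..<l}. V q) = (\<Sum>q\<in>{i..<l}. ennreal (V q))" using V0 by simp
  also have "\<dots> \<le> (\<Sum>q\<in>{i..<l}. ennreal (?c * \<tau>) + jump_mass (mu w) (time_cell \<tau> q) {0..1} Z)"
  proof (rule sum_mono)
    fix q assume q: "q \<in> {i..<l}"
    have "ennreal (V q) = (\<Sum>j\<in>{0..<int n}. ennreal \<bar>L (cell n \<tau> q j) w\<bar>)" unfolding V_def by simp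
    also have "\<dots> \<le> ennreal (?c * \<tau>) + jump_mass (mu w) (time_cell \<tau> q) {0..1} UNIV"
      using cells unfolding cells_bounded_def cell_def time_cell_def by blast
    also have "\<dots> \<le> ennreal (?c * \<tau>) + jump_mass (mu w) (time_cell \<tau> q) {0..1} Z"
      by (intro add_left_mono only q)
    finally show "ennreal (V q) \<le> ennreal (?c * \<tau>) + jump_mass (mu w) (time_cell \<tau> q) {0..1} Z" .
  qed
  also have "\<dots> = (\<Sum>q\<in>{i..<l}. ennreal (?c * \<tau>)) + (\<Sum>q\<in>{i..<l}. jump_mass (mu w) (time_cell \<tau> q) {0..1} Z)" by (rule sum.distrib)
  also have "\<dots> \<le> ennreal (?c * ((real l - real i) * \<tau>)) + ennreal A"
  proof (rule add_mono)
    have "(\<Sum>q\<in>{i..<l}. ennreal (?c * \<tau>)) = ennreal (\<Sum>q\<in>{i..<l}. ?c * \<tau>)" using c \<tau> by (intro sum_ennreal) auto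
    also have "(\<Sum>q\<in>{i..<l}. ?c * \<tau>) = ?c * ((real l - real i) * \<tau>)" using il by (simp add: of_nat_diff)
    finally show "(\<Sum>q\<in>{i..<l}. ennreal (?c * \<tau>)) \<le> ennreal (?c * ((real l - real i) * \<tau>))" by simp
    show "(\<Sum>q\<in>{i..<l}. jump_mass (mu w) (time_cell \<tau> q) {0..1} Z) \<le> ennreal A"
      by (rule order_trans[OF time_cell_sum_le[OF w \<tau> il lT Z] mass])
  qed
  also have "\<dots> = ennreal (?c * ((real l - real i) * \<tau>) + A)"
    using c \<tau> il A by (intro ennreal_plus[symmetric]) auto
  finally show ?thesis using c \<tau> il A by (subst (asm) ennreal_le_iff) auto
qed

text \<open>Level \<open>k\<close> asks for modulus 1 / Suc k outside an event of probability
  \<open>\<epsilon>0 * (1/2) ^ Suc (Suc k)\<close>; these events add up to \<epsilon>0 / 2, and the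
  other half is spent on the total jump mass. The null sets depending on (n, \<tau>) are not put
  into \<open>B\<close> but stay inside the almost sure statement.\<close>

lemma paths_tight:
  assumes T: "0 < T" and r: "r < - 1/2" and \<theta>: "0 \<le> \<theta>" "\<theta> \<le> 1" and \<epsilon>0: "0 < \<epsilon>0"
    and S: "\<And>x. \<bar>\<sigma> x\<bar> \<le> S" and U: "\<And>x. x \<in> {0..1} \<Longrightarrow> \<bar>u0 x\<bar> \<le> U"
    and scheme: "\<And>n \<tau> w. (n, \<tau>) \<in> admissible \<theta> \<rho> \<epsilon> \<Longrightarrow> w \<in> space M \<Longrightarrow>
      fully_discrete_scheme \<theta> \<sigma> u0 n \<tau> (\<lambda>B. L B w) (u n \<tau> w)"
  shows "\<exists>K B. compactin (skorohod_topology (sobolev r) T) K \<and> B \<in> sets M \<and> prob B \<le> \<epsilon>0 \<and>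
    (\<forall>(n, \<tau>)\<in>admissible \<theta> \<rho> \<epsilon>. AE w in M. w \<notin> B \<longrightarrow> sobolev_path T (u n \<tau> w) \<in> K)"
proof -
  let ?c = "\<bar>b\<bar> + moment"
  have c: "0 \<le> ?c" using moment(2) by simp
  have S0: "0 \<le> S" using order_trans[OF abs_ge_zero S] .
  have U0: "0 \<le> U" using order_trans[OF abs_ge_zero U[of 0]] by simp
  obtain A0 where A0: "0 < A0" "prob {w \<in> space M. \<not> jump_mass (mu w) {0<..T} {0..1} UNIV \<le> ennreal A0} \<le> \<epsilon>0 / 2"
    using total_mass_tight[OF T half_gt_zero[OF \<epsilon>0]] by blast
  define A where "A = ?c * T + A0"
  define A' where "A' = U + S * A"
  have A': "0 \<le> A" "0 \<le> A'" using c T A0 S0 U0 by (simp_all add: A_def A'_def)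
  \<comment> \<open>Step sizes and path are quantified inside, so that \<delta> and \<open>B\<close>
    depend on the level only.\<close>
  define good where "good k \<delta> B \<longleftrightarrow> 0 < \<delta> \<and> B \<in> sets M \<and> prob B \<le> \<epsilon>0 * (1/2) ^ Suc (Suc k) \<and>
    (\<forall>w\<in>space M - B. jump_mass (mu w) {0<..T} {0..1} UNIV \<le> ennreal A0 \<longrightarrow>
      (\<forall>n \<tau> v. scheme_path \<theta> \<sigma> u0 n \<tau> (\<lambda>B. L B w) v \<rho> \<epsilon> \<longrightarrow> cells_bounded w n \<tau> \<longrightarrow>
        (\<exists>s. (\<forall>i. s i \<le> T + (real i + 1) * \<delta>) \<and>
          jump_modulus (sobolev r) T (sobolev_path T v) s \<delta> (1 / real (Suc k)))))" for k \<delta> B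
  have level: "\<exists>\<delta> B. good k \<delta> B" for k
  proof -
    have e: "0 < 1 / real (Suc k)" by simp
    from box_dist_small[OF r e A'(2)] obtain H \<zeta> where H: "finite H" "0 < \<zeta>"
      "\<forall>c\<in>box A'. \<forall>d\<in>box A'. (\<forall>k\<in>H. cmod (c k - d k) \<le> \<zeta>) \<longrightarrow> sobolev_dist r c d \<le> 1 / real (Suc k)"
      by (elim exE conjE)
    define K where "K = (\<Sum>k\<in>H. (real_of_int k)\<^sup>2)"
    have K: "(real_of_int k)\<^sup>2 \<le> K" if "k \<in> H" for k unfolding K_def using H(1) that by (intro member_le_sum) auto
    have K0: "0 \<le> K" by (simp add: K_def sum_nonneg)
    \<comment> \<open>Half of \<zeta> is reserved for the small jumps, scaled by the bound
      \<open>S\<close>; S + 1 avoids division by 0.\<close>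
    define \<eta> where "\<eta> = \<zeta> / (2 * (S + 1))"
    have \<eta>: "0 < \<eta>" "S * \<eta> \<le> \<zeta> / 2"
    proof -
      show "0 < \<eta>" using H(2) S0 by (simp add: \<eta>_def)
      have "S * \<eta> \<le> (S + 1) * \<eta>" using \<open>0 < \<eta>\<close> by (intro mult_right_mono) auto
      also have "\<dots> = \<zeta> / 2" using S0 by (simp add: \<eta>_def field_simps)
      finally show "S * \<eta> \<le> \<zeta> / 2" .
    qed
    \<comment> \<open>The coefficient of \<delta> in the increment of a mode in \<open>H\<close>,
      from diffusion and from drift, plus 1 for positivity.\<close>
    define R where "R = 4 * pi\<^sup>2 * K * A' + S * ?c + 1"
    have R: "1 \<le> R" using K0 A' S0 c by (simp add: R_def)
    have pos: "0 < \<epsilon>0 * (1/2) ^ Suc (Suc k)" "0 < \<zeta> / (2 * R)" using \<epsilon>0 H(2) R by auto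
    obtain \<delta> e B where \<delta>: "0 < \<delta>" "\<delta> \<le> \<zeta> / (2 * R)" and B: "B \<in> sets M" "prob B \<le> \<epsilon>0 * (1/2) ^ Suc (Suc k)"
      "\<And>w. w \<in> space M - B \<Longrightarrow> regular_jumps (mu w) T \<delta> \<eta> e"
      using regular_jumps_likely[OF T \<eta>(1) pos] by blast
    have \<delta>R: "\<delta> * R \<le> \<zeta> / 2" using \<delta>(2) R by (simp add: field_simps)
    have \<delta>\<zeta>: "2 * (\<delta> / 2) * (4 * pi\<^sup>2 * K) * (U + S * A) + S * (?c * (2 * (\<delta> / 2)) + \<eta>) \<le> \<zeta>"
    proof -
      have "2 * (\<delta> / 2) * (4 * pi\<^sup>2 * K) * (U + S * A) + S * (?c * (2 * (\<delta> / 2)) + \<eta>) = \<delta> * R - \<delta> + S * \<eta>"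
        unfolding A'_def[symmetric] by (simp add: R_def algebra_simps)
      then show ?thesis using \<delta>R \<eta>(2) \<delta>(1) by linarith
    qed
    show ?thesis
      unfolding good_def
    \<comment> \<open>\<open>path_modulus\<close> needs gaps exceeding twice its parameter, while
      \<open>regular_jumps\<close> separates the jumps by \<delta>.\<close>
    proof (intro exI[of _ "\<delta> / 2"] exI[of _ B] conjI ballI impI allI B(1,2))
      fix w n \<tau> v
      assume w: "w \<in> space M - B" and mass: "jump_mass (mu w) {0<..T} {0..1} UNIV \<le> ennreal A0"
        and sp: "scheme_path \<theta> \<sigma> u0 n \<tau> (\<lambda>B. L B w) v \<rho> \<epsilon>"
        and cells: "cells_bounded w n \<tau>"
      have ws: "w \<in> space M" using w by simp
      note reg = B(3)[OF w]
      interpret scheme_path \<theta> \<sigma> u0 n \<tau> "\<lambda>B. L B w" v \<rho> \<epsilon> by (rule sp)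
      show "\<exists>s. (\<forall>i. s i \<le> T + (real i + 1) * (\<delta> / 2)) \<and>
          jump_modulus (sobolev r) T (sobolev_path T v) s (\<delta> / 2) (1 / real (Suc k))"
      proof (rule path_modulus[OF T r S U, where big = "big_jump w \<tau> e" and H = H and \<zeta> = \<zeta> and K = K and A = A and c = ?c and \<eta> = \<eta>])
        fix l assume l: "real l * \<tau> \<le> T"
        have "(\<Sum>q\<in>{0..<l}. V q) \<le> ?c * ((real l - real 0) * \<tau>) + A0"
          by (rule scheme_mass_le[OF ws sp cells _ l _ _ mass]) (use A0 in auto)
        also have "\<dots> \<le> A" unfolding A_def using l c by (intro add_right_mono mult_left_mono) auto
        finally show "(\<Sum>q<l. V q) \<le> A" by (simp add: lessThan_atLeast0)
      next
        fix i l assume il: "i \<le> l" "real l * \<tau> \<le> T" and no: "\<And>q. q \<in> {i..<l} \<Longrightarrow> \<not> big_jump w \<tau> e q"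
        show "(\<Sum>q\<in>{i..<l}. V q) \<le> ?c * ((real l - real i) * \<tau>) + \<eta>"
        proof (rule scheme_mass_le[OF ws sp cells il])
          show "jump_mass (mu w) {0<..T} {0..1} {z. \<bar>z\<bar> \<le> e} \<le> ennreal \<eta>" using reg by (simp add: regular_jumps_def)
        qed (use \<eta> no_big_jump[OF ws no] in auto)
      next
        fix q assume "big_jump w \<tau> e q"
        then show "2 * (\<delta> / 2) < real (Suc q) * \<tau>" using big_jump_first[OF ws reg] by simp
      next
        fix q q' assume "big_jump w \<tau> e q" "big_jump w \<tau> e q'" "q < q'" "real (Suc q') * \<tau> \<le> T"
        then show "2 * (\<delta> / 2) < real (Suc q') * \<tau> - real q * \<tau>" using big_jump_isolated[OF ws reg _ _ _ \<tau>] by simp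
      next
        fix c d assume "c \<in> box (U + S * A)" "d \<in> box (U + S * A)" "\<And>k. k \<in> H \<Longrightarrow> cmod (c k - d k) \<le> \<zeta>"
        then show "sobolev_dist r c d \<le> 1 / real (Suc k)" using H(3) unfolding A'_def by blast
      qed (use c \<delta> K \<delta>\<zeta> in auto)
    qed (use \<delta> in auto)
  qed
  have "\<forall>k. \<exists>p. good k (fst p) (snd p)" using level by simp
  from choice[OF this] obtain p where p: "\<forall>k. good k (fst (p k)) (snd (p k))" ..
  define \<delta> where "\<delta> k = fst (p k)" for k
  define Bk where "Bk k = snd (p k)" for k
  have good: "good k (\<delta> k) (Bk k)" for k using p by (simp add: \<delta>_def Bk_def)
  have \<delta>: "0 < \<delta> k" and Bk: "Bk k \<in> sets M" "prob (Bk k) \<le> \<epsilon>0 * (1/2) ^ Suc (Suc k)" for k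
    using good[of k] unfolding good_def by blast+
  define B0 where "B0 = {w \<in> space M. \<not> jump_mass (mu w) {0<..T} {0..1} UNIV \<le> ennreal A0}"
  have [measurable]: "(\<lambda>w. jump_mass (mu w) {0<..T} {0..1} UNIV) \<in> borel_measurable M" by (intro jump_mass_measurable) auto
  have B0: "B0 \<in> sets M" unfolding B0_def by measurable
  define B where "B = B0 \<union> (\<Union>k. Bk k)"
  have B: "B \<in> sets M" unfolding B_def using B0 Bk(1) by auto
  have geo: "(\<lambda>k. \<epsilon>0 / 2 * (1/2) ^ Suc k) sums (\<epsilon>0 / 2)" using sums_mult[OF power_half_series, of "\<epsilon>0 / 2"] by simp
  have Bk': "prob (Bk k) \<le> \<epsilon>0 / 2 * (1/2) ^ Suc k" for k using Bk(2)[of k] by simp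
  have smb: "summable (\<lambda>k. prob (Bk k))"
    by (rule summable_comparison_test[OF _ sums_summable[OF geo]]) (use Bk' in auto)
  have "prob (\<Union>k. Bk k) \<le> (\<Sum>k. prob (Bk k))"
    by (rule finite_measure_subadditive_countably) (use Bk(1) smb in auto)
  also have "\<dots> \<le> (\<Sum>k. \<epsilon>0 / 2 * (1/2) ^ Suc k)" by (rule suminf_le[OF Bk' smb sums_summable[OF geo]])
  also have "\<dots> = \<epsilon>0 / 2" using geo by (simp add: sums_iff)
  finally have "prob (\<Union>k. Bk k) \<le> \<epsilon>0 / 2" .
  moreover have "prob B \<le> prob B0 + prob (\<Union>k. Bk k)" unfolding B_def using B0 Bk(1) by (intro measure_Un_le) auto
  moreover have "prob B0 \<le> \<epsilon>0 / 2" using A0(2) by (simp add: B0_def)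
  ultimately have pB: "prob B \<le> \<epsilon>0" by linarith
  let ?K = "modulus_class (sobolev r) T (box A') \<delta> (\<lambda>k. 1 / real (Suc k)) (\<lambda>k i. T + (real i + 1) * \<delta> k)"
  have K: "compactin (skorohod_topology (sobolev r) T) ?K"
    by (rule compactin_modulus_class[OF T compactin_box[OF r A'(2)] \<delta>]) (use LIMSEQ_Suc[OF lim_inverse_n'] in simp)
  have "AE w in M. w \<notin> B \<longrightarrow> sobolev_path T (u n \<tau> w) \<in> ?K" if adm: "(n, \<tau>) \<in> admissible \<theta> \<rho> \<epsilon>" for n \<tau>
  proof -
    have n\<tau>: "0 < n" "0 < \<tau>" using adm by (auto simp: admissible_def)
    show ?thesis
      using cell_noise_bound[OF n\<tau>(2,1)] AE_space
    proof eventually_elim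
      case (elim w)
      show ?case
      proof
        assume wB: "w \<notin> B"
        have sp: "scheme_path \<theta> \<sigma> u0 n \<tau> (\<lambda>B. L B w) (u n \<tau> w) \<rho> \<epsilon>"
          by unfold_locales (use scheme[OF adm elim(2)] adm \<theta> in auto)
        interpret scheme_path \<theta> \<sigma> u0 n \<tau> "\<lambda>B. L B w" "u n \<tau> w" \<rho> \<epsilon> by (rule sp)
        have mass: "jump_mass (mu w) {0<..T} {0..1} UNIV \<le> ennreal A0" using wB elim(2) by (auto simp: B_def B0_def)
        have "(\<Sum>q<l. V q) \<le> A" if l: "real l * \<tau> \<le> T" for l
        proof -
          have "(\<Sum>q\<in>{0..<l}. V q) \<le> ?c * ((real l - real 0) * \<tau>) + A0"
            by (rule scheme_mass_le[OF elim(2) sp elim(1) _ l _ _ mass]) (use A0 in auto)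
          also have "\<dots> \<le> A" unfolding A_def using l c by (intro add_right_mono mult_left_mono) auto
          finally show ?thesis by (simp add: lessThan_atLeast0)
        qed
        note V = this
        show "sobolev_path T (u n \<tau> w) \<in> ?K"
          unfolding modulus_class_def
        proof (intro CollectI conjI allI)
          show "sobolev_path T (u n \<tau> w) \<in> {0..T} \<rightarrow>\<^sub>E box A'"
            unfolding sobolev_path_eq
          proof (intro restrict_PiE_iff[THEN iffD2] ballI)
            fix t assume "t \<in> {0..T}"
            then have "real (grid_index \<tau> t) * \<tau> \<le> T" using grid_index_bounds(1)[OF n\<tau>(2), of t] by auto
            from path_in_box[OF S U V[OF this]]
            show "(\<lambda>k. cell_average n k * coef (grid_index \<tau> t) (fourier_root n k)) \<in> box A'" by (simp add: A'_def)
          qed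
          fix k
          have "w \<in> space M - Bk k" using wB elim(2) by (auto simp: B_def)
          then show "\<exists>s. (\<forall>i. s i \<le> T + (real i + 1) * \<delta> k) \<and>
              jump_modulus (sobolev r) T (sobolev_path T (u n \<tau> w)) s (\<delta> k) (1 / real (Suc k))"
            using good[of k] mass sp elim(1) unfolding good_def by blast
        qed
      qed
    qed
  qed
  with K B pB show ?thesis by (intro exI[of _ ?K] exI[of _ B]) auto
qed

lemma cell_noise_measurable:
  assumes \<tau>: "0 < \<tau>" and n: "0 < n" and j: "j \<in> {0..<int n}"
  shows "L (cell n \<tau> i j) \<in> borel_measurable M"
proof -
  let ?S = "{real i * \<tau>..<real (Suc i) * \<tau>}" and ?X = "{grid_point n j..<grid_point n (j + 1)}"
  have "0 \<le> real i * \<tau>" "0 \<le> grid_point n j" using \<tau> j by (simp_all add: grid_point_def)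
  moreover have "real_of_int (j + 1) \<le> real n" using j by simp
  then have "grid_point n (j + 1) \<le> 1" using n by (simp add: grid_point_def)
  ultimately have sub: "?S \<times> ?X \<subseteq> {0..} \<times> {0..1}" by auto
  have borel: "?S \<times> ?X \<in> sets borel" by (simp add: borel_prod[symmetric])
  have "emeasure lborel (?S \<times> ?X) = emeasure lborel ?S * emeasure lborel ?X"
    by (simp add: lborel_prod[symmetric] lborel.emeasure_pair_measure_Times)
  also have "\<dots> < \<infinity>" using \<tau> n by (simp add: ennreal_mult_less_top grid_point_def divide_right_mono)
  finally have fin: "emeasure lborel (?S \<times> ?X) < \<infinity>" .
  from noise[unfolded is_levy_noise_def, rule_format, OF borel sub fin] show ?thesis by (simp add: cell_def)
qed

end

theorem mainTheorem3:
  fixes T \<theta> \<rho> \<epsilon> b r :: real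
    and \<sigma> u0 :: "real \<Rightarrow> real"
    and lam :: "real measure"
    and M :: "'w measure"
    and F :: "real \<Rightarrow> 'w measure"
    and mu :: "'w \<Rightarrow> (real \<times> real \<times> real) measure"
    and L :: "(real \<times> real) set \<Rightarrow> 'w \<Rightarrow> real"
    and u :: "nat \<Rightarrow> real \<Rightarrow> 'w \<Rightarrow> real \<Rightarrow> real \<Rightarrow> real"
  assumes "T > 0" and "0 \<le> \<theta>" and "\<theta> \<le> 1"
    and "complete_filtered_prob_space M F"
    and "levy_measure lam" and "emeasure lam UNIV \<noteq> 0"
    and "poisson_random_measure M F lam mu"
    and "is_levy_noise M b lam mu L"
    and "\<forall>p\<in>{1..<3}. (\<integral>\<^sup>+z. ennreal (\<bar>z\<bar> powr p) \<partial>lam) < \<infinity>"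
    and "\<exists>C. C-lipschitz_on UNIV \<sigma>" and "bounded (range \<sigma>)"
    and "bounded (u0 ` {0..1})" and "\<forall>x\<in>{0..1}. 0 \<le> u0 x"
    and "u0 \<in> borel_measurable (restrict_space borel {0..1})"
    and "\<forall>(n, \<tau>)\<in>admissible \<theta> \<rho> \<epsilon>. \<forall>w\<in>space M.
           fully_discrete_scheme \<theta> \<sigma> u0 n \<tau> (\<lambda>B. L B w) (u n \<tau> w)"
    and "r < - 1/2"
  shows "weakly_relatively_compact M (skorohod_topology (sobolev r) T) (admissible \<theta> \<rho> \<epsilon>)
           (\<lambda>(n, \<tau>) w. sobolev_path T (u n \<tau> w))"
proof -
  \<comment> \<open>The case p = 1 of the moment assumption gives the noise finite
    variation.\<close>
  have "(\<integral>\<^sup>+z. ennreal (\<bar>z\<bar> powr 1) \<partial>lam) < \<infinity>" by (rule assms(9)[rule_format]) simp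
  then have first_moment: "(\<integral>\<^sup>+z. ennreal \<bar>z\<bar> \<partial>lam) < \<infinity>" by simp
  interpret noise: finite_variation_noise M F b lam mu L
    by unfold_locales (use assms(4,5,7,8) first_moment in auto)
  let ?X = "skorohod_topology (sobolev r) T" and ?I = "admissible \<theta> \<rho> \<epsilon>"
  let ?Y = "\<lambda>i w. (case i of (n, \<tau>) \<Rightarrow> \<lambda>w. sobolev_path T (u n \<tau> w)) w"
  interpret Sk: Metric_space "skorohod_carrier (sobolev r) T" "skorohod_dist (sobolev r) T"
    by (rule Metric_space_skorohod[OF assms(1)])
  have topo: "?X = Sk.mtopology"
    by (simp add: skorohod_topology_def mtopology_of_def Sk.mspace_metric Sk.mdist_metric)
  obtain S where S: "\<And>x. \<bar>\<sigma> x\<bar> \<le> S" using assms(11) by (auto simp: bounded_iff)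
  from assms(12) obtain U where "\<forall>x\<in>{0..1}. \<bar>u0 x\<bar> \<le> U" by (auto simp: bounded_iff)
  note U = this[rule_format]
  have \<sigma>: "\<sigma> \<in> borel_measurable borel"
    using assms(10) lipschitz_on_continuous_on by (auto intro: borel_measurable_continuous_onI)
  have scheme: "fully_discrete_scheme \<theta> \<sigma> u0 n \<tau> (\<lambda>B. L B w) (u n \<tau> w)"
    if "(n, \<tau>) \<in> ?I" "w \<in> space M" for n \<tau> w
    using assms(15) that by blast
  have meas: "(\<lambda>w. sobolev_path T (u n \<tau> w)) \<in> M \<rightarrow>\<^sub>M borel_of ?X" if adm: "(n, \<tau>) \<in> ?I" for n \<tau>
  proof -
    have n\<tau>: "0 < n" "0 < \<tau>" using adm by (auto simp: admissible_def)
    have path: "scheme_path \<theta> \<sigma> u0 n \<tau> (\<lambda>B. L B w) (u n \<tau> w) \<rho> \<epsilon>" if "w \<in> space M" for w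
      by unfold_locales (use scheme[OF adm that] adm assms(2,3) in auto)
    \<comment> \<open>The value 0 off the grid makes \<open>Z\<close> total on pairs of naturals;
      \<open>step_map\<close> reads indices j < n.\<close>
    define Z where "Z w = (\<lambda>(i, j). if j < n then u n \<tau> w (real i * \<tau>) (grid_point n (int j)) else 0)" for w
    have Z: "(\<lambda>w. Z w p) \<in> borel_measurable M" for p
    proof (cases p)
      case (Pair i j)
      then show ?thesis
        using scheme_measurable[OF path noise.cell_noise_measurable[OF n\<tau>(2,1)] \<sigma>, of j i] by (cases "j < n") (simp_all add: Z_def)
    qed
    have "sobolev_path T (u n \<tau> w) = step_map n \<tau> T (Z w)" if w: "w \<in> space M" for w
    proof -
      interpret scheme_path \<theta> \<sigma> u0 n \<tau> "\<lambda>B. L B w" "u n \<tau> w" \<rho> \<epsilon> by (rule path[OF w])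
      show ?thesis unfolding sobolev_path_eq step_map_def by (simp add: coef_def X_def Z_def cong: restrict_cong)
    qed
    then show ?thesis
      using step_map_measurable[OF assms(1) n\<tau>(2,1) assms(16) Z] by (simp cong: measurable_cong)
  qed
  have "relatively_compactin (weak_topology Sk.mtopology) ((\<lambda>i. distr M (borel_of ?X) (?Y i)) ` ?I)"
  proof (rule Sk.tight_imp_relatively_compactin)
    show "(\<lambda>i. distr M (borel_of ?X) (?Y i)) ` ?I \<subseteq> prob_measures_on Sk.mtopology"
      using noise.prob_space_distr[OF meas] by (auto simp: prob_measures_on_def topo)
    fix e :: real assume "0 < e"
    have "\<exists>K B. compactin ?X K \<and> B \<in> sets M \<and> noise.prob B \<le> e \<and>
        (\<forall>(n, \<tau>)\<in>?I. AE w in M. w \<notin> B \<longrightarrow> sobolev_path T (u n \<tau> w) \<in> K)"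
      by (rule noise.paths_tight[OF assms(1,16,2,3) \<open>0 < e\<close> S U scheme])
    then obtain K B where K: "compactin ?X K" and B: "B \<in> sets M" "noise.prob B \<le> e"
      and tight: "\<forall>(n, \<tau>)\<in>?I. AE w in M. w \<notin> B \<longrightarrow> sobolev_path T (u n \<tau> w) \<in> K"
      by (elim exE conjE)
    have "closedin Sk.mtopology K"
      using compactin_imp_closedin[OF Sk.Hausdorff_space_mtopology] K by (simp add: topo)
    then have "openin ?X (skorohod_carrier (sobolev r) T - K)" unfolding topo by (simp add: closedin_def)
    then have opn: "skorohod_carrier (sobolev r) T - K \<in> sets (borel_of ?X)" by (rule borel_of_open)
    have "measure N (skorohod_carrier (sobolev r) T - K) \<le> e"
      if N: "N \<in> (\<lambda>i. distr M (borel_of ?X) (?Y i)) ` ?I" for N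
    proof -
      obtain n \<tau> where adm: "(n, \<tau>) \<in> ?I" and N_eq: "N = distr M (borel_of ?X) (\<lambda>w. sobolev_path T (u n \<tau> w))"
        using N by auto
      have "measure N (skorohod_carrier (sobolev r) T - K) =
          noise.prob ((\<lambda>w. sobolev_path T (u n \<tau> w)) -` (skorohod_carrier (sobolev r) T - K) \<inter> space M)"
        unfolding N_eq by (rule measure_distr[OF meas[OF adm] opn])
      also have "\<dots> \<le> noise.prob B"
      proof (rule noise.finite_measure_mono_AE[OF _ B(1)])
        have "AE w in M. w \<notin> B \<longrightarrow> sobolev_path T (u n \<tau> w) \<in> K" using tight adm by auto
        then show "AE w in M. w \<in> (\<lambda>w. sobolev_path T (u n \<tau> w)) -` (skorohod_carrier (sobolev r) T - K) \<inter> space M \<longrightarrow> w \<in> B"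
          by eventually_elim auto
      qed
      finally show ?thesis using B(2) by simp
    qed
    then show "\<exists>K. compactin Sk.mtopology K \<and>
        (\<forall>N\<in>(\<lambda>i. distr M (borel_of ?X) (?Y i)) ` ?I. measure N (skorohod_carrier (sobolev r) T - K) \<le> e)"
      using K unfolding topo by blast
  qed
  then show ?thesis
    unfolding weakly_relatively_compact_def topo using meas by (auto simp: topo)
qed

end
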